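(* Let $(M,g)$ be an oriented space-time, not of constant curvature, admitting a null conformal Killing-Yano tensor $A$ such that $Z_1\equiv\delta A$ and $Z_2\equiv\delta{*A}$ are Killing vectors verifying $Z_1\wedge Z_2\neq0$. Then: (i) $\{Z_1,Z_2\}$ define a commutative algebra: $[Z_1,Z_2]=0$; (ii) the CKY tensor is $Z_i$-invariant: $\mathcal L_{Z_1}A=\mathcal L_{Z_2}A=0$; (iii) the space-time is conformally flat, i.e. its Weyl tensor vanishes, $W=0$; (iv) the Ricci tensor can be written $Ric=\sigma\,\ell\otimes\ell+\Lambda g$ with $\sigma,\Lambda$ functions and $d\Lambda\neq0$, where $\ell$ is the fundamental vector of $A$.
   Context: A space-time is an oriented 4-dimensional smooth manifold with metric $g$ of signature $(-,+,+,+)$ and volume element $\eta$; vectors and 1-forms are identified through $g$; all considerations are local. $\nabla$ is the Levi-Civita connection, $\mathcal L$ the Lie derivative, $*$ the Hodge dual, $( *A)_{\alpha\beta}=\frac12\eta_{\alpha\beta\gamma\delta}A^{\gamma\delta}$, and the codifferential is $(\delta\omega)_{\underline p}=-\nabla_\alpha\omega^{\alpha}{}_{\underline p}$. For a real two-form $A$ put $\mathcal A=\frac1{\sqrt2}(A-\mathrm i*A)$. $A$ is a conformal Killing-Yano (CKY) tensor if $3\nabla_\alpha\mathcal A_{\beta\gamma}=2\mathcal Z^\mu\mathcal G_{\mu\alpha\beta\gamma}$, with $\mathcal Z=\delta\mathcal A$, $\mathcal G=\frac12(G-\mathrm i\eta)$, $G_{\alpha\beta\gamma\delta}=g_{\alpha\gamma}g_{\beta\delta}-g_{\alpha\delta}g_{\beta\gamma}$.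 $A$ is null if $A\neq0$ and $\mathcal A_{\alpha\beta}\mathcal A^{\alpha\beta}=0$. Then $\mathcal A=\ell\wedge m$ with $\ell$ a real null vector (the fundamental vector of $A$) and $m$ a complex null vector with $(m,\ell)=0$, $(m,\bar m)=1$. *)

theory Defs
  imports "HOL-Analysis.Analysis"
begin

text \<open>
  All notions are local, so a space-time is modelled by a coordinate domain: an open connected
  \<open>M \<subseteq> \<real>\<^sup>4\<close> carrying the component functions of the metric.  A tensor field is the function sending
  a point to its components in the coordinate frame.  One-forms and two-forms are stored with lower
  indices; \<open>raise\<close> turns a one-form into the vector identified with it.  Component functions
  are total, and only their values on \<open>M\<close> matter.
\<close>

type_synonym point = "real ^ 4"
type_synonym metric = "point \<Rightarrow> real ^ 4 ^ 4"
type_synonym 'b form1 = "point \<Rightarrow> 4 \<Rightarrow> 'b"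
type_synonym 'b form2 = "point \<Rightarrow> 4 \<Rightarrow> 4 \<Rightarrow> 'b"

subsection \<open>Smooth functions and partial derivatives\<close>

primrec Ck_on :: "nat \<Rightarrow> 'a::real_normed_vector set \<Rightarrow> ('a \<Rightarrow> 'b::real_normed_vector) \<Rightarrow> bool" where
  "Ck_on 0 S f \<longleftrightarrow> continuous_on S f"
| "Ck_on (Suc k) S f \<longleftrightarrow>
     f differentiable_on S \<and> (\<forall>v. Ck_on k S (\<lambda>x. frechet_derivative f (at x) v))"

definition smooth_on :: "'a::real_normed_vector set \<Rightarrow> ('a \<Rightarrow> 'b::real_normed_vector) \<Rightarrow> bool" where
  "smooth_on S f \<longleftrightarrow> (\<forall>k. Ck_on k S f)"

definition pd :: "4 \<Rightarrow> (point \<Rightarrow> 'b::real_normed_vector) \<Rightarrow> point \<Rightarrow> 'b" where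
  "pd a f p = frechet_derivative f (at p) (axis a 1)"

subsection \<open>Oriented space-times\<close>

definition minkowski :: "real ^ 4 ^ 4" where
  "minkowski = (\<chi> i j. if i = j then (if i = 1 then - 1 else 1) else 0)"

definition lorentzian :: "real ^ 4 ^ 4 \<Rightarrow> bool" where
  "lorentzian G \<longleftrightarrow> transpose G = G \<and>
     (\<exists>P :: real ^ 4 ^ 4. invertible P \<and> transpose P ** G ** P = minkowski)"

text \<open>
  The sign \<open>os\<close> is the orientation of the connected domain \<open>M\<close> relative to its coordinates.
\<close>

definition oriented_spacetime :: "point set \<Rightarrow> metric \<Rightarrow> real \<Rightarrow> bool" where
  "oriented_spacetime M g os \<longleftrightarrow>
     open M \<and> connected M \<and> smooth_on M g \<and> (\<forall>p\<in>M. lorentzian (g p)) \<and> (os = 1 \<or> os = - 1)"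

definition ginv :: "metric \<Rightarrow> metric" where
  "ginv g p = matrix_inv (g p)"

definition volume_element :: "metric \<Rightarrow> real \<Rightarrow> point \<Rightarrow> 4 \<Rightarrow> 4 \<Rightarrow> 4 \<Rightarrow> 4 \<Rightarrow> real" where
  "volume_element g os p a b c d = os * sqrt \<bar>det (g p)\<bar> *
     det (\<chi> i. axis (if i = 1 then a else if i = 2 then b else if i = 3 then c else d) 1
          :: real ^ 4 ^ 4)"

definition raise :: "metric \<Rightarrow> 'b::real_vector form1 \<Rightarrow> 'b form1" where
  "raise g w p a = (\<Sum>b\<in>UNIV. ginv g p $ a $ b *\<^sub>R w p b)"

definition raise2 :: "metric \<Rightarrow> 'b::real_vector form2 \<Rightarrow> 'b form2" where
  "raise2 g T p a b = (\<Sum>c\<in>UNIV. \<Sum>d\<in>UNIV. (ginv g p $ a $ c * ginv g p $ b $ d) *\<^sub>R T p c d)"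

text \<open>The bilinear (not sesquilinear) extension of the inverse metric to complex covectors.\<close>

definition ip :: "metric \<Rightarrow> point \<Rightarrow> (4 \<Rightarrow> complex) \<Rightarrow> (4 \<Rightarrow> complex) \<Rightarrow> complex" where
  "ip g p u v = (\<Sum>a\<in>UNIV. \<Sum>b\<in>UNIV. of_real (ginv g p $ a $ b) * u a * v b)"

subsection \<open>Levi-Civita connection and curvature\<close>

text \<open>\<open>christoffel g p c a b\<close> is \<open>\<Gamma>\<^sup>c\<^sub>a\<^sub>b\<close>, and \<open>nabla2 g T p a b c\<close> is \<open>\<nabla>\<^sub>a T\<^sub>b\<^sub>c\<close>.\<close>

definition christoffel :: "metric \<Rightarrow> point \<Rightarrow> 4 \<Rightarrow> 4 \<Rightarrow> 4 \<Rightarrow> real" where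
  "christoffel g p c a b = (\<Sum>d\<in>UNIV. ginv g p $ c $ d *
     (pd a (\<lambda>x. g x $ b $ d) p + pd b (\<lambda>x. g x $ a $ d) p - pd d (\<lambda>x. g x $ a $ b) p)) / 2"

definition nabla2 ::
    "metric \<Rightarrow> 'b::real_normed_vector form2 \<Rightarrow> point \<Rightarrow> 4 \<Rightarrow> 4 \<Rightarrow> 4 \<Rightarrow> 'b" where
  "nabla2 g T p a b c = pd a (\<lambda>x. T x b c) p
     - (\<Sum>d\<in>UNIV. christoffel g p d a b *\<^sub>R T p d c)
     - (\<Sum>d\<in>UNIV. christoffel g p d a c *\<^sub>R T p b d)"

text \<open>\<open>riemann_up g p a b c d\<close> is \<open>R\<^sup>a\<^sub>b\<^sub>c\<^sub>d\<close>, in the convention in which the curvature of the unit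
  sphere is \<open>R\<^sub>a\<^sub>b\<^sub>c\<^sub>d = g\<^sub>a\<^sub>c g\<^sub>b\<^sub>d - g\<^sub>a\<^sub>d g\<^sub>b\<^sub>c\<close>.\<close>

definition riemann_up :: "metric \<Rightarrow> point \<Rightarrow> 4 \<Rightarrow> 4 \<Rightarrow> 4 \<Rightarrow> 4 \<Rightarrow> real" where
  "riemann_up g p a b c d =
     pd c (\<lambda>x. christoffel g x a d b) p - pd d (\<lambda>x. christoffel g x a c b) p
     + (\<Sum>e\<in>UNIV. christoffel g p a c e * christoffel g p e d b
                - christoffel g p a d e * christoffel g p e c b)"

definition riemann :: "metric \<Rightarrow> point \<Rightarrow> 4 \<Rightarrow> 4 \<Rightarrow> 4 \<Rightarrow> 4 \<Rightarrow> real" where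
  "riemann g p a b c d = (\<Sum>e\<in>UNIV. g p $ a $ e * riemann_up g p e b c d)"

definition ricci :: "metric \<Rightarrow> point \<Rightarrow> 4 \<Rightarrow> 4 \<Rightarrow> real" where
  "ricci g p a b = (\<Sum>c\<in>UNIV. riemann_up g p c a c b)"

definition scalar_curvature :: "metric \<Rightarrow> point \<Rightarrow> real" where
  "scalar_curvature g p = (\<Sum>a\<in>UNIV. \<Sum>b\<in>UNIV. ginv g p $ a $ b * ricci g p a b)"

definition Gtensor :: "metric \<Rightarrow> point \<Rightarrow> 4 \<Rightarrow> 4 \<Rightarrow> 4 \<Rightarrow> 4 \<Rightarrow> real" where
  "Gtensor g p a b c d = g p $ a $ c * g p $ b $ d - g p $ a $ d * g p $ b $ c"

definition weyl :: "metric \<Rightarrow> point \<Rightarrow> 4 \<Rightarrow> 4 \<Rightarrow> 4 \<Rightarrow> 4 \<Rightarrow> real" where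
  "weyl g p a b c d = riemann g p a b c d
     - (g p $ a $ c * ricci g p b d - g p $ a $ d * ricci g p b c
        - g p $ b $ c * ricci g p a d + g p $ b $ d * ricci g p a c) / 2
     + scalar_curvature g p / 6 * Gtensor g p a b c d"

text \<open>For a singleton \<open>U = {p}\<close> this is the pointwise condition that all sectional curvatures at
  \<open>p\<close> coincide.\<close>

definition constant_curvature_on :: "point set \<Rightarrow> metric \<Rightarrow> bool" where
  "constant_curvature_on U g \<longleftrightarrow>
     (\<exists>K. \<forall>p\<in>U. \<forall>a b c d. riemann g p a b c d = K * Gtensor g p a b c d)"

subsection \<open>Lie derivatives, Killing vectors\<close>

definition lie_bracket :: "real form1 \<Rightarrow> real form1 \<Rightarrow> real form1" where
  "lie_bracket X Y p a =
     (\<Sum>c\<in>UNIV. X p c * pd c (\<lambda>x. Y x a) p - Y p c * pd c (\<lambda>x. X x a) p)"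

definition lie_derivative2 :: "real form1 \<Rightarrow> real form2 \<Rightarrow> real form2" where
  "lie_derivative2 X T p a b =
     (\<Sum>c\<in>UNIV. X p c * pd c (\<lambda>x. T x a b) p
        + T p c b * pd a (\<lambda>x. X x c) p + T p a c * pd b (\<lambda>x. X x c) p)"

definition killing_vector_on :: "point set \<Rightarrow> metric \<Rightarrow> real form1 \<Rightarrow> bool" where
  "killing_vector_on M g X \<longleftrightarrow>
     (\<forall>p\<in>M. \<forall>a b. lie_derivative2 X (\<lambda>x i j. g x $ i $ j) p a b = 0)"

subsection \<open>Two-forms and conformal Killing-Yano tensors\<close>

definition smooth_two_form_on :: "point set \<Rightarrow> real form2 \<Rightarrow> bool" where
  "smooth_two_form_on M A \<longleftrightarrow>
     (\<forall>a b. smooth_on M (\<lambda>p. A p a b)) \<and> (\<forall>p\<in>M. \<forall>a b. A p b a = - A p a b)"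

definition wedge :: "(4 \<Rightarrow> 'b::comm_ring_1) \<Rightarrow> (4 \<Rightarrow> 'b) \<Rightarrow> 4 \<Rightarrow> 4 \<Rightarrow> 'b" where
  "wedge u v a b = u a * v b - u b * v a"

definition hodge :: "metric \<Rightarrow> real \<Rightarrow> real form2 \<Rightarrow> real form2" where
  "hodge g os A p a b =
     (\<Sum>c\<in>UNIV. \<Sum>d\<in>UNIV. volume_element g os p a b c d * raise2 g A p c d) / 2"

definition codiff :: "metric \<Rightarrow> 'b::real_normed_vector form2 \<Rightarrow> 'b form1" where
  "codiff g T p c = - (\<Sum>a\<in>UNIV. \<Sum>b\<in>UNIV. ginv g p $ a $ b *\<^sub>R nabla2 g T p a b c)"

definition self_dual :: "metric \<Rightarrow> real \<Rightarrow> real form2 \<Rightarrow> complex form2" where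
  "self_dual g os A p a b =
     (of_real (A p a b) - \<i> * of_real (hodge g os A p a b)) / of_real (sqrt 2)"

definition self_dual_metric ::
    "metric \<Rightarrow> real \<Rightarrow> point \<Rightarrow> 4 \<Rightarrow> 4 \<Rightarrow> 4 \<Rightarrow> 4 \<Rightarrow> complex" where
  "self_dual_metric g os p a b c d =
     (of_real (Gtensor g p a b c d) - \<i> * of_real (volume_element g os p a b c d)) / 2"

definition cky_tensor_on :: "point set \<Rightarrow> metric \<Rightarrow> real \<Rightarrow> real form2 \<Rightarrow> bool" where
  "cky_tensor_on M g os A \<longleftrightarrow> smooth_two_form_on M A \<and>
     (\<forall>p\<in>M. \<forall>a b c. 3 * nabla2 g (self_dual g os A) p a b c =
        2 * (\<Sum>m\<in>UNIV. raise g (codiff g (self_dual g os A)) p m * self_dual_metric g os p m a b c))"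

definition null_two_form_at :: "metric \<Rightarrow> real \<Rightarrow> real form2 \<Rightarrow> point \<Rightarrow> bool" where
  "null_two_form_at g os A p \<longleftrightarrow> (\<exists>a b. A p a b \<noteq> 0) \<and>
     (\<Sum>a\<in>UNIV. \<Sum>b\<in>UNIV. self_dual g os A p a b * raise2 g (self_dual g os A) p a b) = 0"

text \<open>
  At each point the covector \<open>l\<close> is determined by \<open>A\<close> only up to sign (and \<open>m\<close> up to that sign and
  up to adding multiples of \<open>l\<close>), so being a fundamental vector is a predicate on \<open>l\<close>.
\<close>

definition fundamental_vector_at ::
    "metric \<Rightarrow> real \<Rightarrow> real form2 \<Rightarrow> point \<Rightarrow> (4 \<Rightarrow> real) \<Rightarrow> bool" where
  "fundamental_vector_at g os A p l \<longleftrightarrow>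
     (\<exists>m :: 4 \<Rightarrow> complex. let L = (\<lambda>a. complex_of_real (l a)) in
        ip g p L L = 0 \<and> ip g p m m = 0 \<and> ip g p m L = 0 \<and> ip g p m (\<lambda>a. cnj (m a)) = 1 \<and>
        self_dual g os A p = wedge L m)"

end

(*
  In spinor language a null self-dual form is o o, the CKY equation makes it a Killing spinor, and
  Z1 - i Z2 corresponds to a vector o kappa with (kappa, o-bar) nowhere zero because Z1 and Z2 are
  independent.  The Ricci identity for A together with the Killing property leaves only a scalar
  Lambda, a component sigma of the Ricci tensor along l l and a type N Weyl tensor, and shows that
  F_i = nabla Z_i satisfy F_1 - *F_2 = Lambda A.  Differentiating (Z1 - i Z2) . (A - i *A) = 0 shows
  that the anti-self-dual part of F_1 - i F_2 is a null form proportional to kappa kappa; by the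
  Killing identity nabla nabla Z = R Z, the derivative of its vanishing norm forces W = 0, and the
  derivative of F_1 - *F_2 = Lambda A gives d Lambda = - a sigma l and b sigma = 0, where
  (kappa, o-bar) = a + i b up to a phase.  Finally b b is a scalar polynomial in Z, nabla Z and A
  whose gradient vanishes identically, so b = 0 everywhere as soon as sigma is nonzero somewhere;
  and b is the only obstruction to [Z1, Z2] = 0 and to the invariance of A.

  Everything is evaluated at one point p in a null frame (l, n, x, y) with A = l wedge x, extended
  to a frame field whose covariant derivative vanishes at p.
*)
theory Submission
  imports Defs
begin

subsection \<open>Smooth functions\<close>

text \<open>The obstacle is to differentiate facts that were read off in an adapted frame. The frame
  field used at \<open>p\<close> is adapted to \<open>A\<close> at \<open>p\<close> only, and a
  field adapted in a whole neighbourhood would bring in unknown connection coefficients. Each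
  algebraic consequence is therefore restated as a tensor identity without a frame; it holds at
  every point because every point has an adapted frame of its own, and only then is it
  differentiated at \<open>p\<close>. \<open>dot2_zero\<close>, \<open>null_contraction\<close>,
  \<open>duality\<close> and \<open>derivative_norms\<close> are such restatements, and this
  alternation of algebra and differentiation is why the component algebra is split into
  \<open>null_algebra1\<close> to \<open>null_algebra4\<close>.

  A second obstacle is that \<open>A\<close> fixes its fundamental vector l only up to sign at each
  point, so smooth coefficients cannot be built from a pointwise choice of l. They are built from
  \<open>fundamental_square\<close>, which equals the product of l with itself but is polynomial in
  \<open>A\<close> and the inverse metric. In the same way \<open>b\<close> is a mere frame
  component, and what is differentiated in its place is the scalar \<open>defect\<close>.\<close>

lemma Ck_on_Suc_has_derivative:
  assumes "open S" "Ck_on (Suc k) S f" "x \<in> S"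
  shows "(f has_derivative frechet_derivative f (at x)) (at x)"
  using assms by (metis Ck_on.simps(2) at_within_open differentiable_on_def frechet_derivative_works)

lemma Ck_on_SucI:
  assumes "open S" and f: "\<And>x. x \<in> S \<Longrightarrow> (f has_derivative f' x) (at x)"
    and cong: "\<And>v. Ck_on k S (\<lambda>x. frechet_derivative f (at x) v)"
  shows "Ck_on (Suc k) S f"
  using assms unfolding Ck_on.simps
  by (meson differentiable_at_imp_differentiable_on differentiableI)

text \<open>\<open>frechet_derivative f (at x)\<close> depends on \<open>f\<close> near
  \<open>x\<close>, so agreement on \<open>S\<close> carries over to derivatives because
  \<open>S\<close> is open.\<close>

lemma Ck_on_cong:
  assumes "open S" "\<And>x. x \<in> S \<Longrightarrow> f x = h x" "Ck_on k S f"
  shows "Ck_on k S h"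
  using assms(2,3)
proof (induction k arbitrary: f h)
  case 0
  then show ?case using continuous_on_cong by (metis Ck_on.simps(1))
next
  case (Suc k)
  have d: "(f has_derivative frechet_derivative f (at x)) (at x)" if "x \<in> S" for x
    using Ck_on_Suc_has_derivative[OF \<open>open S\<close> Suc.prems(2) that] .
  have d': "(h has_derivative frechet_derivative f (at x)) (at x)" if "x \<in> S" for x
    using has_derivative_transform_within_open[OF d[OF that] \<open>open S\<close> that] Suc.prems(1) by simp
  have eq: "frechet_derivative f (at x) = frechet_derivative h (at x)" if "x \<in> S" for x
    using d'[OF that] by (rule frechet_derivative_at)
  have "Ck_on k S (\<lambda>x. frechet_derivative h (at x) v)" for v
    by (rule Suc.IH[of "\<lambda>x. frechet_derivative f (at x) v"]) (use Suc.prems(2) in \<open>simp_all add: eq\<close>)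
  then show ?case by (intro Ck_on_SucI[OF \<open>open S\<close> d'])
qed

text \<open>Lets an explicit formula stand in for the derivative that
  \<open>frechet_derivative\<close> chooses; the closure rules below all go through it.\<close>

lemma Ck_on_SucI':
  assumes "open S" "\<And>x. x \<in> S \<Longrightarrow> (f has_derivative f' x) (at x)" "\<And>v. Ck_on k S (\<lambda>x. f' x v)"
  shows "Ck_on (Suc k) S f"
  using assms(1,2)
proof (rule Ck_on_SucI)
  fix v
  show "Ck_on k S (\<lambda>x. frechet_derivative f (at x) v)"
    by (rule Ck_on_cong[OF assms(1) _ assms(3)[of v]]) (simp add: frechet_derivative_at[OF assms(2), symmetric])
qed

text \<open>Needed for products and reciprocals, whose derivatives contain the undifferentiated
  functions again.\<close>

lemma Ck_on_SucD: "Ck_on (Suc k) S f \<Longrightarrow> Ck_on k S f"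
proof (induction k arbitrary: f)
  case 0
  then show ?case by (simp add: differentiable_imp_continuous_on)
next
  case (Suc k)
  then have "Ck_on (Suc k) S (\<lambda>x. frechet_derivative f (at x) v)" for v
    by (simp only: Ck_on.simps(2)[of "Suc k"])
  then have "Ck_on k S (\<lambda>x. frechet_derivative f (at x) v)" for v
    by (rule Suc.IH)
  with Suc.prems show ?case by simp
qed

lemma Ck_on_const: "Ck_on k S (\<lambda>x. c)"
  by (induction k arbitrary: c) auto

lemma Ck_on_bounded_linear:
  assumes "open S" "bounded_linear L" "Ck_on k S f"
  shows "Ck_on k S (\<lambda>x. L (f x))"
  using assms(3)
proof (induction k arbitrary: f)
  case 0
  then show ?case using assms(2) by (auto intro: bounded_linear.continuous_on)
next
  case (Suc k)
  show ?case
  proof (rule Ck_on_SucI'[OF assms(1)])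
    show "((\<lambda>x. L (f x)) has_derivative (\<lambda>v. L (frechet_derivative f (at x) v))) (at x)" if "x \<in> S" for x
      using bounded_linear.has_derivative[OF assms(2) Ck_on_Suc_has_derivative[OF assms(1) Suc.prems that]] .
    show "Ck_on k S (\<lambda>x. L (frechet_derivative f (at x) v))" for v
      using Suc by simp
  qed
qed

lemma Ck_on_add:
  assumes "open S" "Ck_on k S f" "Ck_on k S h"
  shows "Ck_on k S (\<lambda>x. f x + h x)"
  using assms(2,3)
proof (induction k arbitrary: f h)
  case 0
  then show ?case by (auto intro: continuous_on_add)
next
  case (Suc k)
  show ?case
  proof (rule Ck_on_SucI'[OF assms(1)])
    show "((\<lambda>x. f x + h x) has_derivative (\<lambda>v. frechet_derivative f (at x) v + frechet_derivative h (at x) v)) (at x)" if "x \<in> S" for x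
      using Suc.prems that by (intro has_derivative_add Ck_on_Suc_has_derivative[OF assms(1)])
    show "Ck_on k S (\<lambda>x. frechet_derivative f (at x) v + frechet_derivative h (at x) v)" for v
      using Suc by simp
  qed
qed

lemma Ck_on_mult:
  fixes f h :: "'a::real_normed_vector \<Rightarrow> 'b::real_normed_algebra"
  assumes "open S" "Ck_on k S f" "Ck_on k S h"
  shows "Ck_on k S (\<lambda>x. f x * h x)"
  using assms(2,3)
proof (induction k arbitrary: f h)
  case 0
  then show ?case by (auto intro: continuous_on_mult)
next
  case (Suc k)
  show ?case
  proof (rule Ck_on_SucI'[OF assms(1)])
    show "((\<lambda>x. f x * h x) has_derivative (\<lambda>v. f x * frechet_derivative h (at x) v + frechet_derivative f (at x) v * h x)) (at x)" if "x \<in> S" for x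
      using Suc.prems that by (intro has_derivative_mult Ck_on_Suc_has_derivative[OF assms(1)])
    show "Ck_on k S (\<lambda>x. f x * frechet_derivative h (at x) v + frechet_derivative f (at x) v * h x)" for v
      using Suc.prems Ck_on_SucD[OF Suc.prems(1)] Ck_on_SucD[OF Suc.prems(2)]
      by (intro Ck_on_add[OF assms(1)] Suc.IH) auto
  qed
qed

text \<open>The derivative of \<open>1 / f\<close> is a polynomial in \<open>1 / f\<close> and the
  derivative of \<open>f\<close>, so order \<open>k\<close> of \<open>1 / f\<close>, the induction
  hypothesis, yields the next order.\<close>

lemma Ck_on_inverse:
  fixes f :: "'a::real_normed_vector \<Rightarrow> real"
  assumes "open S" "Ck_on k S f" "\<And>x. x \<in> S \<Longrightarrow> f x \<noteq> 0"
  shows "Ck_on k S (\<lambda>x. inverse (f x))"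
  using assms(2)
proof (induction k)
  case 0
  then show ?case using assms(3) by (auto intro!: continuous_intros)
next
  case (Suc k)
  have IH: "Ck_on k S (\<lambda>x. inverse (f x))" using Suc Ck_on_SucD by blast
  show ?case
  proof (rule Ck_on_SucI'[OF assms(1)])
    show "((\<lambda>x. inverse (f x)) has_derivative (\<lambda>v. (- 1) * (inverse (f x) * frechet_derivative f (at x) v * inverse (f x)))) (at x)" if "x \<in> S" for x
      using Deriv.has_derivative_inverse[OF assms(3)[OF that] Ck_on_Suc_has_derivative[OF assms(1) Suc.prems that]] by simp
    show "Ck_on k S (\<lambda>x. (- 1) * (inverse (f x) * frechet_derivative f (at x) v * inverse (f x)))" for v
      using Suc.prems by (intro Ck_on_mult[OF assms(1)] Ck_on_const IH) auto
  qed
qed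

lemma Ck_on_sqrt:
  fixes f :: "'a::real_normed_vector \<Rightarrow> real"
  assumes "open S" "Ck_on k S f" "\<And>x. x \<in> S \<Longrightarrow> f x > 0"
  shows "Ck_on k S (\<lambda>x. sqrt (f x))"
  using assms(2)
proof (induction k)
  case 0
  then show ?case by (auto intro!: continuous_intros)
next
  case (Suc k)
  have IH: "Ck_on k S (\<lambda>x. sqrt (f x))" using Suc Ck_on_SucD by blast
  show ?case
  proof (rule Ck_on_SucI'[OF assms(1)])
    show "((\<lambda>x. sqrt (f x)) has_derivative (\<lambda>v. (1 / 2) * (inverse (sqrt (f x)) * frechet_derivative f (at x) v))) (at x)" if "x \<in> S" for x
      using has_derivative_real_sqrt[OF assms(3)[OF that] Ck_on_Suc_has_derivative[OF assms(1) Suc.prems that]]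
      by (simp add: field_simps)
    have "Ck_on k S (\<lambda>x. inverse (sqrt (f x)))"
      using assms(3) by (intro Ck_on_inverse[OF assms(1) IH]) (metis less_irrefl real_sqrt_eq_0_iff)
    then show "Ck_on k S (\<lambda>x. (1 / 2) * (inverse (sqrt (f x)) * frechet_derivative f (at x) v))" for v
      using Suc.prems by (intro Ck_on_mult[OF assms(1)] Ck_on_const) auto
  qed
qed

lemma smooth_on_cong:
  "open S \<Longrightarrow> (\<And>x. x \<in> S \<Longrightarrow> f x = h x) \<Longrightarrow> smooth_on S f \<Longrightarrow> smooth_on S h"
  unfolding smooth_on_def by (metis Ck_on_cong)

lemma smooth_on_subset_open:
  assumes "smooth_on S f" "open T" "T \<subseteq> S" "open S"
  shows "smooth_on T f"
proof -
  have "Ck_on k S f \<Longrightarrow> Ck_on k T f" for k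
    by (induction k arbitrary: f) (use assms in \<open>auto intro: continuous_on_subset differentiable_on_subset\<close>)
  then show ?thesis using assms(1) by (simp add: smooth_on_def)
qed

lemma smooth_on_const [simp]: "smooth_on S (\<lambda>x. c)"
  by (simp add: smooth_on_def Ck_on_const)

lemma smooth_on_bounded_linear:
  "open S \<Longrightarrow> bounded_linear L \<Longrightarrow> smooth_on S f \<Longrightarrow> smooth_on S (\<lambda>x. L (f x))"
  unfolding smooth_on_def using Ck_on_bounded_linear by blast

lemma smooth_on_add: "open S \<Longrightarrow> smooth_on S f \<Longrightarrow> smooth_on S h \<Longrightarrow> smooth_on S (\<lambda>x. f x + h x)"
  unfolding smooth_on_def using Ck_on_add by blast

lemma smooth_on_mult:
  fixes f h :: "'a::real_normed_vector \<Rightarrow> 'b::real_normed_algebra"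
  shows "open S \<Longrightarrow> smooth_on S f \<Longrightarrow> smooth_on S h \<Longrightarrow> smooth_on S (\<lambda>x. f x * h x)"
  unfolding smooth_on_def using Ck_on_mult by blast

lemma smooth_on_minus: "open S \<Longrightarrow> smooth_on S f \<Longrightarrow> smooth_on S (\<lambda>x. - f x)"
  by (rule smooth_on_bounded_linear[of S uminus]) (auto intro: bounded_linear_minus bounded_linear_ident)

lemma smooth_on_diff: "open S \<Longrightarrow> smooth_on S f \<Longrightarrow> smooth_on S h \<Longrightarrow> smooth_on S (\<lambda>x. f x - h x)"
  using smooth_on_add[of S f "\<lambda>x. - h x"] smooth_on_minus[of S h] by simp

lemma smooth_on_inverse:
  fixes f :: "'a::real_normed_vector \<Rightarrow> real"
  shows "open S \<Longrightarrow> smooth_on S f \<Longrightarrow> (\<And>x. x \<in> S \<Longrightarrow> f x \<noteq> 0) \<Longrightarrow> smooth_on S (\<lambda>x. inverse (f x))"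
  unfolding smooth_on_def using Ck_on_inverse by blast

lemma smooth_on_divide:
  fixes f :: "'a::real_normed_vector \<Rightarrow> real"
  shows "open S \<Longrightarrow> smooth_on S f \<Longrightarrow> smooth_on S h \<Longrightarrow> (\<And>x. x \<in> S \<Longrightarrow> h x \<noteq> 0) \<Longrightarrow> smooth_on S (\<lambda>x. f x / h x)"
  unfolding divide_inverse by (intro smooth_on_mult smooth_on_inverse)

lemma smooth_on_sqrt:
  fixes f :: "'a::real_normed_vector \<Rightarrow> real"
  shows "open S \<Longrightarrow> smooth_on S f \<Longrightarrow> (\<And>x. x \<in> S \<Longrightarrow> f x > 0) \<Longrightarrow> smooth_on S (\<lambda>x. sqrt (f x))"
  unfolding smooth_on_def using Ck_on_sqrt by blast

lemma smooth_on_sum: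
  assumes "open S" "\<And>i. i \<in> I \<Longrightarrow> smooth_on S (f i)"
  shows "smooth_on S (\<lambda>x. \<Sum>i\<in>I. f i x)"
  using assms(2) by (induction I rule: infinite_finite_induct) (auto intro: smooth_on_add assms(1))

lemma smooth_on_prod:
  fixes f :: "'i \<Rightarrow> 'a::real_normed_vector \<Rightarrow> 'b::real_normed_field"
  assumes "open S" "\<And>i. i \<in> I \<Longrightarrow> smooth_on S (f i)"
  shows "smooth_on S (\<lambda>x. \<Prod>i\<in>I. f i x)"
  using assms(2) by (induction I rule: infinite_finite_induct) (auto intro: smooth_on_mult assms(1))

lemma smooth_on_pd: "smooth_on S f \<Longrightarrow> smooth_on S (pd a f)"
  unfolding smooth_on_def pd_def by (metis Ck_on.simps(2))

lemma smooth_on_has_derivative: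
  "open S \<Longrightarrow> smooth_on S f \<Longrightarrow> x \<in> S \<Longrightarrow> (f has_derivative frechet_derivative f (at x)) (at x)"
  unfolding smooth_on_def using Ck_on_Suc_has_derivative by blast

lemma smooth_on_differentiable: "open S \<Longrightarrow> smooth_on S f \<Longrightarrow> x \<in> S \<Longrightarrow> f differentiable (at x)"
  using smooth_on_has_derivative differentiableI by blast

lemma smooth_on_imp_continuous_on: "smooth_on S f \<Longrightarrow> continuous_on S f"
  unfolding smooth_on_def by (metis Ck_on.simps(1))

subsection \<open>Partial derivatives\<close>

lemma pd_eqI: "(f has_derivative f') (at p) \<Longrightarrow> pd a f p = f' (axis a 1)"
  unfolding pd_def by (metis frechet_derivative_at)

text \<open>\<open>frechet_derivative\<close> is a choice among the maps satisfying
  \<open>has_derivative\<close>. Both functions admit the same maps, so the choices agree even where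
  neither function is differentiable.\<close>

lemma pd_cong:
  assumes "open S" "p \<in> S" "\<And>x. x \<in> S \<Longrightarrow> f x = h x"
  shows "pd a f p = pd a h p"
proof -
  have "(f has_derivative D) (at p) \<longleftrightarrow> (h has_derivative D) (at p)" for D
    using assms by (auto intro: has_derivative_transform_within_open)
  then show ?thesis by (simp add: pd_def frechet_derivative_def)
qed

lemma pd_const [simp]: "pd a (\<lambda>x. c) p = 0"
  by (simp add: pd_def)

lemma pd_add:
  "f differentiable (at p) \<Longrightarrow> h differentiable (at p) \<Longrightarrow> pd a (\<lambda>x. f x + h x) p = pd a f p + pd a h p"
  by (subst pd_eqI[OF has_derivative_add]) (auto simp: pd_def dest: frechet_derivative_works[THEN iffD1])

lemma pd_minus: "f differentiable (at p) \<Longrightarrow> pd a (\<lambda>x. - f x) p = - pd a f p"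
  by (subst pd_eqI[OF has_derivative_minus]) (auto simp: pd_def dest: frechet_derivative_works[THEN iffD1])

lemma pd_diff:
  "f differentiable (at p) \<Longrightarrow> h differentiable (at p) \<Longrightarrow> pd a (\<lambda>x. f x - h x) p = pd a f p - pd a h p"
  by (subst pd_eqI[OF has_derivative_diff]) (auto simp: pd_def dest: frechet_derivative_works[THEN iffD1])

lemma pd_mult:
  fixes f h :: "point \<Rightarrow> 'b::real_normed_algebra"
  shows "f differentiable (at p) \<Longrightarrow> h differentiable (at p) \<Longrightarrow>
    pd a (\<lambda>x. f x * h x) p = f p * pd a h p + pd a f p * h p"
  by (subst pd_eqI[OF has_derivative_mult]) (auto simp: pd_def dest: frechet_derivative_works[THEN iffD1])

lemma pd_sum:
  "(\<And>i. i \<in> I \<Longrightarrow> f i differentiable (at p)) \<Longrightarrow> pd a (\<lambda>x. \<Sum>i\<in>I. f i x) p = (\<Sum>i\<in>I. pd a (f i) p)"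
proof -
  assume *: "\<And>i. i \<in> I \<Longrightarrow> f i differentiable (at p)"
  show ?thesis
    using * by (subst pd_eqI[OF has_derivative_sum, of I f "\<lambda>i. frechet_derivative (f i) (at p)"])
      (auto simp: pd_def dest: frechet_derivative_works[THEN iffD1])
qed

lemma constant_if_pd_zero:
  fixes f :: "point \<Rightarrow> real"
  assumes "open S" "connected S" "smooth_on S f" "\<And>p a. p \<in> S \<Longrightarrow> pd a f p = 0"
  shows "\<exists>c. \<forall>p\<in>S. f p = c"
proof -
  have "(f has_derivative (\<lambda>v. 0)) (at p)" if "p \<in> S" for p
  proof -
    have d: "(f has_derivative frechet_derivative f (at p)) (at p)"
      using assms that by (intro smooth_on_has_derivative)
    have lin: "linear (frechet_derivative f (at p))"
      using d has_derivative_linear by blast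
    have "frechet_derivative f (at p) v = 0" for v
    proof -
      have "v = (\<Sum>a\<in>UNIV. (v $ a) *\<^sub>R axis a 1)"
        by (metis basis_expansion scalar_mult_eq_scaleR)
      then have "frechet_derivative f (at p) v = (\<Sum>a\<in>UNIV. (v $ a) *\<^sub>R frechet_derivative f (at p) (axis a 1))"
        using linear_sum[OF lin] linear_scale[OF lin] by (smt (verit) sum.cong)
      then show ?thesis using assms(4)[OF that] by (simp add: pd_def)
    qed
    then show ?thesis using d by (metis (no_types, lifting) ext)
  qed
  then have "\<exists>c. \<forall>p\<in>S. f p = c"
    using has_derivative_zero_connected_constant_on[of S "{}" f] assms
    by (metis constant_on_def finite.emptyI has_derivative_at_withinI smooth_on_imp_continuous_on Diff_empty)
  then show ?thesis .
qed

text \<open>The mean value theorem, applied once along \<open>v\<close> and once along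
  \<open>w\<close>, turns the second difference into \<open>h * h\<close> times the mixed derivative
  at a nearby point; continuity of that derivative at \<open>p\<close> bounds the error.\<close>

lemma second_difference_quotient:
  fixes f :: "'a::real_normed_vector \<Rightarrow> real"
  assumes S: "open S" "p \<in> S" and f: "Ck_on (Suc (Suc 0)) S f" and "e > 0"
  shows "\<exists>d>0. \<forall>h. 0 < h \<and> h < d \<longrightarrow>
    \<bar>(f (p + h *\<^sub>R v + h *\<^sub>R w) - f (p + h *\<^sub>R v) - f (p + h *\<^sub>R w) + f p) -
      h\<^sup>2 * frechet_derivative (\<lambda>x. frechet_derivative f (at x) v) (at p) w\<bar> \<le> h\<^sup>2 * e"
proof -
  define f1 where "f1 = (\<lambda>x. frechet_derivative f (at x) v)"
  define f2 where "f2 = (\<lambda>x. frechet_derivative f1 (at x) w)"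
  have Cf1: "Ck_on (Suc 0) S f1" using f unfolding f1_def by simp
  have df: "(f has_derivative frechet_derivative f (at x)) (at x)" if "x \<in> S" for x
    using Ck_on_Suc_has_derivative[OF S(1) f that] .
  have df1: "(f1 has_derivative frechet_derivative f1 (at x)) (at x)" if "x \<in> S" for x
    using Ck_on_Suc_has_derivative[OF S(1) Cf1 that] .
  have "continuous_on S f2" using Cf1 unfolding f2_def by simp
  then obtain r where r: "r > 0" "ball p r \<subseteq> S" "\<And>x. x \<in> ball p r \<Longrightarrow> \<bar>f2 x - f2 p\<bar> < e"
  proof -
    have "isCont f2 p" using \<open>continuous_on S f2\<close> S continuous_on_eq_continuous_at by blast
    then obtain r1 where r1: "r1 > 0" "\<And>x. dist x p < r1 \<Longrightarrow> \<bar>f2 x - f2 p\<bar> < e"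
      unfolding continuous_at_eps_delta dist_real_def using \<open>e > 0\<close> by blast
    obtain r2 where r2: "r2 > 0" "ball p r2 \<subseteq> S" using S openE by blast
    show ?thesis
      by (rule that[of "min r1 r2"]) (use r1 r2 in \<open>auto simp: dist_commute\<close>)
  qed
  \<comment> \<open>Keeps \<open>p + s *\<^sub>R v + t *\<^sub>R w\<close> inside
    \<open>ball p r\<close> for \<open>s\<close> and \<open>t\<close> up to \<open>h\<close>; the
    summand 1 keeps the denominator positive when \<open>v\<close> and \<open>w\<close>
    vanish.\<close>
  define d where "d = r / (norm v + norm w + 1)"
  have "d > 0" using r unfolding d_def by (smt (verit) divide_pos_pos norm_ge_zero)
  have inb: "p + s *\<^sub>R v + t *\<^sub>R w \<in> ball p r" if "0 \<le> s" "s \<le> h" "0 \<le> t" "t \<le> h" "0 < h" "h < d" for s t h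
  proof -
    have "norm (s *\<^sub>R v + t *\<^sub>R w) \<le> s * norm v + t * norm w"
      by (metis abs_of_nonneg norm_scaleR norm_triangle_ineq that(1) that(3))
    also have "\<dots> \<le> h * norm v + h * norm w"
      using that by (intro add_mono mult_right_mono) auto
    also have "\<dots> \<le> h * (norm v + norm w + 1)" using that by (simp add: algebra_simps)
    also have "\<dots> < d * (norm v + norm w + 1)"
      using that by (intro mult_strict_right_mono) (auto simp: add_nonneg_pos)
    also have "\<dots> = r" unfolding d_def
      by (smt (verit) nonzero_eq_divide_eq norm_ge_zero)
    finally have "norm (s *\<^sub>R v + t *\<^sub>R w) < r" .
    moreover have "dist p (p + (s *\<^sub>R v + t *\<^sub>R w)) = norm (s *\<^sub>R v + t *\<^sub>R w)"
      by (subst dist_commute) (simp add: dist_norm)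
    ultimately show ?thesis by (simp add: add.assoc)
  qed
  have "\<bar>(f (p + h *\<^sub>R v + h *\<^sub>R w) - f (p + h *\<^sub>R v) - f (p + h *\<^sub>R w) + f p) - h\<^sup>2 * f2 p\<bar> \<le> h\<^sup>2 * e"
    if h: "0 < h" "h < d" for h
  proof -
    define phi where "phi = (\<lambda>s. f (p + s *\<^sub>R v + h *\<^sub>R w) - f (p + s *\<^sub>R v))"
    have D1: "(phi has_real_derivative (f1 (p + s *\<^sub>R v + h *\<^sub>R w) - f1 (p + s *\<^sub>R v))) (at s)"
      if "0 \<le> s" "s \<le> h" for s
    proof -
      have m1: "p + s *\<^sub>R v + h *\<^sub>R w \<in> S" using inb[of s h h] that h r by auto
      have m2: "p + s *\<^sub>R v \<in> S" using inb[of s h 0] that h r by auto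
      note L1 = has_derivative_linear[OF df[OF m1]] and L2 = has_derivative_linear[OF df[OF m2]]
      have "((\<lambda>s. f (p + s *\<^sub>R v + h *\<^sub>R w)) has_derivative (\<lambda>t. frechet_derivative f (at (p + s *\<^sub>R v + h *\<^sub>R w)) (t *\<^sub>R v))) (at s)"
        by (rule has_derivative_compose[where g=f and f="\<lambda>s. p + s *\<^sub>R v + h *\<^sub>R w", OF _ df[OF m1]]) (auto intro!: derivative_eq_intros)
      moreover have "((\<lambda>s. f (p + s *\<^sub>R v)) has_derivative (\<lambda>t. frechet_derivative f (at (p + s *\<^sub>R v)) (t *\<^sub>R v))) (at s)"
        by (rule has_derivative_compose[where g=f and f="\<lambda>s. p + s *\<^sub>R v", OF _ df[OF m2]]) (auto intro!: derivative_eq_intros)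
      ultimately have "(phi has_derivative (\<lambda>t. frechet_derivative f (at (p + s *\<^sub>R v + h *\<^sub>R w)) (t *\<^sub>R v) - frechet_derivative f (at (p + s *\<^sub>R v)) (t *\<^sub>R v))) (at s)"
        unfolding phi_def by (rule has_derivative_diff)
      then show ?thesis
        unfolding has_field_derivative_def f1_def
        by (rule has_derivative_eq_rhs)
          (simp add: fun_eq_iff linear_scale[OF L1] linear_scale[OF L2] right_diff_distrib left_diff_distrib mult.commute)
    qed
    obtain xi where xi: "0 < xi" "xi < h" "phi h - phi 0 = (h - 0) * (f1 (p + xi *\<^sub>R v + h *\<^sub>R w) - f1 (p + xi *\<^sub>R v))"
      using MVT2[OF h(1) D1] by blast
    define psi where "psi = (\<lambda>t. f1 (p + xi *\<^sub>R v + t *\<^sub>R w))"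
    have D2: "(psi has_real_derivative f2 (p + xi *\<^sub>R v + t *\<^sub>R w)) (at t)" if "0 \<le> t" "t \<le> h" for t
    proof -
      have m1: "p + xi *\<^sub>R v + t *\<^sub>R w \<in> S" using inb[of xi h t] that h r xi by auto
      note L1 = has_derivative_linear[OF df1[OF m1]]
      have "(psi has_derivative (\<lambda>u. frechet_derivative f1 (at (p + xi *\<^sub>R v + t *\<^sub>R w)) (u *\<^sub>R w))) (at t)"
        unfolding psi_def
        by (rule has_derivative_compose[where g=f1 and f="\<lambda>t. p + xi *\<^sub>R v + t *\<^sub>R w", OF _ df1[OF m1]]) (auto intro!: derivative_eq_intros)
      then show ?thesis
        unfolding has_field_derivative_def f2_def
        by (rule has_derivative_eq_rhs) (simp add: fun_eq_iff linear_scale[OF L1] mult.commute)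
    qed
    obtain et where et: "0 < et" "et < h" "psi h - psi 0 = (h - 0) * f2 (p + xi *\<^sub>R v + et *\<^sub>R w)"
      using MVT2[OF h(1) D2] by blast
    have "\<bar>f2 (p + xi *\<^sub>R v + et *\<^sub>R w) - f2 p\<bar> < e"
      using inb[of xi h et] h xi et r(3) by auto
    moreover have "f (p + h *\<^sub>R v + h *\<^sub>R w) - f (p + h *\<^sub>R v) - f (p + h *\<^sub>R w) + f p = phi h - phi 0"
      unfolding phi_def by simp
    moreover have "phi h - phi 0 = h\<^sup>2 * f2 (p + xi *\<^sub>R v + et *\<^sub>R w)"
      using xi et unfolding psi_def by (simp add: power2_eq_square)
    ultimately show ?thesis
      by (simp add: right_diff_distrib[symmetric] abs_mult mult_left_mono)
  qed
  then show ?thesis using \<open>d > 0\<close> unfolding f2_def f1_def by blast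
qed

text \<open>Schwarz's theorem: the second difference is symmetric in \<open>v\<close> and
  \<open>w\<close>, so the same quotient approximates both mixed derivatives.\<close>

theorem frechet_derivative_commute:
  fixes f :: "'a::real_normed_vector \<Rightarrow> real"
  assumes S: "open S" "p \<in> S" and f: "Ck_on (Suc (Suc 0)) S f"
  shows "frechet_derivative (\<lambda>x. frechet_derivative f (at x) v) (at p) w =
         frechet_derivative (\<lambda>x. frechet_derivative f (at x) w) (at p) v" (is "?x = ?y")
proof (rule ccontr)
  assume "?x \<noteq> ?y"
  \<comment> \<open>A third of the gap: the two estimates together account for at most two thirds of
    it.\<close>
  define e where "e = \<bar>?x - ?y\<bar> / 3"
  have "e > 0" using \<open>?x \<noteq> ?y\<close> unfolding e_def by simp
  obtain d1 where d1: "d1 > 0" "\<And>h. 0 < h \<Longrightarrow> h < d1 \<Longrightarrow>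
    \<bar>(f (p + h *\<^sub>R v + h *\<^sub>R w) - f (p + h *\<^sub>R v) - f (p + h *\<^sub>R w) + f p) - h\<^sup>2 * ?x\<bar> \<le> h\<^sup>2 * e"
    using second_difference_quotient[OF S f \<open>e > 0\<close>, of v w] by blast
  obtain d2 where d2: "d2 > 0" "\<And>h. 0 < h \<Longrightarrow> h < d2 \<Longrightarrow>
    \<bar>(f (p + h *\<^sub>R w + h *\<^sub>R v) - f (p + h *\<^sub>R w) - f (p + h *\<^sub>R v) + f p) - h\<^sup>2 * ?y\<bar> \<le> h\<^sup>2 * e"
    using second_difference_quotient[OF S f \<open>e > 0\<close>, of w v] by blast
  define h where "h = min d1 d2 / 2"
  have h: "0 < h" "h < d1" "h < d2" using d1 d2 unfolding h_def by auto
  have "\<bar>h\<^sup>2 * ?x - h\<^sup>2 * ?y\<bar> \<le> 2 * (h\<^sup>2 * e)"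
    using d1(2)[OF h(1,2)] d2(2)[OF h(1,3)] by (simp add: add.commute add.left_commute)
  then have "h\<^sup>2 * \<bar>?x - ?y\<bar> \<le> h\<^sup>2 * (2 * e)"
    by (simp only: right_diff_distrib[symmetric] abs_mult abs_power2 mult.left_commute[of 2])
  then have "\<bar>?x - ?y\<bar> \<le> 2 * e" using h(1) by simp
  then show False using \<open>e > 0\<close> unfolding e_def by simp
qed

lemma pd_commute:
  fixes f :: "point \<Rightarrow> real"
  assumes "open S" "p \<in> S" "smooth_on S f"
  shows "pd a (pd b f) p = pd b (pd a f) p"
  using frechet_derivative_commute[OF assms(1,2), of f] assms(3)
  unfolding smooth_on_def pd_def by blast

subsection \<open>Matrices\<close>

lemma matrix_inv_inverse:
  fixes A :: "'a::semiring_1 ^ 'n ^ 'n"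
  assumes "invertible A"
  shows "A ** matrix_inv A = mat 1" "matrix_inv A ** A = mat 1"
  using someI_ex[OF assms[unfolded invertible_def]] unfolding matrix_inv_def by blast+

lemma matrix_inv_unique:
  fixes A :: "'a::semiring_1 ^ 'n ^ 'n"
  assumes "A ** B = mat 1" "B ** A = mat 1"
  shows "matrix_inv A = B"
proof -
  have "invertible A" using assms unfolding invertible_def by blast
  then have "matrix_inv A = matrix_inv A ** (A ** B)" using assms by simp
  also have "\<dots> = B" using matrix_inv_inverse[OF \<open>invertible A\<close>] by (simp add: matrix_mul_assoc)
  finally show ?thesis .
qed

text \<open>Cramer's rule makes each entry of the inverse a quotient of polynomials in the entries,
  from which the smoothness of the inverse metric follows.\<close>

lemma matrix_inv_entry:
  fixes A :: "'a::field ^ 'n ^ 'n"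
  assumes "det A \<noteq> 0"
  shows "matrix_inv A $ i $ j = det (\<chi> r c. if c = i then (if r = j then 1 else 0) else A $ r $ c) / det A"
proof -
  have "A ** matrix_inv A = mat 1" using assms by (simp add: matrix_inv_inverse invertible_det_nz)
  then have "(A ** matrix_inv A) $ r $ j = (if r = j then 1 else 0)" for r by (simp add: mat_def)
  then have "A *v column j (matrix_inv A) = (\<chi> r. if r = j then 1 else 0)"
    by (simp add: vec_eq_iff matrix_matrix_mult_def matrix_vector_mult_def column_def)
  then have "column j (matrix_inv A) =
      (\<chi> k. det (\<chi> r c. if c = k then (\<chi> r. if r = j then 1 else 0) $ r else A $ r $ c) / det A)"
    using cramer[OF assms] by blast
  then have "column j (matrix_inv A) $ i =
      det (\<chi> r c. if c = i then (\<chi> r. if r = j then 1 else 0) $ r else A $ r $ c) / det A"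
    by simp
  also have "(\<chi> r c. if c = i then (\<chi> r. if r = j then 1 else 0) $ r else A $ r $ c) =
      (\<chi> r c. if c = i then (if r = j then 1 else 0) else A $ r $ c)"
    by (simp add: vec_eq_iff)
  finally show ?thesis by (simp add: column_def)
qed

lemma smooth_on_det:
  fixes A :: "'a::real_normed_vector \<Rightarrow> real ^ 'n ^ 'n"
  assumes "open S" "\<And>i j. smooth_on S (\<lambda>x. A x $ i $ j)"
  shows "smooth_on S (\<lambda>x. det (A x))"
  unfolding det_def by (intro smooth_on_sum smooth_on_mult smooth_on_prod smooth_on_const assms)

lemma smooth_on_matrix_inv:
  fixes A :: "'a::real_normed_vector \<Rightarrow> real ^ 'n ^ 'n"
  assumes "open S" "\<And>i j. smooth_on S (\<lambda>x. A x $ i $ j)" "\<And>x. x \<in> S \<Longrightarrow> det (A x) \<noteq> 0"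
  shows "smooth_on S (\<lambda>x. matrix_inv (A x) $ i $ j)"
proof (rule smooth_on_cong[OF assms(1)])
  have "smooth_on S (\<lambda>x. (\<chi> r c. if c = i then (if r = j then 1 else 0) else A x $ r $ c) $ a $ b)" for a b
    by (cases "b = i") (auto intro: assms)
  then show "smooth_on S (\<lambda>x. det (\<chi> r c. if c = i then (if r = j then 1 else 0) else A x $ r $ c) / det (A x))"
    by (intro smooth_on_divide smooth_on_det assms)
qed (simp add: matrix_inv_entry assms)

lemma det_4:
  "det (A::'a::comm_ring_1^4^4) =
    A$1$1 * (A$2$2 * (A$3$3 * A$4$4 - A$3$4 * A$4$3) - A$2$3 * (A$3$2 * A$4$4 - A$3$4 * A$4$2)
           + A$2$4 * (A$3$2 * A$4$3 - A$3$3 * A$4$2))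
  - A$1$2 * (A$2$1 * (A$3$3 * A$4$4 - A$3$4 * A$4$3) - A$2$3 * (A$3$1 * A$4$4 - A$3$4 * A$4$1)
           + A$2$4 * (A$3$1 * A$4$3 - A$3$3 * A$4$1))
  + A$1$3 * (A$2$1 * (A$3$2 * A$4$4 - A$3$4 * A$4$2) - A$2$2 * (A$3$1 * A$4$4 - A$3$4 * A$4$1)
           + A$2$4 * (A$3$1 * A$4$2 - A$3$2 * A$4$1))
  - A$1$4 * (A$2$1 * (A$3$2 * A$4$3 - A$3$3 * A$4$2) - A$2$2 * (A$3$1 * A$4$3 - A$3$3 * A$4$1)
           + A$2$3 * (A$3$1 * A$4$2 - A$3$2 * A$4$1))"
proof -
  have f1: "finite {2::4, 3, 4}" "1 \<notin> {2::4, 3, 4}" by auto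
  have f2: "finite {3::4, 4}" "2 \<notin> {3::4, 4}" by auto
  have f3: "finite {4::4}" "3 \<notin> {4::4}" by auto
  show ?thesis
    unfolding det_def UNIV_4
    unfolding sum_over_permutations_insert[OF f1]
    unfolding sum_over_permutations_insert[OF f2]
    unfolding sum_over_permutations_insert[OF f3]
    unfolding permutes_sing
    by (simp add: sign_swap_id permutation_swap_id sign_compose sign_id swap_id_eq permutation_compose algebra_simps)
qed

subsection \<open>Covariant derivatives and curvature\<close>

text \<open>In \<open>nabla1\<close> and \<open>nabla3\<close>, as in \<open>nabla2\<close>, the
  direction of differentiation is the first index, so \<open>nabla2 g (nabla1 g w)\<close> and
  \<open>nabla3 g (nabla2 g T)\<close> are second covariant derivatives.\<close>

definition nabla1 :: "metric \<Rightarrow> real form1 \<Rightarrow> point \<Rightarrow> 4 \<Rightarrow> 4 \<Rightarrow> real" where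
  "nabla1 g w p a b = pd a (\<lambda>x. w x b) p - (\<Sum>d\<in>UNIV. christoffel g p d a b * w p d)"

definition nabla3 ::
    "metric \<Rightarrow> (point \<Rightarrow> 4 \<Rightarrow> 4 \<Rightarrow> 4 \<Rightarrow> real) \<Rightarrow> point \<Rightarrow> 4 \<Rightarrow> 4 \<Rightarrow> 4 \<Rightarrow> 4 \<Rightarrow> real" where
  "nabla3 g T p e a b c = pd e (\<lambda>x. T x a b c) p
     - (\<Sum>d\<in>UNIV. christoffel g p d e a * T p d b c)
     - (\<Sum>d\<in>UNIV. christoffel g p d e b * T p a d c)
     - (\<Sum>d\<in>UNIV. christoffel g p d e c * T p a b d)"

text \<open>The Ricci identity at one point with the analysis stripped away: \<open>G\<close> is the
  connection, and \<open>dG\<close>, \<open>dw\<close>, \<open>ddw\<close> stand for partial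
  derivatives. Symmetry of \<open>G\<close> removes the torsion term, and \<open>dE\<close> removes
  the second derivatives.\<close>

lemma Ricci_identity1_algebra:
  fixes G :: "'i::finite \<Rightarrow> 'i \<Rightarrow> 'i \<Rightarrow> real"
  assumes sym: "\<And>c a b. G c a b = G c b a" and dE: "ddw a b c = ddw b a c"
    and D: "\<And>b c. D b c = dw b c - (\<Sum>e\<in>UNIV. G e b c * w e)"
  shows "(ddw a b c - (\<Sum>e\<in>UNIV. dG a e b c * w e + G e b c * dw a e))
      - (\<Sum>e\<in>UNIV. G e a b * D e c) - (\<Sum>e\<in>UNIV. G e a c * D b e)
    - ((ddw b a c - (\<Sum>e\<in>UNIV. dG b e a c * w e + G e a c * dw b e))
      - (\<Sum>e\<in>UNIV. G e b a * D e c) - (\<Sum>e\<in>UNIV. G e b c * D a e))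
    = - (\<Sum>e\<in>UNIV. (dG a e b c - dG b e a c + (\<Sum>f\<in>UNIV. G e a f * G f b c - G e b f * G f a c)) * w e)"
proof -
  have S: "(\<Sum>e\<in>UNIV. (\<Sum>f\<in>UNIV. G e x f * G f y c) * w e) = (\<Sum>e\<in>UNIV. \<Sum>f\<in>UNIV. G e y c * (G f x e * w f))" for x y
    unfolding sum_distrib_right by (rule trans[OF sum.swap]) (simp add: mult_ac)
  have "(\<Sum>e\<in>UNIV. G e a b * D e c) = (\<Sum>e\<in>UNIV. G e b a * D e c)" using sym by simp
  then show ?thesis
    unfolding D using S[of a b] S[of b a] dE
    by (simp add: sum.distrib sum_subtractf right_diff_distrib left_diff_distrib distrib_right
        distrib_left sum_distrib_left)
qed

lemma Ricci_identity2_algebra: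
  fixes G :: "'i::finite \<Rightarrow> 'i \<Rightarrow> 'i \<Rightarrow> real"
  assumes sym: "\<And>c a b. G c a b = G c b a" and dE: "ddT a b c d = ddT b a c d"
    and D: "\<And>b c d. D b c d = dT b c d - (\<Sum>e\<in>UNIV. G e b c * T e d) - (\<Sum>e\<in>UNIV. G e b d * T c e)"
  shows "(ddT a b c d - (\<Sum>e\<in>UNIV. dG a e b c * T e d + G e b c * dT a e d)
          - (\<Sum>e\<in>UNIV. dG a e b d * T c e + G e b d * dT a c e))
      - (\<Sum>e\<in>UNIV. G e a b * D e c d) - (\<Sum>e\<in>UNIV. G e a c * D b e d) - (\<Sum>e\<in>UNIV. G e a d * D b c e)
    - ((ddT b a c d - (\<Sum>e\<in>UNIV. dG b e a c * T e d + G e a c * dT b e d)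
          - (\<Sum>e\<in>UNIV. dG b e a d * T c e + G e a d * dT b c e))
      - (\<Sum>e\<in>UNIV. G e b a * D e c d) - (\<Sum>e\<in>UNIV. G e b c * D a e d) - (\<Sum>e\<in>UNIV. G e b d * D a c e))
    = - (\<Sum>e\<in>UNIV. (dG a e b c - dG b e a c + (\<Sum>f\<in>UNIV. G e a f * G f b c - G e b f * G f a c)) * T e d)
      - (\<Sum>e\<in>UNIV. (dG a e b d - dG b e a d + (\<Sum>f\<in>UNIV. G e a f * G f b d - G e b f * G f a d)) * T c e)"
proof -
  have S: "(\<Sum>e\<in>UNIV. (\<Sum>f\<in>UNIV. G e x f * G f y z) * h e) = (\<Sum>e\<in>UNIV. \<Sum>f\<in>UNIV. G e y z * (G f x e * h f))"
    for x y z and h :: "'i \<Rightarrow> real"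
    unfolding sum_distrib_right by (rule trans[OF sum.swap]) (simp add: mult_ac)
  \<comment> \<open>The cross terms, with one connection factor on each slot of \<open>T\<close>,
    cancel between the two orders of differentiation.\<close>
  have X: "(\<Sum>e\<in>UNIV. \<Sum>f\<in>UNIV. G e x c * (G f y d * T e f)) = (\<Sum>e\<in>UNIV. \<Sum>f\<in>UNIV. G e y d * (G f x c * T f e))" for x y
    by (subst sum.swap) (simp add: mult_ac)
  have "(\<Sum>e\<in>UNIV. G e a b * D e c d) = (\<Sum>e\<in>UNIV. G e b a * D e c d)" using sym by simp
  then show ?thesis
    unfolding D using dE S[of a b c "\<lambda>e. T e d"] S[of b a c "\<lambda>e. T e d"]
      S[of a b d "\<lambda>e. T c e"] S[of b a d "\<lambda>e. T c e"] X[of a b] X[of b a]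
    by (simp add: sum.distrib sum_subtractf right_diff_distrib left_diff_distrib distrib_right
        distrib_left sum_distrib_left)
qed

text \<open>\<open>X\<close> is the second covariant derivative of a Killing covector and
  \<open>S\<close> the curvature applied to it. Antisymmetry in one pair and known commutators in
  the other determine \<open>X\<close>, as in the Koszul formula.\<close>

lemma killing_algebra:
  fixes X :: "'i \<Rightarrow> 'i \<Rightarrow> 'i \<Rightarrow> real"
  assumes anti: "\<And>a b c. X a b c = - X a c b"
    and comm: "\<And>a b c. X a b c - X b a c = - S c a b"
    and cyc: "\<And>a b c. S a b c + S b c a + S c a b = 0"
    and Santi: "\<And>a b c. S a b c = - S a c b"
  shows "X a b c = S a b c"
  using anti[of a b c] anti[of b c a] anti[of c a b] comm[of a b c] comm[of b c a] comm[of c a b]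
    cyc[of a b c] Santi[of a b c] Santi[of b c a] Santi[of c a b]
    anti[of a c b] anti[of b a c] anti[of c b a] comm[of b a c] comm[of c b a] comm[of a c b]
  by linarith

text \<open>The four cyclic identities, one for each leading index, combine so that the
  antisymmetries leave only the two sides.\<close>

lemma riemann_pair_algebra:
  fixes R :: "'i \<Rightarrow> 'i \<Rightarrow> 'i \<Rightarrow> 'i \<Rightarrow> real"
  assumes "\<And>a b c d. R a b c d = - R b a c d" "\<And>a b c d. R a b c d = - R a b d c"
    and "\<And>a b c d. R a b c d + R a c d b + R a d b c = 0"
  shows "R a b c d = R c d a b"
  using assms(3)[of a b c d] assms(3)[of b c d a] assms(3)[of c d a b] assms(3)[of d a b c]
    assms(1)[of a b c d] assms(1)[of a c d b] assms(1)[of a d b c]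
    assms(1)[of b c d a] assms(1)[of b d a c] assms(1)[of b a c d] assms(1)[of c d a b]
    assms(1)[of c a b d] assms(1)[of c b d a] assms(1)[of d a b c] assms(1)[of d b c a] assms(1)[of d c a b]
    assms(2)[of a b c d] assms(2)[of a c d b] assms(2)[of a d b c]
    assms(2)[of b c d a] assms(2)[of b d a c] assms(2)[of b a c d] assms(2)[of c d a b]
    assms(2)[of c a b d] assms(2)[of c b d a] assms(2)[of d a b c] assms(2)[of d b c a] assms(2)[of d c a b]
    assms(2)[of c b a d] assms(2)[of d b a c]
  by linarith

lemma smooth_on_matrix_component:
  fixes g :: "'a::real_normed_vector \<Rightarrow> real ^ 'n ^ 'm"
  assumes "open S" "smooth_on S g"
  shows "smooth_on S (\<lambda>x. g x $ i $ j)"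
  using smooth_on_bounded_linear[OF assms(1), of "\<lambda>A. A $ i $ j" g] assms(2)
    bounded_linear_compose[OF bounded_linear_vec_nth[of j] bounded_linear_vec_nth[of i]]
  by (simp add: o_def)

section \<open>Levi-Civita calculus and curvature symmetries of a Lorentzian metric\<close>

locale metric_domain =
  fixes M :: "point set" and g :: metric
  assumes open_M: "open M" and smooth_g: "smooth_on M g"
    and lorentzian_g: "\<And>p. p \<in> M \<Longrightarrow> lorentzian (g p)"
begin

lemma g_sym: "p \<in> M \<Longrightarrow> g p $ a $ b = g p $ b $ a"
proof -
  assume "p \<in> M"
  then have "transpose (g p) = g p" using lorentzian_g unfolding lorentzian_def by blast
  then have "transpose (g p) $ b $ a = g p $ b $ a" by simp
  then show "g p $ a $ b = g p $ b $ a" by (simp add: transpose_def)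
qed

lemma det_g_neg:
  assumes "p \<in> M"
  shows "det (g p) < 0"
proof -
  obtain P :: "real ^ 4 ^ 4" where P: "invertible P" "transpose P ** g p ** P = minkowski"
    using lorentzian_g[OF assms] unfolding lorentzian_def by blast
  have "det minkowski = -1" by (simp add: det_4 minkowski_def)
  then have "det (transpose P ** g p ** P) = -1" using P(2) by simp
  then have "det (g p) * (det P)\<^sup>2 = -1"
    by (simp add: det_mul det_transpose power2_eq_square mult_ac)
  then show ?thesis by (smt (verit) mult_nonneg_nonneg zero_le_power2)
qed

lemma invertible_g: "p \<in> M \<Longrightarrow> invertible (g p)"
  using det_g_neg[of p] by (simp add: invertible_det_nz)

lemma smooth_metric [simp]: "smooth_on M (\<lambda>x. g x $ a $ b)"
  by (rule smooth_on_matrix_component[OF open_M smooth_g])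

lemma smooth_ginv [simp]: "smooth_on M (\<lambda>x. ginv g x $ a $ b)"
  unfolding ginv_def
  by (intro smooth_on_matrix_inv open_M smooth_metric) (metis det_g_neg less_irrefl)

lemma smooth_christoffel [simp]: "smooth_on M (\<lambda>x. christoffel g x c a b)"
  unfolding christoffel_def
  by (intro smooth_on_divide smooth_on_sum smooth_on_mult smooth_on_add smooth_on_diff smooth_on_pd open_M) auto

lemma g_ginv: "p \<in> M \<Longrightarrow> (\<Sum>c\<in>UNIV. g p $ a $ c * ginv g p $ c $ b) = (if a = b then 1 else 0)"
  using matrix_inv_inverse(1)[OF invertible_g, of p]
  by (simp add: vec_eq_iff matrix_matrix_mult_def mat_def ginv_def)

lemma ginv_g: "p \<in> M \<Longrightarrow> (\<Sum>c\<in>UNIV. ginv g p $ a $ c * g p $ c $ b) = (if a = b then 1 else 0)"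
  using matrix_inv_inverse(2)[OF invertible_g, of p]
  by (simp add: vec_eq_iff matrix_matrix_mult_def mat_def ginv_def)

lemma lower_raised:
  assumes "p \<in> M"
  shows "(\<Sum>c\<in>UNIV. g p $ a $ c * (\<Sum>d\<in>UNIV. ginv g p $ c $ d * (X d :: real))) = X a"
proof -
  have "(\<Sum>c\<in>UNIV. g p $ a $ c * (\<Sum>d\<in>UNIV. ginv g p $ c $ d * X d)) =
      (\<Sum>d\<in>UNIV. (\<Sum>c\<in>UNIV. g p $ a $ c * ginv g p $ c $ d) * X d)"
    unfolding sum_distrib_left sum_distrib_right by (subst sum.swap) (simp add: mult_ac)
  then show ?thesis by (simp add: g_ginv[OF assms] if_distrib[of "\<lambda>z. z * _"] cong: if_cong)
qed

lemma raise_lowered: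
  assumes "p \<in> M"
  shows "(\<Sum>c\<in>UNIV. ginv g p $ a $ c * (\<Sum>d\<in>UNIV. g p $ c $ d * (X d :: real))) = X a"
proof -
  have "(\<Sum>c\<in>UNIV. ginv g p $ a $ c * (\<Sum>d\<in>UNIV. g p $ c $ d * X d)) =
      (\<Sum>d\<in>UNIV. (\<Sum>c\<in>UNIV. ginv g p $ a $ c * g p $ c $ d) * X d)"
    unfolding sum_distrib_left sum_distrib_right by (subst sum.swap) (simp add: mult_ac)
  then show ?thesis by (simp add: ginv_g[OF assms] if_distrib[of "\<lambda>z. z * _"] cong: if_cong)
qed

lemma pd_g_sym: "p \<in> M \<Longrightarrow> pd e (\<lambda>x. g x $ a $ b) p = pd e (\<lambda>x. g x $ b $ a) p"
  using g_sym by (intro pd_cong[OF open_M]) auto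

lemma christoffel_sym: "p \<in> M \<Longrightarrow> christoffel g p c a b = christoffel g p c b a"
  unfolding christoffel_def by (simp add: pd_g_sym[of p _ a b] add.commute)

lemma pd_christoffel_sym:
  "p \<in> M \<Longrightarrow> pd e (\<lambda>x. christoffel g x c a b) p = pd e (\<lambda>x. christoffel g x c b a) p"
  using christoffel_sym by (intro pd_cong[OF open_M]) auto

lemma christoffel_lowered:
  assumes "p \<in> M"
  shows "(\<Sum>c\<in>UNIV. g p $ f $ c * christoffel g p c a b) =
    (pd a (\<lambda>x. g x $ b $ f) p + pd b (\<lambda>x. g x $ a $ f) p - pd f (\<lambda>x. g x $ a $ b) p) / 2"
  using lower_raised[OF assms, of f "\<lambda>d. pd a (\<lambda>x. g x $ b $ d) p + pd b (\<lambda>x. g x $ a $ d) p - pd d (\<lambda>x. g x $ a $ b) p"]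
  unfolding christoffel_def by (simp add: sum_divide_distrib[symmetric])

text \<open>Metric compatibility: the two lowered Christoffel terms are Koszul combinations whose
  sum is the partial derivative of the metric.\<close>

lemma nabla2_metric:
  assumes "p \<in> M"
  shows "nabla2 g (\<lambda>x i j. g x $ i $ j) p a b c = 0"
proof -
  have "(\<Sum>d\<in>UNIV. christoffel g p d a b * g p $ d $ c) = (\<Sum>d\<in>UNIV. g p $ c $ d * christoffel g p d a b)"
    by (intro sum.cong) (auto simp: g_sym[OF assms, of _ c])
  moreover have "(\<Sum>d\<in>UNIV. christoffel g p d a c * g p $ b $ d) = (\<Sum>d\<in>UNIV. g p $ b $ d * christoffel g p d a c)"
    by (intro sum.cong) auto
  ultimately show ?thesis
    unfolding nabla2_def using pd_g_sym[OF assms, of _ b c] pd_g_sym[OF assms, of _ a c] pd_g_sym[OF assms, of _ a b]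
    by (simp add: christoffel_lowered[OF assms])
qed

lemma differentiable_on_M: "p \<in> M \<Longrightarrow> smooth_on M f \<Longrightarrow> f differentiable (at p)"
  using smooth_on_differentiable[OF open_M] by blast

lemma smooth_nabla1:
  assumes "\<And>a. smooth_on M (\<lambda>x. w x a)"
  shows "smooth_on M (\<lambda>x. nabla1 g w x a b)"
  unfolding nabla1_def
  by (intro smooth_on_diff smooth_on_sum smooth_on_mult smooth_on_pd open_M assms smooth_christoffel)

lemma smooth_nabla2:
  fixes T :: "real form2"
  assumes "\<And>a b. smooth_on M (\<lambda>x. T x a b)"
  shows "smooth_on M (\<lambda>x. nabla2 g T x a b c)"
  unfolding nabla2_def real_scaleR_def
  by (intro smooth_on_diff smooth_on_sum smooth_on_mult smooth_on_pd open_M assms smooth_christoffel)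

lemma Ricci_identity1:
  assumes p: "p \<in> M" and w: "\<And>a. smooth_on M (\<lambda>x. w x a)"
  shows "nabla2 g (nabla1 g w) p a b c - nabla2 g (nabla1 g w) p b a c =
    - (\<Sum>e\<in>UNIV. riemann_up g p e c a b * w p e)"
proof -
  note d [simp] = differentiable_on_M[OF p]
  have n1: "nabla1 g w p b c = pd b (\<lambda>x. w x c) p - (\<Sum>e\<in>UNIV. christoffel g p e b c * w p e)" for b c
    by (simp add: nabla1_def)
  have P: "pd a (\<lambda>x. nabla1 g w x b c) p = pd a (pd b (\<lambda>x. w x c)) p -
      (\<Sum>e\<in>UNIV. pd a (\<lambda>x. christoffel g x e b c) p * w p e + christoffel g p e b c * pd a (\<lambda>x. w x e) p)" for a b c
    unfolding nabla1_def
    by (subst pd_diff) (auto simp: pd_sum pd_mult w smooth_on_pd add.commute)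
  have "riemann_up g p e c a b = pd a (\<lambda>x. christoffel g x e b c) p - pd b (\<lambda>x. christoffel g x e a c) p
     + (\<Sum>f\<in>UNIV. christoffel g p e a f * christoffel g p f b c - christoffel g p e b f * christoffel g p f a c)" for e
    by (simp add: riemann_up_def)
  then show ?thesis
    using Ricci_identity1_algebra[of "christoffel g p" "\<lambda>a b c. pd a (pd b (\<lambda>x. w x c)) p" a b c "nabla1 g w p"
        "\<lambda>b c. pd b (\<lambda>x. w x c) p" "w p" "\<lambda>a e b c. pd a (\<lambda>x. christoffel g x e b c) p",
        OF christoffel_sym[OF p] pd_commute[OF open_M p w] n1]
    unfolding nabla2_def P real_scaleR_def by simp
qed

lemma Ricci_identity2:
  assumes p: "p \<in> M" and w: "\<And>a b. smooth_on M (\<lambda>x. T x a b)"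
  shows "nabla3 g (nabla2 g T) p a b c d - nabla3 g (nabla2 g T) p b a c d =
    - (\<Sum>e\<in>UNIV. riemann_up g p e c a b * T p e d) - (\<Sum>e\<in>UNIV. riemann_up g p e d a b * T p c e)"
proof -
  note d [simp] = differentiable_on_M[OF p]
  have n1: "nabla2 g T p b c d = pd b (\<lambda>x. T x c d) p - (\<Sum>e\<in>UNIV. christoffel g p e b c * T p e d)
      - (\<Sum>e\<in>UNIV. christoffel g p e b d * T p c e)" for b c d
    by (simp add: nabla2_def)
  have P: "pd a (\<lambda>x. nabla2 g T x b c d) p = pd a (pd b (\<lambda>x. T x c d)) p -
      (\<Sum>e\<in>UNIV. pd a (\<lambda>x. christoffel g x e b c) p * T p e d + christoffel g p e b c * pd a (\<lambda>x. T x e d) p) -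
      (\<Sum>e\<in>UNIV. pd a (\<lambda>x. christoffel g x e b d) p * T p c e + christoffel g p e b d * pd a (\<lambda>x. T x c e) p)" for a b c d
    unfolding nabla2_def
    by (subst pd_diff, auto simp: w smooth_on_pd, subst pd_diff, auto simp: w smooth_on_pd pd_sum pd_mult add.commute)
  have R: "riemann_up g p e c a b = pd a (\<lambda>x. christoffel g x e b c) p - pd b (\<lambda>x. christoffel g x e a c) p
     + (\<Sum>f\<in>UNIV. christoffel g p e a f * christoffel g p f b c - christoffel g p e b f * christoffel g p f a c)" for e c
    by (simp add: riemann_up_def)
  show ?thesis
    using Ricci_identity2_algebra[of "christoffel g p" "\<lambda>a b c d. pd a (pd b (\<lambda>x. T x c d)) p" a b c d "nabla2 g T p"
        "\<lambda>b c d. pd b (\<lambda>x. T x c d) p" "T p" "\<lambda>a e b c. pd a (\<lambda>x. christoffel g x e b c) p",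
        OF christoffel_sym[OF p] pd_commute[OF open_M p w] n1]
    unfolding nabla3_def P R by simp
qed

lemma riemann_antisym_right: "riemann g p a b c d = - riemann g p a b d c"
  unfolding riemann_def riemann_up_def sum_negf[symmetric]
  by (intro sum.cong refl) (simp add: sum_subtractf algebra_simps)

lemma riemann_up_cyclic:
  assumes "p \<in> M"
  shows "riemann_up g p a b c d + riemann_up g p a c d b + riemann_up g p a d b c = 0"
  unfolding riemann_up_def using pd_christoffel_sym[OF assms] christoffel_sym[OF assms]
  by (simp add: sum_subtractf)

lemma riemann_cyclic:
  assumes "p \<in> M"
  shows "riemann g p a b c d + riemann g p a c d b + riemann g p a d b c = 0"
  unfolding riemann_def sum.distrib[symmetric] distrib_left[symmetric] riemann_up_cyclic[OF assms] by simp

text \<open>This is the Ricci identity for the metric itself: its second covariant derivatives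
  vanish, and the two curvature terms that remain must cancel.\<close>

lemma riemann_antisym_left:
  assumes p: "p \<in> M"
  shows "riemann g p a b c d = - riemann g p b a c d"
proof -
  have z: "nabla3 g (nabla2 g (\<lambda>x i j. g x $ i $ j)) p a b c d = 0" for a b c d
  proof -
    have "pd a (\<lambda>x. nabla2 g (\<lambda>x i j. g x $ i $ j) x b c d) p = pd a (\<lambda>x. 0) p"
      using nabla2_metric by (intro pd_cong[OF open_M p]) auto
    then show ?thesis by (simp add: nabla3_def nabla2_metric[OF p])
  qed
  have "(\<Sum>e\<in>UNIV. riemann_up g p e a c d * g p $ e $ b) + (\<Sum>e\<in>UNIV. riemann_up g p e b c d * g p $ a $ e) = 0"
    using Ricci_identity2[OF p, where T = "\<lambda>x i j. g x $ i $ j" and a = c and b = d and c = a and d = b,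
        OF smooth_metric] z by simp
  moreover have "(\<Sum>e\<in>UNIV. riemann_up g p e a c d * g p $ e $ b) = riemann g p b a c d"
    unfolding riemann_def by (intro sum.cong) (auto simp: g_sym[OF p, of _ b])
  moreover have "(\<Sum>e\<in>UNIV. riemann_up g p e b c d * g p $ a $ e) = riemann g p a b c d"
    unfolding riemann_def by (intro sum.cong) auto
  ultimately show ?thesis by simp
qed

lemma riemann_pair: "p \<in> M \<Longrightarrow> riemann g p a b c d = riemann g p c d a b"
  by (rule riemann_pair_algebra) (auto intro: riemann_antisym_left riemann_antisym_right riemann_cyclic)

lemma riemann_up_eq:
  assumes "p \<in> M"
  shows "riemann_up g p a b c d = (\<Sum>e\<in>UNIV. ginv g p $ a $ e * riemann g p e b c d)"
  unfolding riemann_def raise_lowered[OF assms] ..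

text \<open>Kostant's identity: second derivatives of a Killing field are curvature times the field,
  so differentiating \<open>nabla1 g w\<close> introduces no new unknown.\<close>

lemma killing_second_derivative:
  assumes p: "p \<in> M" and w: "\<And>a. smooth_on M (\<lambda>x. w x a)"
    and killing: "\<And>x a b. x \<in> M \<Longrightarrow> nabla1 g w x a b = - nabla1 g w x b a"
  shows "nabla2 g (nabla1 g w) p a b c = (\<Sum>e\<in>UNIV. riemann_up g p e a b c * w p e)"
proof (rule killing_algebra[where X = "nabla2 g (nabla1 g w) p" and
      S = "\<lambda>a b c. \<Sum>e\<in>UNIV. riemann_up g p e a b c * w p e"])
  fix a b c
  have "pd a (\<lambda>x. nabla1 g w x b c) p = pd a (\<lambda>x. - nabla1 g w x c b) p"
    by (rule pd_cong[OF open_M p]) (rule killing)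
  also have "\<dots> = - pd a (\<lambda>x. nabla1 g w x c b) p"
    by (intro pd_minus differentiable_on_M[OF p] smooth_nabla1 w)
  finally have 1: "pd a (\<lambda>x. nabla1 g w x b c) p = - pd a (\<lambda>x. nabla1 g w x c b) p" .
  have 2: "(\<Sum>d\<in>UNIV. christoffel g p d a x * nabla1 g w p d y) = - (\<Sum>d\<in>UNIV. christoffel g p d a x * nabla1 g w p y d)" for x y
    unfolding sum_negf[symmetric] by (intro sum.cong refl, subst killing[OF p]) simp
  show "nabla2 g (nabla1 g w) p a b c = - nabla2 g (nabla1 g w) p a c b"
    unfolding nabla2_def real_scaleR_def using 1 2[of b c] 2[of c b] by linarith
  show "nabla2 g (nabla1 g w) p a b c - nabla2 g (nabla1 g w) p b a c =
      - (\<Sum>e\<in>UNIV. riemann_up g p e c a b * w p e)"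
    by (rule Ricci_identity1[OF p w])
  show "(\<Sum>e\<in>UNIV. riemann_up g p e a b c * w p e) + (\<Sum>e\<in>UNIV. riemann_up g p e b c a * w p e) +
      (\<Sum>e\<in>UNIV. riemann_up g p e c a b * w p e) = 0"
    unfolding sum.distrib[symmetric] distrib_right[symmetric] riemann_up_cyclic[OF p] by simp
  show "(\<Sum>e\<in>UNIV. riemann_up g p e a b c * w p e) = - (\<Sum>e\<in>UNIV. riemann_up g p e a c b * w p e)"
    unfolding sum_negf[symmetric] riemann_up_def
    by (intro sum.cong refl) (simp add: sum_subtractf algebra_simps)
qed

end

subsection \<open>Components in a frame\<close>

text \<open>\<open>e i a\<close> is coordinate component \<open>a\<close> of frame vector
  \<open>i\<close>. Tensors of higher rank are contracted slot by slot through \<open>fr1\<close>,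
  so that its linearity rules serve all ranks.\<close>

definition fr1 :: "(4 \<Rightarrow> 4 \<Rightarrow> real) \<Rightarrow> (4 \<Rightarrow> real) \<Rightarrow> 4 \<Rightarrow> real" where
  "fr1 e w i = (\<Sum>a\<in>UNIV. e i a * w a)"

definition fr2 :: "(4 \<Rightarrow> 4 \<Rightarrow> real) \<Rightarrow> (4 \<Rightarrow> 4 \<Rightarrow> real) \<Rightarrow> 4 \<Rightarrow> 4 \<Rightarrow> real" where
  "fr2 e T i j = fr1 e (\<lambda>a. fr1 e (T a) j) i"

definition fr3 :: "(4 \<Rightarrow> 4 \<Rightarrow> real) \<Rightarrow> (4 \<Rightarrow> 4 \<Rightarrow> 4 \<Rightarrow> real) \<Rightarrow> 4 \<Rightarrow> 4 \<Rightarrow> 4 \<Rightarrow> real" where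
  "fr3 e T i j k = fr1 e (\<lambda>a. fr2 e (T a) j k) i"

definition fr4 :: "(4 \<Rightarrow> 4 \<Rightarrow> real) \<Rightarrow> (4 \<Rightarrow> 4 \<Rightarrow> 4 \<Rightarrow> 4 \<Rightarrow> real) \<Rightarrow> 4 \<Rightarrow> 4 \<Rightarrow> 4 \<Rightarrow> 4 \<Rightarrow> real" where
  "fr4 e T i j k l = fr1 e (\<lambda>a. fr3 e (T a) j k l) i"

lemma fr1_add: "fr1 e (\<lambda>a. w a + v a) i = fr1 e w i + fr1 e v i"
  by (simp add: fr1_def distrib_left sum.distrib)

lemma fr1_diff: "fr1 e (\<lambda>a. w a - v a) i = fr1 e w i - fr1 e v i"
  by (simp add: fr1_def right_diff_distrib sum_subtractf)

lemma fr1_minus: "fr1 e (\<lambda>a. - w a) i = - fr1 e w i"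
  by (simp add: fr1_def sum_negf)

lemma fr1_mult_left: "fr1 e (\<lambda>a. c * w a) i = c * fr1 e w i"
  by (simp add: fr1_def sum_distrib_left mult.left_commute)

lemma fr1_mult_right: "fr1 e (\<lambda>a. w a * c) i = fr1 e w i * c"
  by (simp add: fr1_def sum_distrib_right mult.assoc)

lemma fr1_divide: "fr1 e (\<lambda>a. w a / c) i = fr1 e w i / c"
  by (simp add: fr1_def sum_divide_distrib)

lemma fr1_sum: "fr1 e (\<lambda>a. \<Sum>k\<in>K. w k a) i = (\<Sum>k\<in>K. fr1 e (w k) i)"
  unfolding fr1_def sum_distrib_left by (rule sum.swap)

lemma fr1_zero [simp]: "fr1 e (\<lambda>a. 0) i = 0"
  by (simp add: fr1_def)

lemma fr1_swap: "fr1 e (\<lambda>a. fr1 e (\<lambda>b. T a b) j) i = fr1 e (\<lambda>b. fr1 e (\<lambda>a. T a b) i) j"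
  unfolding fr1_def sum_distrib_left by (subst sum.swap) (simp add: mult_ac)

lemmas fr1_linear = fr1_add fr1_diff fr1_minus fr1_mult_left fr1_mult_right fr1_divide fr1_sum

definition frame_matrix :: "(4 \<Rightarrow> 4 \<Rightarrow> real) \<Rightarrow> real ^ 4 ^ 4" where
  "frame_matrix e = (\<chi> a i. e i a)"

text \<open>The inverse Gram matrix raises indices in an arbitrary frame; this generality matters
  because the frame fields below are null frames only at the base point.\<close>

definition frame_inv_metric :: "metric \<Rightarrow> point \<Rightarrow> (4 \<Rightarrow> 4 \<Rightarrow> real) \<Rightarrow> 4 \<Rightarrow> 4 \<Rightarrow> real" where
  "frame_inv_metric g p e i j = matrix_inv (\<chi> i j. fr2 e (\<lambda>a b. g p $ a $ b) i j) $ i $ j"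

lemma frame_metric_matrix:
  "(\<chi> i j. fr2 e (\<lambda>a b. g p $ a $ b) i j) = transpose (frame_matrix e) ** g p ** frame_matrix e"
proof -
  have "(\<Sum>a\<in>UNIV. e i a * (\<Sum>b\<in>UNIV. e j b * g p $ a $ b)) = (\<Sum>b\<in>UNIV. (\<Sum>a\<in>UNIV. e i a * g p $ a $ b) * e j b)" for i j
    unfolding sum_distrib_left sum_distrib_right by (subst sum.swap) (simp add: mult_ac)
  then show ?thesis
    by (simp add: vec_eq_iff matrix_matrix_mult_def transpose_def frame_matrix_def fr2_def fr1_def)
qed

lemma sum_swap4:
  "(\<Sum>a\<in>UNIV. \<Sum>b\<in>UNIV. \<Sum>i\<in>UNIV. \<Sum>j\<in>UNIV. (X :: 'a::finite \<Rightarrow> 'a \<Rightarrow> 'a \<Rightarrow> 'a \<Rightarrow> real) a b i j) =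
    (\<Sum>i\<in>UNIV. \<Sum>j\<in>UNIV. \<Sum>a\<in>UNIV. \<Sum>b\<in>UNIV. X a b i j)"
proof -
  have "(\<Sum>a\<in>UNIV. \<Sum>b\<in>UNIV. \<Sum>i\<in>UNIV. \<Sum>j\<in>UNIV. X a b i j) = (\<Sum>a\<in>UNIV. \<Sum>i\<in>UNIV. \<Sum>b\<in>UNIV. \<Sum>j\<in>UNIV. X a b i j)"
    by (rule sum.cong[OF refl], rule sum.swap)
  also have "\<dots> = (\<Sum>a\<in>UNIV. \<Sum>i\<in>UNIV. \<Sum>j\<in>UNIV. \<Sum>b\<in>UNIV. X a b i j)"
    by (rule sum.cong[OF refl], rule sum.cong[OF refl], rule sum.swap)
  also have "\<dots> = (\<Sum>i\<in>UNIV. \<Sum>a\<in>UNIV. \<Sum>j\<in>UNIV. \<Sum>b\<in>UNIV. X a b i j)"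
    by (rule sum.swap)
  also have "\<dots> = (\<Sum>i\<in>UNIV. \<Sum>j\<in>UNIV. \<Sum>a\<in>UNIV. \<Sum>b\<in>UNIV. X a b i j)"
    by (rule sum.cong[OF refl], rule sum.swap)
  finally show ?thesis .
qed

text \<open>With the frame vectors as columns of \<open>?F\<close> and Gram matrix
  \<open>?G\<close>, the inverse metric is
  \<open>?F ** matrix_inv ?G ** transpose ?F\<close>.\<close>

lemma (in metric_domain) contraction_frame:
  assumes p: "p \<in> M" and e: "invertible (frame_matrix e)"
  shows "(\<Sum>a\<in>UNIV. \<Sum>b\<in>UNIV. ginv g p $ a $ b * T a b) =
    (\<Sum>i\<in>UNIV. \<Sum>j\<in>UNIV. frame_inv_metric g p e i j * fr2 e T i j)"
proof -
  let ?F = "frame_matrix e" and ?G = "\<chi> i j. fr2 e (\<lambda>a b. g p $ a $ b) i j"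
  have "matrix_inv ?G = matrix_inv ?F ** ginv g p ** transpose (matrix_inv ?F)"
  proof (rule matrix_inv_unique)
    have F: "?F ** matrix_inv ?F = mat 1" "matrix_inv ?F ** ?F = mat 1"
      using matrix_inv_inverse[OF e] by auto
    then have FT: "transpose ?F ** transpose (matrix_inv ?F) = mat 1" "transpose (matrix_inv ?F) ** transpose ?F = mat 1"
      by (metis matrix_transpose_mul transpose_mat)+
    have G: "g p ** ginv g p = mat 1" "ginv g p ** g p = mat 1"
      using matrix_inv_inverse[OF invertible_g[OF p]] by (auto simp: ginv_def)
    have "?G ** (matrix_inv ?F ** ginv g p ** transpose (matrix_inv ?F)) =
        transpose ?F ** (g p ** (?F ** matrix_inv ?F) ** ginv g p) ** transpose (matrix_inv ?F)"
      unfolding frame_metric_matrix by (simp add: matrix_mul_assoc)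
    then show "?G ** (matrix_inv ?F ** ginv g p ** transpose (matrix_inv ?F)) = mat 1"
      using F FT G by simp
    have "(matrix_inv ?F ** ginv g p ** transpose (matrix_inv ?F)) ** ?G =
        matrix_inv ?F ** (ginv g p ** (transpose (matrix_inv ?F) ** transpose ?F) ** g p) ** ?F"
      unfolding frame_metric_matrix by (simp add: matrix_mul_assoc)
    then show "(matrix_inv ?F ** ginv g p ** transpose (matrix_inv ?F)) ** ?G = mat 1"
      using F FT G by simp
  qed
  then have "?F ** matrix_inv ?G ** transpose ?F =
      (?F ** matrix_inv ?F) ** ginv g p ** (transpose (matrix_inv ?F) ** transpose ?F)"
    by (simp add: matrix_mul_assoc)
  also have "\<dots> = ginv g p"
    using matrix_inv_inverse[OF e] by (simp add: matrix_transpose_mul[symmetric] transpose_mat)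
  finally have "ginv g p $ a $ b = (?F ** matrix_inv ?G ** transpose ?F) $ a $ b" for a b by simp
  then have *: "ginv g p $ a $ b = (\<Sum>j\<in>UNIV. (\<Sum>i\<in>UNIV. e i a * frame_inv_metric g p e i j) * e j b)" for a b
    by (simp add: matrix_matrix_mult_def frame_matrix_def transpose_def frame_inv_metric_def)
  have "ginv g p $ a $ b * T a b = (\<Sum>i\<in>UNIV. \<Sum>j\<in>UNIV. frame_inv_metric g p e i j * (e i a * (e j b * T a b)))" for a b
    unfolding * sum_distrib_right by (subst sum.swap) (simp add: mult_ac)
  then have "(\<Sum>a\<in>UNIV. \<Sum>b\<in>UNIV. ginv g p $ a $ b * T a b) =
     (\<Sum>a\<in>UNIV. \<Sum>b\<in>UNIV. \<Sum>i\<in>UNIV. \<Sum>j\<in>UNIV. frame_inv_metric g p e i j * (e i a * (e j b * T a b)))"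
    by simp
  also have "\<dots> = (\<Sum>i\<in>UNIV. \<Sum>j\<in>UNIV. \<Sum>a\<in>UNIV. \<Sum>b\<in>UNIV. frame_inv_metric g p e i j * (e i a * (e j b * T a b)))"
    by (rule sum_swap4)
  finally show ?thesis by (simp add: fr2_def fr1_def sum_distrib_left)
qed

section \<open>The Levi-Civita symbol and the volume form in a frame\<close>

definition eps4 :: "4 \<Rightarrow> 4 \<Rightarrow> 4 \<Rightarrow> 4 \<Rightarrow> real" where
  "eps4 a b c d =
    det (\<chi> i. axis (if i = 1 then a else if i = 2 then b else if i = 3 then c else d) 1 :: real ^ 4 ^ 4)"

lemma eps4_expand:
  "eps4 a b c d = det (\<chi> i j. if j = (if i = 1 then a else if i = 2 then b else if i = 3 then c else d) then 1 else 0)"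
  unfolding eps4_def axis_def by simp

lemma eps4_nonzero:
  "eps4 1 2 3 4 = 1" "eps4 1 2 4 3 = -1" "eps4 1 3 2 4 = -1" "eps4 1 3 4 2 = 1" "eps4 1 4 2 3 = 1" "eps4 1 4 3 2 = -1"
  "eps4 2 1 3 4 = -1" "eps4 2 1 4 3 = 1" "eps4 2 3 1 4 = 1" "eps4 2 3 4 1 = -1" "eps4 2 4 1 3 = -1" "eps4 2 4 3 1 = 1"
  "eps4 3 1 2 4 = 1" "eps4 3 1 4 2 = -1" "eps4 3 2 1 4 = -1" "eps4 3 2 4 1 = 1" "eps4 3 4 1 2 = 1" "eps4 3 4 2 1 = -1"
  "eps4 4 1 2 3 = -1" "eps4 4 1 3 2 = 1" "eps4 4 2 1 3 = 1" "eps4 4 2 3 1 = -1" "eps4 4 3 1 2 = -1" "eps4 4 3 2 1 = 1"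
  unfolding eps4_expand det_4 by simp_all

lemma eps4_repeated:
  "eps4 a a c d = 0" "eps4 a b a d = 0" "eps4 a b c a = 0" "eps4 a b b d = 0" "eps4 a b c b = 0" "eps4 a b c c = 0"
proof -
  have r: "det (\<chi> i. axis (f i) 1 :: real ^ 4 ^ 4) = 0" if "i \<noteq> j" "f i = f j" for i j :: 4 and f :: "4 \<Rightarrow> 4"
    using det_identical_rows[OF that(1), of "\<chi> i. axis (f i) 1 :: real ^ 4 ^ 4"] that(2) by (simp add: row_def)
  show "eps4 a a c d = 0" unfolding eps4_def by (rule r[of 1 2]) auto
  show "eps4 a b a d = 0" unfolding eps4_def by (rule r[of 1 3]) auto
  show "eps4 a b c a = 0" unfolding eps4_def by (rule r[of 1 4]) auto
  show "eps4 a b b d = 0" unfolding eps4_def by (rule r[of 2 3]) auto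
  show "eps4 a b c b = 0" unfolding eps4_def by (rule r[of 2 4]) auto
  show "eps4 a b c c = 0" unfolding eps4_def by (rule r[of 3 4]) auto
qed

lemmas eps4_simps = eps4_nonzero eps4_repeated

text \<open>The selected frame vectors are the rows of a 0-1 selection matrix times the transposed
  frame matrix, so the determinant is multiplicative in the two.\<close>

lemma fr4_eps4: "fr4 e eps4 i j k l = det (frame_matrix e) * eps4 i j k l"
proof -
  define idx where "idx = (\<lambda>r::4. if r = 1 then i else if r = 2 then j else if r = 3 then k else l)"
  let ?K = "\<chi> r. axis (idx r) 1 :: real ^ 4 ^ 4"
  have "(?K ** transpose (frame_matrix e)) $ r $ c = e (idx r) c" for r c
    by (simp add: matrix_matrix_mult_def transpose_def frame_matrix_def axis_def if_distrib[of "\<lambda>z. z * _"] cong: if_cong)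
  then have K: "?K ** transpose (frame_matrix e) = (\<chi> r c. e (idx r) c)"
    by (simp add: vec_eq_iff)
  have "fr4 e eps4 i j k l = det (\<chi> r c. e (idx r) c)"
    unfolding fr4_def fr3_def fr2_def fr1_def sum_4 eps4_simps det_4
    by (simp add: idx_def algebra_simps)
  also have "\<dots> = det (?K ** transpose (frame_matrix e))" by (simp only: K)
  also have "\<dots> = det (frame_matrix e) * eps4 i j k l"
    by (simp add: det_mul det_transpose eps4_def idx_def)
  finally show ?thesis .
qed

lemma volume_element_eps4: "volume_element g os p = (\<lambda>a b c d. os * sqrt \<bar>det (g p)\<bar> * eps4 a b c d)"
  by (intro ext) (simp add: volume_element_def eps4_def)

lemma fr4_volume_element:
  "fr4 e (volume_element g os p) i j k l = os * sqrt \<bar>det (g p)\<bar> * det (frame_matrix e) * eps4 i j k l"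
  using fr4_eps4[of e i j k l]
  by (simp add: volume_element_eps4 fr4_def fr3_def fr2_def fr1_mult_left)

text \<open>Tensor equations may be checked in a frame, because an invertible frame matrix has
  trivial kernel; the versions for higher rank peel off one slot at a time.\<close>

lemma fr1_inject:
  assumes "invertible (frame_matrix e)" "\<And>i. fr1 e w i = fr1 e v i"
  shows "w a = v a"
proof -
  let ?F = "frame_matrix e"
  have "transpose ?F *v (\<chi> a. w a - v a) = 0"
    using assms(2) by (simp add: vec_eq_iff matrix_vector_mult_def transpose_def frame_matrix_def fr1_def
        right_diff_distrib sum_subtractf)
  moreover have "invertible (transpose ?F)" using assms(1) by (simp add: invertible_det_nz)
  moreover have "x = 0" if "B *v x = 0" "invertible B" for B :: "real ^ 4 ^ 4" and x
  proof -
    have "x = matrix_inv B *v (B *v x)"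
      using matrix_inv_inverse(2)[OF that(2)] by (simp add: matrix_vector_mul_assoc)
    then show ?thesis using that(1) by simp
  qed
  ultimately have "(\<chi> a. w a - v a) = 0" by blast
  then have "(\<chi> a. w a - v a) $ a = 0" by (simp only: zero_index)
  then show ?thesis by simp
qed

lemma fr2_inject:
  assumes "invertible (frame_matrix e)" "\<And>i j. fr2 e S i j = fr2 e T i j"
  shows "S a b = T a b"
proof (rule fr1_inject[OF assms(1)])
  show "fr1 e (S a) j = fr1 e (T a) j" for j
    by (rule fr1_inject[OF assms(1), of "\<lambda>a. fr1 e (S a) j" "\<lambda>a. fr1 e (T a) j"]) (use assms(2) in \<open>simp add: fr2_def\<close>)
qed

lemma fr4_inject:
  assumes "invertible (frame_matrix e)" "\<And>i j k l. fr4 e S i j k l = fr4 e T i j k l"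
  shows "S a b c d = T a b c d"
proof -
  have 1: "fr3 e (S a) j k l = fr3 e (T a) j k l" for a j k l
    by (rule fr1_inject[OF assms(1), of "\<lambda>a. fr3 e (S a) j k l" "\<lambda>a. fr3 e (T a) j k l"]) (use assms(2) in \<open>simp add: fr4_def\<close>)
  have "fr2 e (S a b) k l = fr2 e (T a b) k l" for a b k l
    by (rule fr1_inject[OF assms(1), of "\<lambda>b. fr2 e (S a b) k l" "\<lambda>b. fr2 e (T a b) k l"]) (use 1 in \<open>simp add: fr3_def\<close>)
  then show ?thesis by (rule fr2_inject[OF assms(1)])
qed

subsection \<open>Parallel frame fields\<close>

lemma nabla1_fun:
  "nabla1 g w p a = (\<lambda>b. pd a (\<lambda>x. w x b) p - (\<Sum>d\<in>UNIV. christoffel g p d a b * w p d))"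
  by (intro ext) (simp add: nabla1_def)

lemma nabla2_fun:
  fixes T :: "real form2"
  shows "nabla2 g T p a b = (\<lambda>c. pd a (\<lambda>x. T x b c) p
     - (\<Sum>d\<in>UNIV. christoffel g p d a b * T p d c) - (\<Sum>d\<in>UNIV. christoffel g p d a c * T p b d))"
  by (intro ext) (simp add: nabla2_def)

lemma nabla3_fun:
  "nabla3 g T p e a b = (\<lambda>c. pd e (\<lambda>x. T x a b c) p
     - (\<Sum>d\<in>UNIV. christoffel g p d e a * T p d b c)
     - (\<Sum>d\<in>UNIV. christoffel g p d e b * T p a d c)
     - (\<Sum>d\<in>UNIV. christoffel g p d e c * T p a b d))"
  by (intro ext) (simp add: nabla3_def)

text \<open>
  A frame field with \<open>\<nabla>E = 0\<close> at \<open>p\<close>: covariant derivatives at \<open>p\<close> become ordinary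
  derivatives of frame components, and the frame components of the metric and of the volume form
  are stationary at \<open>p\<close>.
\<close>

locale parallel_frame = metric_domain +
  fixes p :: point and E :: "point \<Rightarrow> 4 \<Rightarrow> 4 \<Rightarrow> real" and U :: "point set" and os :: real
  assumes open_U: "open U" and U_sub: "U \<subseteq> M" and p_U: "p \<in> U"
    and smooth_E: "\<And>i a. smooth_on U (\<lambda>x. E x i a)"
    and pd_E: "\<And>b i a. pd b (\<lambda>x. E x i a) p = - (\<Sum>c\<in>UNIV. christoffel g p a b c * E p i c)"
    and invertible_E: "\<And>x. x \<in> U \<Longrightarrow> invertible (frame_matrix (E x))"
    and os_square: "os * os = 1"
begin

lemma p_M: "p \<in> M" using p_U U_sub by blast

definition dE :: "4 \<Rightarrow> (point \<Rightarrow> real) \<Rightarrow> real" where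
  "dE l f = fr1 (E p) (\<lambda>a. pd a f p) l"

lemma smooth_U: "smooth_on M f \<Longrightarrow> smooth_on U f"
  using smooth_on_subset_open open_U U_sub open_M by blast

lemma diff_U [simp]: "smooth_on U f \<Longrightarrow> f differentiable (at p)"
  using smooth_on_differentiable open_U p_U by blast

lemma dE_cong: "(\<And>x. x \<in> U \<Longrightarrow> f x = h x) \<Longrightarrow> dE l f = dE l h"
  unfolding dE_def using pd_cong[OF open_U p_U, of f h] by presburger

lemma dE_const [simp]: "dE l (\<lambda>x. c) = 0"
  by (simp add: dE_def)

lemma dE_add: "smooth_on U f \<Longrightarrow> smooth_on U h \<Longrightarrow> dE l (\<lambda>x. f x + h x) = dE l f + dE l h"
  by (simp add: dE_def pd_add fr1_add)

lemma dE_diff: "smooth_on U f \<Longrightarrow> smooth_on U h \<Longrightarrow> dE l (\<lambda>x. f x - h x) = dE l f - dE l h"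
  by (simp add: dE_def pd_diff fr1_diff)

lemma dE_mult: "smooth_on U f \<Longrightarrow> smooth_on U h \<Longrightarrow> dE l (\<lambda>x. f x * h x) = f p * dE l h + dE l f * h p"
  by (simp add: dE_def pd_mult fr1_linear)

lemma dE_sum: "(\<And>i. i \<in> I \<Longrightarrow> smooth_on U (f i)) \<Longrightarrow> dE l (\<lambda>x. \<Sum>i\<in>I. f i x) = (\<Sum>i\<in>I. dE l (f i))"
  by (simp add: dE_def pd_sum fr1_sum)

lemma smooth_fr1:
  assumes "\<And>a. smooth_on U (\<lambda>x. w x a)"
  shows "smooth_on U (\<lambda>x. fr1 (E x) (w x) i)"
  unfolding fr1_def by (intro smooth_on_sum smooth_on_mult open_U smooth_E assms)

lemma smooth_fr2:
  assumes "\<And>a b. smooth_on U (\<lambda>x. T x a b)"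
  shows "smooth_on U (\<lambda>x. fr2 (E x) (T x) i j)"
  unfolding fr2_def by (intro smooth_fr1 assms)

lemma smooth_fr3:
  assumes "\<And>a b c. smooth_on U (\<lambda>x. T x a b c)"
  shows "smooth_on U (\<lambda>x. fr3 (E x) (T x) i j k)"
  unfolding fr3_def by (intro smooth_fr1 smooth_fr2 assms)

text \<open>By \<open>pd_E\<close> the derivative of the frame supplies exactly the Christoffel
  terms of the covariant derivative.\<close>

lemma pd_fr1:
  assumes w: "\<And>a. smooth_on U (\<lambda>x. w x a)"
  shows "pd k (\<lambda>x. fr1 (E x) (w x) i) p =
    fr1 (E p) (\<lambda>a. pd k (\<lambda>x. w x a) p - (\<Sum>d\<in>UNIV. christoffel g p d k a * w p d)) i"
proof -
  have "pd k (\<lambda>x. fr1 (E x) (w x) i) p =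
      (\<Sum>a\<in>UNIV. E p i a * pd k (\<lambda>x. w x a) p) -
      (\<Sum>a\<in>UNIV. (\<Sum>c\<in>UNIV. christoffel g p a k c * E p i c) * w p a)"
    unfolding fr1_def
    by (subst pd_sum) (auto simp: pd_mult w smooth_E smooth_on_mult open_U pd_E sum.distrib sum_negf sum_subtractf)
  also have "(\<Sum>a\<in>UNIV. (\<Sum>c\<in>UNIV. christoffel g p a k c * E p i c) * w p a) =
     (\<Sum>a\<in>UNIV. E p i a * (\<Sum>d\<in>UNIV. christoffel g p d k a * w p d))"
    unfolding sum_distrib_left sum_distrib_right by (subst sum.swap) (simp add: mult_ac)
  finally show ?thesis by (simp add: fr1_def sum_subtractf right_diff_distrib)
qed

lemma pd_fr2:
  assumes w: "\<And>a b. smooth_on U (\<lambda>x. T x a b)"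
  shows "pd k (\<lambda>x. fr2 (E x) (T x) i j) p = fr2 (E p) (nabla2 g T p k) i j"
  unfolding fr2_def using w
  by (subst pd_fr1) (auto simp: smooth_fr1 pd_fr1 nabla2_fun fr1_linear algebra_simps)

lemma pd_fr3:
  assumes w: "\<And>a b c. smooth_on U (\<lambda>x. T x a b c)"
  shows "pd k (\<lambda>x. fr3 (E x) (T x) i j h) p = fr3 (E p) (nabla3 g T p k) i j h"
proof -
  have X: "fr2 (E p) (nabla2 g (\<lambda>x. T x a) p k) j h - (\<Sum>d\<in>UNIV. christoffel g p d k a * fr2 (E p) (T p d) j h) =
      fr2 (E p) (nabla3 g T p k a) j h" for a
    by (simp add: fr2_def nabla3_fun nabla2_fun fr1_linear algebra_simps)
  show ?thesis
    unfolding fr3_def using w by (subst pd_fr1) (auto simp: smooth_fr2 pd_fr2 X)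
qed

lemma dE_fr1:
  "(\<And>a. smooth_on U (\<lambda>x. w x a)) \<Longrightarrow> dE l (\<lambda>x. fr1 (E x) (w x) i) = fr2 (E p) (nabla1 g w p) l i"
  unfolding dE_def fr2_def by (simp add: pd_fr1 nabla1_fun)

lemma dE_fr2:
  "(\<And>a b. smooth_on U (\<lambda>x. T x a b)) \<Longrightarrow> dE l (\<lambda>x. fr2 (E x) (T x) i j) = fr3 (E p) (nabla2 g T p) l i j"
  unfolding dE_def fr3_def by (simp add: pd_fr2)

lemma dE_fr3:
  "(\<And>a b c. smooth_on U (\<lambda>x. T x a b c)) \<Longrightarrow> dE l (\<lambda>x. fr3 (E x) (T x) i j k) = fr4 (E p) (nabla3 g T p) l i j k"
  unfolding dE_def fr4_def by (simp add: pd_fr3)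

definition G :: "point \<Rightarrow> 4 \<Rightarrow> 4 \<Rightarrow> real" where
  "G x i j = fr2 (E x) (\<lambda>a b. g x $ a $ b) i j"

definition H :: "point \<Rightarrow> 4 \<Rightarrow> 4 \<Rightarrow> real" where
  "H x i j = frame_inv_metric g x (E x) i j"

text \<open>The value of the volume element on the four frame vectors, compare
  \<open>fr4_volume_element\<close>.\<close>

definition tau :: "point \<Rightarrow> real" where
  "tau x = os * sqrt \<bar>det (g x)\<bar> * det (frame_matrix (E x))"

text \<open>Constancy to first order at \<open>p\<close>, which is enough to pull metric and volume
  factors out of a derivative taken at \<open>p\<close>.\<close>

definition stationary :: "(point \<Rightarrow> real) \<Rightarrow> bool" where
  "stationary f \<longleftrightarrow> smooth_on U f \<and> (\<forall>l. dE l f = 0)"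

lemma stationary_add: "stationary f \<Longrightarrow> stationary h \<Longrightarrow> stationary (\<lambda>x. f x + h x)"
  unfolding stationary_def by (simp add: dE_add smooth_on_add open_U)

lemma stationary_diff: "stationary f \<Longrightarrow> stationary h \<Longrightarrow> stationary (\<lambda>x. f x - h x)"
  unfolding stationary_def by (simp add: dE_diff smooth_on_diff open_U)

lemma stationary_mult: "stationary f \<Longrightarrow> stationary h \<Longrightarrow> stationary (\<lambda>x. f x * h x)"
  unfolding stationary_def by (simp add: dE_mult smooth_on_mult open_U)

lemma stationary_G: "stationary (\<lambda>x. G x i j)"
proof -
  have s: "smooth_on U (\<lambda>x. g x $ a $ b)" for a b by (intro smooth_U smooth_metric)
  have "nabla2 g (\<lambda>x a b. g x $ a $ b) p = (\<lambda>a b c. 0)"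
    by (intro ext) (rule nabla2_metric[OF p_M])
  then have "dE l (\<lambda>x. G x i j) = 0" for l
    unfolding G_def using s by (subst dE_fr2) (auto simp: fr3_def fr2_def)
  then show ?thesis unfolding stationary_def G_def using s by (auto intro: smooth_fr2)
qed

lemma G_matrix: "(\<chi> i j. G x i j) = transpose (frame_matrix (E x)) ** g x ** frame_matrix (E x)"
  unfolding G_def frame_metric_matrix ..

lemma det_G: "det (\<chi> i j. G x i j) = det (g x) * (det (frame_matrix (E x)))\<^sup>2"
  unfolding G_matrix by (simp add: det_mul det_transpose power2_eq_square)

lemma det_E_nz: "x \<in> U \<Longrightarrow> det (frame_matrix (E x)) \<noteq> 0"
  using invertible_E by (simp add: invertible_det_nz)

lemma det_g_nz: "x \<in> U \<Longrightarrow> det (g x) < 0"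
  using det_g_neg U_sub by blast

text \<open>Differentiating \<open>G H = 1\<close> with \<open>G\<close> stationary shows that
  \<open>G\<close> annihilates the derivative of \<open>H\<close>; multiplying by \<open>H\<close>
  finishes.\<close>

lemma stationary_H: "stationary (\<lambda>x. H x i j)"
proof -
  have inv: "det (\<chi> i j. G x i j) \<noteq> 0" if "x \<in> U" for x
    using det_E_nz[OF that] det_g_nz[OF that] by (simp add: det_G)
  have Hm: "H x i j = matrix_inv (\<chi> i j. G x i j) $ i $ j" for x i j
    unfolding H_def frame_inv_metric_def G_def ..
  have sG: "smooth_on U (\<lambda>x. G x i j)" "dE l (\<lambda>x. G x i j) = 0" for i j l
    using stationary_G unfolding stationary_def by auto
  have sH: "smooth_on U (\<lambda>x. H x i j)" for i j
    unfolding Hm by (rule smooth_on_matrix_inv[OF open_U]) (auto simp: sG inv)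
  have 1: "(\<Sum>c\<in>UNIV. G x a c * H x c b) = (if a = b then 1 else 0)"
    and 2: "(\<Sum>c\<in>UNIV. H x a c * G x c b) = (if a = b then 1 else 0)" if "x \<in> U" for x a b
    using matrix_inv_inverse[of "\<chi> i j. G x i j"] inv[OF that]
    by (simp_all add: Hm vec_eq_iff matrix_matrix_mult_def mat_def invertible_det_nz)
  have "dE l (\<lambda>x. H x i j) = 0" for l i j
  proof -
    have "(\<Sum>c\<in>UNIV. G p a c * dE l (\<lambda>x. H x c j)) = 0" for a
    proof -
      have "dE l (\<lambda>x. \<Sum>c\<in>UNIV. G x a c * H x c j) = dE l (\<lambda>x. if a = j then 1 else 0)"
        using 1 by (intro dE_cong)
      then show ?thesis by (simp add: dE_sum dE_mult sG sH smooth_on_mult open_U)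
    qed
    then have "(\<Sum>a\<in>UNIV. H p i a * (\<Sum>c\<in>UNIV. G p a c * dE l (\<lambda>x. H x c j))) = 0" by simp
    also have "(\<Sum>a\<in>UNIV. H p i a * (\<Sum>c\<in>UNIV. G p a c * dE l (\<lambda>x. H x c j))) =
        (\<Sum>c\<in>UNIV. (\<Sum>a\<in>UNIV. H p i a * G p a c) * dE l (\<lambda>x. H x c j))"
      unfolding sum_distrib_left sum_distrib_right by (subst sum.swap) (simp add: mult_ac)
    also have "\<dots> = dE l (\<lambda>x. H x i j)"
      by (simp add: 2[OF p_U] if_distrib[of "\<lambda>z. z * _"] cong: if_cong)
    finally show ?thesis .
  qed
  then show ?thesis using sH unfolding stationary_def by blast
qed

text \<open>\<open>tau * tau\<close> is minus the Gram determinant, a polynomial in stationary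
  functions, and \<open>tau p\<close> is nonzero, so the derivative of \<open>tau\<close> itself
  vanishes.\<close>

lemma stationary_tau: "stationary tau"
proof -
  have "smooth_on U (\<lambda>x. \<bar>det (g x)\<bar>)"
  proof (rule smooth_on_cong[OF open_U])
    show "smooth_on U (\<lambda>x. - det (g x))"
      by (intro smooth_on_minus smooth_on_det smooth_U smooth_metric open_U)
  qed (simp add: abs_of_neg det_g_nz)
  then have "smooth_on U (\<lambda>x. sqrt \<bar>det (g x)\<bar>)"
    by (rule smooth_on_sqrt[OF open_U]) (use det_g_nz in force)
  moreover have "smooth_on U (\<lambda>x. det (frame_matrix (E x)))"
    by (rule smooth_on_det[OF open_U]) (simp add: frame_matrix_def smooth_E)
  ultimately have s: "smooth_on U tau"
    unfolding tau_def by (intro smooth_on_mult open_U smooth_on_const)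
  have sq: "tau x * tau x = - det (\<chi> i j. G x i j)" if "x \<in> U" for x
  proof -
    have "tau x * tau x = (os * os) * (sqrt \<bar>det (g x)\<bar> * sqrt \<bar>det (g x)\<bar>) * (det (frame_matrix (E x)))\<^sup>2"
      unfolding tau_def by (simp add: power2_eq_square mult_ac)
    also have "sqrt \<bar>det (g x)\<bar> * sqrt \<bar>det (g x)\<bar> = - det (g x)"
      using det_g_nz[OF that] by simp
    finally show ?thesis by (simp add: os_square det_G)
  qed
  have "stationary (\<lambda>x. det (\<chi> i j. G x i j))"
    unfolding det_4 by (simp, intro stationary_add stationary_diff stationary_mult stationary_G)
  then have 0: "dE l (\<lambda>x. det (\<chi> i j. G x i j)) = 0" "smooth_on U (\<lambda>x. det (\<chi> i j. G x i j))" for l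
    unfolding stationary_def by auto
  have "dE l tau = 0" for l
  proof -
    have "dE l (\<lambda>x. tau x * tau x) = dE l (\<lambda>x. 0 - det (\<chi> i j. G x i j))"
      using sq by (intro dE_cong) simp
    also have "\<dots> = 0"
      by (simp only: dE_diff[OF smooth_on_const 0(2)] 0(1) dE_const diff_zero)
    finally have "tau p * dE l tau = 0" by (simp add: dE_mult s)
    moreover have "tau p \<noteq> 0"
      using sq[OF p_U] det_E_nz[OF p_U] det_g_nz[OF p_U] by (auto simp: det_G)
    ultimately show ?thesis by simp
  qed
  then show ?thesis using s unfolding stationary_def by blast
qed

end

text \<open>Parallel transport is needed to first order only, so the frame is affine in the
  coordinates, with slope given by the Christoffel symbols at \<open>p\<close>; \<open>U\<close> is
  cut down to where the vectors stay independent.\<close>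

lemma (in metric_domain) exists_parallel_frame:
  assumes p: "p \<in> M" and e: "invertible (frame_matrix e)" and "os * os = 1"
  shows "\<exists>E U. parallel_frame M g p E U os \<and> E p = e"
proof -
  define E where "E = (\<lambda>x i a. e i a - (\<Sum>b\<in>UNIV. (x $ b - p $ b) * (\<Sum>c\<in>UNIV. christoffel g p a b c * e i c)))"
  have comp: "smooth_on UNIV (\<lambda>x::point. x $ b)" for b
  proof -
    have "Ck_on k (UNIV::point set) (\<lambda>x. x)" for k
      by (cases k) (auto intro: Ck_on_const)
    then have "smooth_on UNIV (\<lambda>x::point. x)" unfolding smooth_on_def by blast
    then show ?thesis by (rule smooth_on_bounded_linear[OF open_UNIV bounded_linear_vec_nth])
  qed
  have sE: "smooth_on UNIV (\<lambda>x. E x i a)" for i a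
    unfolding E_def by (intro smooth_on_diff smooth_on_sum smooth_on_mult smooth_on_const comp open_UNIV)
  have Ep: "E p = e" unfolding E_def by (intro ext) simp
  have pdx: "pd b (\<lambda>x. x $ c) p = (if b = c then 1 else 0)" for b c
    by (subst pd_eqI[OF bounded_linear.has_derivative[OF bounded_linear_vec_nth has_derivative_ident]])
      (simp add: axis_def)
  have [simp]: "(\<lambda>x. x $ c) differentiable (at p)" for c
    by (rule smooth_on_differentiable[OF open_UNIV comp]) simp
  have pdE: "pd b (\<lambda>x. E x i a) p = - (\<Sum>c\<in>UNIV. christoffel g p a b c * E p i c)" for b i a
  proof -
    have "pd b (\<lambda>x. E x i a) p = - (\<Sum>d\<in>UNIV. (if b = d then 1 else 0) * (\<Sum>c\<in>UNIV. christoffel g p a d c * e i c))"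
      unfolding E_def by (subst pd_diff) (auto simp: pd_sum pd_mult pd_diff pdx)
    then show ?thesis by (simp add: Ep if_distrib[of "\<lambda>z. z * _"] cong: if_cong)
  qed
  have sdet: "smooth_on UNIV (\<lambda>x. det (frame_matrix (E x)))"
    by (rule smooth_on_det[OF open_UNIV]) (simp add: frame_matrix_def sE)
  define U where "U = M \<inter> {x. det (frame_matrix (E x)) \<noteq> 0}"
  have "open {x. det (frame_matrix (E x)) \<noteq> 0}"
    using smooth_on_imp_continuous_on[OF sdet] by (intro open_Collect_neq continuous_on_const)
  then have "open U" unfolding U_def using open_M by blast
  have "p \<in> U" using p e Ep by (simp add: U_def invertible_det_nz)
  have "parallel_frame M g p E U os"
  proof
    show "smooth_on U (\<lambda>x. E x i a)" for i a
      using smooth_on_subset_open[OF sE \<open>open U\<close> subset_UNIV open_UNIV] .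
    show "invertible (frame_matrix (E x))" if "x \<in> U" for x
      using that by (simp add: U_def invertible_det_nz)
  qed (use \<open>open U\<close> \<open>p \<in> U\<close> pdE assms(3) in \<open>auto simp: U_def\<close>)
  then show ?thesis using Ep by blast
qed

subsection \<open>Algebra in an adapted null frame\<close>

text \<open>
  The frame is \<open>(\<ell>, n, x, y)\<close> with \<open>g(\<ell>, n) = g(x, x) = g(y, y) = 1\<close> and volume
  \<open>\<eta>(\<ell>, n, x, y) = 1\<close>; then \<open>A = \<ell> \<and> x\<close> and \<open>*A = - \<ell> \<and> y\<close>.
\<close>

definition null_metric :: "4 \<Rightarrow> 4 \<Rightarrow> real" where
  "null_metric i j = (if i = 1 \<and> j = 2 \<or> i = 2 \<and> j = 1 \<or> i = 3 \<and> j = 3 \<or> i = 4 \<and> j = 4 then 1 else 0)"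

text \<open>\<open>null_metric\<close> is its own inverse, so this is the metric trace in an adapted
  frame.\<close>

definition tr_null :: "(4 \<Rightarrow> 4 \<Rightarrow> real) \<Rightarrow> real" where
  "tr_null X = X 1 2 + X 2 1 + X 3 3 + X 4 4"

text \<open>Lowering the index of l, the first frame vector, moves its only component to slot 2;
  hence the nonzero entries sit at 2 and 3.\<close>

definition null_form :: "4 \<Rightarrow> 4 \<Rightarrow> real" where
  "null_form i j = (if i = 2 \<and> j = 3 then 1 else if i = 3 \<and> j = 2 then - 1 else 0)"

definition null_dual :: "4 \<Rightarrow> 4 \<Rightarrow> real" where
  "null_dual i j = (if i = 2 \<and> j = 4 then - 1 else if i = 4 \<and> j = 2 then 1 else 0)"

lemma null_metric_simps [simp]:
  "null_metric 1 1 = 0" "null_metric 1 2 = 1" "null_metric 1 3 = 0" "null_metric 1 4 = 0"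
  "null_metric 2 1 = 1" "null_metric 2 2 = 0" "null_metric 2 3 = 0" "null_metric 2 4 = 0"
  "null_metric 3 1 = 0" "null_metric 3 2 = 0" "null_metric 3 3 = 1" "null_metric 3 4 = 0"
  "null_metric 4 1 = 0" "null_metric 4 2 = 0" "null_metric 4 3 = 0" "null_metric 4 4 = 1"
  by (simp_all add: null_metric_def)

lemma null_form_simps [simp]:
  "null_form 1 i = 0" "null_form i 1 = 0" "null_form 4 i = 0" "null_form i 4 = 0" "null_form 2 2 = 0" "null_form 2 3 = 1" "null_form 3 2 = - 1" "null_form 3 3 = 0"
  by (simp_all add: null_form_def)

lemma null_dual_simps [simp]:
  "null_dual 1 i = 0" "null_dual i 1 = 0" "null_dual 3 i = 0" "null_dual i 3 = 0" "null_dual 2 2 = 0" "null_dual 2 4 = - 1" "null_dual 4 2 = 1" "null_dual 4 4 = 0"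
  by (simp_all add: null_dual_def)

text \<open>
  Frame components: \<open>z\<^sub>i\<close> of \<open>Z\<^sub>i\<close>, \<open>f\<^sub>i\<close> of \<open>\<nabla>Z\<^sub>i\<close>, \<open>df\<^sub>i\<close> of
  \<open>\<nabla>\<nabla>Z\<^sub>i\<close>, \<open>r\<close> of the Riemann tensor, \<open>dL\<close> of the differential of
  \<open>\<Lambda>\<close>.  The hypotheses \<open>AA\<close>, \<open>AB\<close> are derivatives of the nullity of \<open>A\<close>,
  \<open>Ricci_A\<close> is the Ricci identity for \<open>A\<close> with the derivative of the CKY equation inserted,
  and \<open>X\<close>, \<open>Y\<close> are derivatives of the real and imaginary parts of
  \<open>(Z\<^sub>1 - \<i> Z\<^sub>2) \<cdot> (A - \<i> *A) = 0\<close>.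
\<close>

locale null_algebra1 =
  fixes z1 z2 :: "4 \<Rightarrow> real" and dA dB :: "4 \<Rightarrow> 4 \<Rightarrow> 4 \<Rightarrow> real"
  assumes E1: "\<And>k i j. 3 * dA k i j = z1 i * null_metric k j - z1 j * null_metric k i - tr_null (\<lambda>m n. eps4 m k i j * z2 n)"
    and E2: "\<And>k i j. 3 * dB k i j = z2 i * null_metric k j - z2 j * null_metric k i + tr_null (\<lambda>m n. eps4 m k i j * z1 n)"
    and AA: "\<And>l. tr_null (\<lambda>i k. tr_null (\<lambda>j m. null_form i j * dA l k m + dA l i j * null_form k m)) = 0"
    and AB: "\<And>l. tr_null (\<lambda>i k. tr_null (\<lambda>j m. null_form i j * dB l k m + dA l i j * null_dual k m)) = 0"
begin

lemma dA_eq: "dA k i j = (z1 i * null_metric k j - z1 j * null_metric k i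
    - (eps4 1 k i j * z2 2 + eps4 2 k i j * z2 1 + eps4 3 k i j * z2 3 + eps4 4 k i j * z2 4)) / 3"
  using E1[of k i j] by (simp add: tr_null_def)

lemma dB_eq: "dB k i j = (z2 i * null_metric k j - z2 j * null_metric k i
    + (eps4 1 k i j * z1 2 + eps4 2 k i j * z1 1 + eps4 3 k i j * z1 3 + eps4 4 k i j * z1 4)) / 3"
  using E2[of k i j] by (simp add: tr_null_def)

text \<open>The complex vector \<open>Z1 - i Z2\<close> is null and orthogonal to l, with transverse
  components \<open>(a - i b) (1, i)\<close> where \<open>a = z1 3\<close> and
  \<open>b = z1 4\<close>. Of eight real components four remain: these two, \<open>z1 2\<close> and
  \<open>z2 2\<close>.\<close>

lemma z_values: "z1 1 = 0" "z2 1 = 0" "z2 3 = z1 4" "z2 4 = - z1 3"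
proof -
  show a: "z1 1 = 0" using AA[of 3] by (simp add: tr_null_def dA_eq eps4_simps)
  show b: "z2 1 = 0" using AA[of 4] by (simp add: tr_null_def dA_eq eps4_simps)
  show "z2 4 = - z1 3" using AA[of 2] a b by (simp add: tr_null_def dA_eq eps4_simps field_simps)
  show "z2 3 = z1 4" using AB[of 2] a b by (simp add: tr_null_def dA_eq dB_eq eps4_simps field_simps)
qed

end

locale null_algebra2 = null_algebra1 +
  fixes f1 f2 :: "4 \<Rightarrow> 4 \<Rightarrow> real" and r :: "4 \<Rightarrow> 4 \<Rightarrow> 4 \<Rightarrow> 4 \<Rightarrow> real"
  assumes f1_anti: "\<And>i j. f1 i j = - f1 j i" and f2_anti: "\<And>i j. f2 i j = - f2 j i"
    and r_anti_left: "\<And>i j k l. r i j k l = - r j i k l"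
    and r_anti_right: "\<And>i j k l. r i j k l = - r i j l k"
    and r_pair: "\<And>i j k l. r i j k l = r k l i j"
    and r_cyclic: "\<And>i j k l. r i j k l + r i k l j + r i l j k = 0"
    and Ricci_A: "\<And>l k i j. - 3 * (tr_null (\<lambda>e f. r f i l k * null_form e j) + tr_null (\<lambda>e f. r f j l k * null_form i e)) =
      (f1 l i * null_metric k j - f1 l j * null_metric k i - tr_null (\<lambda>m n. eps4 m k i j * f2 l n)) -
      (f1 k i * null_metric l j - f1 k j * null_metric l i - tr_null (\<lambda>m n. eps4 m l i j * f2 k n))"
begin

text \<open>Oriented rules taking each curvature component to one with ordered index pairs; with
  \<open>r_cyclic_normal\<close>, twenty independent components are left.\<close>

lemma r_normal:
  "r i i k l = 0" "r k l i i = 0"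
  "r 2 1 k l = - r 1 2 k l" "r 3 1 k l = - r 1 3 k l" "r 4 1 k l = - r 1 4 k l"
  "r 3 2 k l = - r 2 3 k l" "r 4 2 k l = - r 2 4 k l" "r 4 3 k l = - r 3 4 k l"
  "r k l 2 1 = - r k l 1 2" "r k l 3 1 = - r k l 1 3" "r k l 4 1 = - r k l 1 4"
  "r k l 3 2 = - r k l 2 3" "r k l 4 2 = - r k l 2 4" "r k l 4 3 = - r k l 3 4"
  "r 1 3 1 2 = r 1 2 1 3" "r 1 4 1 2 = r 1 2 1 4" "r 2 3 1 2 = r 1 2 2 3" "r 2 4 1 2 = r 1 2 2 4" "r 3 4 1 2 = r 1 2 3 4"
  "r 1 4 1 3 = r 1 3 1 4" "r 2 3 1 3 = r 1 3 2 3" "r 2 4 1 3 = r 1 3 2 4" "r 3 4 1 3 = r 1 3 3 4"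
  "r 2 3 1 4 = r 1 4 2 3" "r 2 4 1 4 = r 1 4 2 4" "r 3 4 1 4 = r 1 4 3 4"
  "r 2 4 2 3 = r 2 3 2 4" "r 3 4 2 3 = r 2 3 3 4" "r 3 4 2 4 = r 2 4 3 4"
  using r_anti_left[of i i k l] r_anti_right[of k l i i]
  by (auto intro: r_anti_left r_anti_right r_pair)

lemma r_cyclic_normal: "r 1 4 2 3 = r 1 3 2 4 - r 1 2 3 4"
  using r_cyclic[of 1 2 3 4] by (simp add: r_normal)

lemma f_normal:
  "f1 i i = 0" "f1 2 1 = - f1 1 2" "f1 3 1 = - f1 1 3" "f1 4 1 = - f1 1 4" "f1 3 2 = - f1 2 3" "f1 4 2 = - f1 2 4" "f1 4 3 = - f1 3 4"
  "f2 i i = 0" "f2 2 1 = - f2 1 2" "f2 3 1 = - f2 1 3" "f2 4 1 = - f2 1 4" "f2 3 2 = - f2 2 3" "f2 4 2 = - f2 2 4" "f2 4 3 = - f2 3 4"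
  using f1_anti[of i i] f2_anti[of i i] by (auto intro: f1_anti f2_anti)

lemma Ricci_A_expand: "- 3 * (r 2 i l k * null_form 1 j + r 1 i l k * null_form 2 j + r 3 i l k * null_form 3 j + r 4 i l k * null_form 4 j
      + (r 2 j l k * null_form i 1 + r 1 j l k * null_form i 2 + r 3 j l k * null_form i 3 + r 4 j l k * null_form i 4)) =
    (f1 l i * null_metric k j - f1 l j * null_metric k i -
      (eps4 1 k i j * f2 l 2 + eps4 2 k i j * f2 l 1 + eps4 3 k i j * f2 l 3 + eps4 4 k i j * f2 l 4)) -
    (f1 k i * null_metric l j - f1 k j * null_metric l i -
      (eps4 1 l i j * f2 k 2 + eps4 2 l i j * f2 k 1 + eps4 3 l i j * f2 k 3 + eps4 4 l i j * f2 k 4))"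
  using Ricci_A[of i l k j] by (simp add: tr_null_def)

text \<open>The instantiation order is \<open>i\<close>, \<open>l\<close>, \<open>k\<close>,
  \<open>j\<close>. The suffix names the pair \<open>l\<close>, \<open>k\<close>, and each list runs
  through the six pairs \<open>i < j\<close>, so there are 36 equations.\<close>

lemmas Ricci_A_12 = Ricci_A_expand[of 1 1 2 2] Ricci_A_expand[of 1 1 2 3] Ricci_A_expand[of 1 1 2 4] Ricci_A_expand[of 2 1 2 3] Ricci_A_expand[of 2 1 2 4] Ricci_A_expand[of 3 1 2 4]
lemmas Ricci_A_13 = Ricci_A_expand[of 1 1 3 2] Ricci_A_expand[of 1 1 3 3] Ricci_A_expand[of 1 1 3 4] Ricci_A_expand[of 2 1 3 3] Ricci_A_expand[of 2 1 3 4] Ricci_A_expand[of 3 1 3 4]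
lemmas Ricci_A_14 = Ricci_A_expand[of 1 1 4 2] Ricci_A_expand[of 1 1 4 3] Ricci_A_expand[of 1 1 4 4] Ricci_A_expand[of 2 1 4 3] Ricci_A_expand[of 2 1 4 4] Ricci_A_expand[of 3 1 4 4]
lemmas Ricci_A_23 = Ricci_A_expand[of 1 2 3 2] Ricci_A_expand[of 1 2 3 3] Ricci_A_expand[of 1 2 3 4] Ricci_A_expand[of 2 2 3 3] Ricci_A_expand[of 2 2 3 4] Ricci_A_expand[of 3 2 3 4]
lemmas Ricci_A_24 = Ricci_A_expand[of 1 2 4 2] Ricci_A_expand[of 1 2 4 3] Ricci_A_expand[of 1 2 4 4] Ricci_A_expand[of 2 2 4 3] Ricci_A_expand[of 2 2 4 4] Ricci_A_expand[of 3 2 4 4]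
lemmas Ricci_A_34 = Ricci_A_expand[of 1 3 4 2] Ricci_A_expand[of 1 3 4 3] Ricci_A_expand[of 1 3 4 4] Ricci_A_expand[of 2 3 4 3] Ricci_A_expand[of 2 3 4 4] Ricci_A_expand[of 3 3 4 4]
lemmas Ricci_A_all = Ricci_A_12 Ricci_A_13 Ricci_A_14 Ricci_A_23 Ricci_A_24 Ricci_A_34

lemmas Ricci_A_simplified = Ricci_A_all[simplified null_form_simps null_metric_simps eps4_simps r_normal r_cyclic_normal f_normal
    mult_zero_left mult_zero_right add_0_left add_0_right mult_1_left mult_1_right mult_minus_left mult_minus_right
    diff_0 diff_0_right minus_zero minus_minus]

text \<open>Components of \<open>F1 - *F2 = Lambda A\<close> with
  \<open>Lambda = 3 * r 3 4 3 4\<close>; curvature appears only in the component 23, where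
  \<open>A\<close> is nonzero.\<close>

lemma f_dual:
  "f1 1 2 = f2 3 4" "f1 3 4 = - f2 1 2" "f1 1 3 = - f2 1 4" "f1 1 4 = f2 1 3"
  "f1 2 3 = f2 2 4 + 3 * r 3 4 3 4" "f1 2 4 = - f2 2 3"
proof -
  show "f1 2 4 = - f2 2 3" using Ricci_A_simplified(5) Ricci_A_simplified(24) Ricci_A_simplified(25) by argo
qed (use Ricci_A_simplified(2,3,20,21,35) in simp_all)

text \<open>Besides the scalar part \<open>r 3 4 3 4\<close>, only \<open>r 2 3 2 3\<close>,
  \<open>r 2 4 2 4\<close> and \<open>r 2 3 2 4\<close> stay free: the sum of the first two is the
  Ricci component along l l, their difference and the third form the type N Weyl scalar.\<close>

lemma r_values:
  "r 1 2 1 2 = - r 3 4 3 4" "r 1 2 1 3 = 0" "r 1 2 1 4 = 0" "r 1 2 2 3 = 0" "r 1 2 2 4 = 0" "r 1 2 3 4 = 0"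
  "r 1 3 1 3 = 0" "r 1 3 1 4 = 0" "r 1 3 2 3 = r 3 4 3 4" "r 1 3 2 4 = 0" "r 1 3 3 4 = 0"
  "r 1 4 1 4 = 0" "r 1 4 2 4 = r 3 4 3 4" "r 1 4 3 4 = 0" "r 2 3 3 4 = 0" "r 2 4 3 4 = 0" "r 1 4 2 3 = 0"
  using Ricci_A_simplified(1,6,22,28,23,29,31,36) Ricci_A_simplified(4,5,7,13,18,19,25,30) f_dual r_cyclic_normal
  by simp_all

end

locale null_algebra3 = null_algebra2 +
  assumes X: "\<And>l c. tr_null (\<lambda>i j. f1 l i * null_form j c + z1 i * dA l j c) - tr_null (\<lambda>i j. f2 l i * null_dual j c + z2 i * dB l j c) = 0"
    and Y: "\<And>l c. tr_null (\<lambda>i j. f1 l i * null_dual j c + z1 i * dB l j c) + tr_null (\<lambda>i j. f2 l i * null_form j c + z2 i * dA l j c) = 0"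
begin

lemma X_expand: "f1 l 1 * null_form 2 c + z1 1 * dA l 2 c + (f1 l 2 * null_form 1 c + z1 2 * dA l 1 c) + (f1 l 3 * null_form 3 c + z1 3 * dA l 3 c)
      + (f1 l 4 * null_form 4 c + z1 4 * dA l 4 c) =
    f2 l 1 * null_dual 2 c + z2 1 * dB l 2 c + (f2 l 2 * null_dual 1 c + z2 2 * dB l 1 c) + (f2 l 3 * null_dual 3 c + z2 3 * dB l 3 c)
      + (f2 l 4 * null_dual 4 c + z2 4 * dB l 4 c)"
  using X[of l c] by (simp add: tr_null_def)

lemma Y_expand: "f1 l 1 * null_dual 2 c + z1 1 * dB l 2 c + (f1 l 2 * null_dual 1 c + z1 2 * dB l 1 c) + (f1 l 3 * null_dual 3 c + z1 3 * dB l 3 c)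
      + (f1 l 4 * null_dual 4 c + z1 4 * dB l 4 c) +
    (f2 l 1 * null_form 2 c + z2 1 * dA l 2 c + (f2 l 2 * null_form 1 c + z2 2 * dA l 1 c) + (f2 l 3 * null_form 3 c + z2 3 * dA l 3 c)
      + (f2 l 4 * null_form 4 c + z2 4 * dA l 4 c)) = 0"
  using Y[of l c] by (simp add: tr_null_def)

abbreviation "u \<equiv> z1 2"
abbreviation "v \<equiv> z2 2"
abbreviation "a \<equiv> z1 3"
abbreviation "b \<equiv> z1 4"

lemmas field_values = z_values f_normal dA_eq dB_eq eps4_simps

text \<open>\<open>X\<close> and \<open>Y\<close> supply what \<open>f_dual\<close> leaves open, so
  the derivatives of both Killing covectors become quadratic polynomials in \<open>u\<close>,
  \<open>v\<close>, \<open>a\<close>, \<open>b\<close> plus a multiple of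
  \<open>r 3 4 3 4\<close>.\<close>

lemma f_values:
  "f1 1 2 = (b * v - a * u) / 3" "f1 3 4 = (a * v + b * u) / 3"
  "f1 1 3 = (b * b - a * a) / 3" "f1 1 4 = - 2 * (a * b) / 3"
  "f1 2 3 = (3 * r 3 4 3 4 + (v * v - u * u) / 3) / 2" "f1 2 4 = u * v / 3"
  "f2 1 2 = - (a * v + b * u) / 3" "f2 3 4 = (b * v - a * u) / 3"
  "f2 1 3 = - 2 * (a * b) / 3" "f2 1 4 = (a * a - b * b) / 3"
  "f2 2 3 = - u * v / 3" "f2 2 4 = ((v * v - u * u) / 3 - 3 * r 3 4 3 4) / 2"
proof -
  have x: "f1 1 2 = (b * v - a * u) / 3" "f2 1 2 = - (a * v + b * u) / 3"
    "f1 1 3 = (b * b - a * a) / 3" "f2 1 3 = - 2 * (a * b) / 3"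
    "f1 2 3 + f2 2 4 = (v * v - u * u) / 3"
    using X_expand[of 2 3] X_expand[of 2 4] X_expand[of 3 3] X_expand[of 3 4] X_expand[of 2 2]
    by (simp_all add: field_values field_simps)
  have y: "f1 2 4 - f2 2 3 = 2 * (u * v) / 3"
    using Y_expand[of 2 2] by (simp add: field_values field_simps)
  show "f1 1 2 = (b * v - a * u) / 3" "f1 3 4 = (a * v + b * u) / 3"
    "f1 1 3 = (b * b - a * a) / 3" "f1 1 4 = - 2 * (a * b) / 3"
    "f1 2 3 = (3 * r 3 4 3 4 + (v * v - u * u) / 3) / 2" "f1 2 4 = u * v / 3"
    "f2 1 2 = - (a * v + b * u) / 3" "f2 3 4 = (b * v - a * u) / 3"
    "f2 1 3 = - 2 * (a * b) / 3" "f2 1 4 = (a * a - b * b) / 3"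
    "f2 2 3 = - u * v / 3" "f2 2 4 = ((v * v - u * u) / 3 - 3 * r 3 4 3 4) / 2"
    using x y f_dual by (simp_all add: field_simps)
qed

lemmas frame_values = z_values f_normal f_values r_normal r_values dA_eq dB_eq eps4_simps

text \<open>Real and imaginary parts of the vanishing norm of \<open>F1 - i F2\<close>: its
  self-dual part is a multiple of the null form \<open>A - i *A\<close>, and its anti-self-dual part
  is null too.\<close>

lemma f_norms:
  "tr_null (\<lambda>i k. tr_null (\<lambda>j m. f1 i j * f1 k m)) = tr_null (\<lambda>i k. tr_null (\<lambda>j m. f2 i j * f2 k m))"
  "tr_null (\<lambda>i k. tr_null (\<lambda>j m. f1 i j * f2 k m)) = 0"
  by (simp_all add: tr_null_def frame_values field_simps)

text \<open>The norm of \<open>Z1\<close> is \<open>a * a + b * b\<close>, and the contraction of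
  \<open>F1\<close> with \<open>A\<close> is \<open>2 * (b * b - a * a) / 3\<close>; the factor 3/2
  is chosen to cancel \<open>a\<close>.\<close>

lemma imaginary_part: "tr_null (\<lambda>i j. z1 i * z1 j) + 3 / 2 * tr_null (\<lambda>i k. tr_null (\<lambda>j m. f1 i j * null_form k m)) = 2 * (b * b)"
  by (simp add: tr_null_def frame_values field_simps)

end

text \<open>\<open>df1\<close> and \<open>df2\<close> are the Killing identity,
  \<open>d_norm1\<close> and \<open>d_norm2\<close> are derivatives of \<open>f_norms\<close>, and
  \<open>d_dual23\<close> and \<open>d_dual24\<close> are derivatives of two components of the
  duality relation. \<open>independent\<close> encodes that \<open>Z1\<close> and \<open>Z2\<close>
  are linearly independent.\<close>

locale null_algebra4 = null_algebra3 +
  fixes df1 df2 :: "4 \<Rightarrow> 4 \<Rightarrow> 4 \<Rightarrow> real" and dL :: "4 \<Rightarrow> real"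
  assumes df1: "\<And>l i j. df1 l i j = tr_null (\<lambda>m n. r m l i j * z1 n)"
    and df2: "\<And>l i j. df2 l i j = tr_null (\<lambda>m n. r m l i j * z2 n)"
    and d_norm1: "\<And>l. tr_null (\<lambda>i k. tr_null (\<lambda>j m. f1 i j * df1 l k m + df1 l i j * f1 k m)) =
      tr_null (\<lambda>i k. tr_null (\<lambda>j m. f2 i j * df2 l k m + df2 l i j * f2 k m))"
    and d_norm2: "\<And>l. tr_null (\<lambda>i k. tr_null (\<lambda>j m. f1 i j * df2 l k m + df1 l i j * f2 k m)) = 0"
    and d_dual23: "\<And>l. df1 l 2 3 - df2 l 2 4 = dL l + 3 * r 3 4 3 4 * dA l 2 3"
    and d_dual24: "\<And>l. df1 l 2 4 + df2 l 2 3 = 3 * r 3 4 3 4 * dA l 2 4"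
    and independent: "a * a + b * b \<noteq> 0"
begin

lemma df_eq: "df1 l i j = r 2 l i j * z1 1 + r 1 l i j * z1 2 + r 3 l i j * z1 3 + r 4 l i j * z1 4"
  "df2 l i j = r 2 l i j * z2 1 + r 1 l i j * z2 2 + r 3 l i j * z2 3 + r 4 l i j * z2 4"
  by (simp_all add: df1 df2 tr_null_def add.commute)

text \<open>
  The two equations are the real and imaginary parts of \<open>\<psi> (a + \<i> b)\<^sup>3 = 0\<close> for the
  type N Weyl scalar \<open>\<psi>\<close>.
\<close>

lemma weyl_values: "r 2 4 2 4 = r 2 3 2 3" "r 2 3 2 4 = 0"
proof -
  define D Q where "D = r 2 3 2 3 - r 2 4 2 4" and "Q = 2 * r 2 3 2 4"
  define s t where "s = a * a * a - 3 * (a * b * b)" and "t = 3 * (a * a * b) - b * b * b"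
  have 1: "s * D + t * Q = 0"
    using d_norm1[of 2] unfolding D_def Q_def s_def t_def
    by (simp add: tr_null_def df_eq frame_values) (simp add: field_simps)
  have 2: "s * Q - t * D = 0"
    using d_norm2[of 2] unfolding D_def Q_def s_def t_def
    by (simp add: tr_null_def df_eq frame_values) (simp add: field_simps)
  \<comment> \<open>Solves the linear system for \<open>D\<close> and \<open>Q\<close>. As
    \<open>s + i t\<close> is the cube of \<open>a + i b\<close>, its determinant is a power of
    \<open>a * a + b * b\<close>.\<close>
  have "(s * s + t * t) * D = s * (s * D + t * Q) - t * (s * Q - t * D)"
    "(s * s + t * t) * Q = t * (s * D + t * Q) + s * (s * Q - t * D)" by algebra+
  moreover have "s * s + t * t = (a * a + b * b) ^ 3" unfolding s_def t_def by algebra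
  ultimately have "D = 0" "Q = 0" using 1 2 independent by auto
  then show "r 2 4 2 4 = r 2 3 2 3" "r 2 3 2 4 = 0" unfolding D_def Q_def by auto
qed

text \<open>\<open>A\<close> has no component 24, so the derivative of the duality relation there
  contains no \<open>dL\<close> and turns into the constraint
  \<open>b * r 2 3 2 3 = 0\<close>.\<close>

lemma dL_values: "dL 1 = 0" "dL 2 = - 2 * (a * r 2 3 2 3)" "dL 3 = 0" "dL 4 = 0" "b * r 2 3 2 3 = 0"
  using d_dual23[of 1] d_dual23[of 2] d_dual23[of 3] d_dual23[of 4] d_dual24[of 2] weyl_values
  by (simp_all add: df_eq frame_values field_simps)

text \<open>\<open>null_form\<close> picks out the component 13 of \<open>df1\<close>, in which
  \<open>r 2 3 2 3\<close> does not occur; hence \<open>imaginary_part\<close> is stationary even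
  where the Ricci tensor has a part along l l.\<close>

lemma d_imaginary_part:
  "tr_null (\<lambda>i j. z1 i * f1 l j + f1 l i * z1 j) + 3 / 2 * tr_null (\<lambda>i k. tr_null (\<lambda>j m. f1 i j * dA l k m + df1 l i j * null_form k m)) = 0"
proof -
  have ?thesis if "l = 1" unfolding that using weyl_values by (simp add: tr_null_def df_eq frame_values) (simp add: field_simps)
  moreover have ?thesis if "l = 2" unfolding that using weyl_values by (simp add: tr_null_def df_eq frame_values) (simp add: field_simps)
  moreover have ?thesis if "l = 3" unfolding that using weyl_values by (simp add: tr_null_def df_eq frame_values) (simp add: field_simps)
  moreover have ?thesis if "l = 4" unfolding that using weyl_values by (simp add: tr_null_def df_eq frame_values) (simp add: field_simps)
  ultimately show ?thesis using exhaust_4[of l] by blast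
qed

end

context null_algebra3
begin

text \<open>The left sides here and in \<open>lie_zero\<close> are the frame components of the
  lowered bracket and of the Lie derivatives of \<open>A\<close>, written with covariant
  derivatives.\<close>

lemma bracket_zero:
  assumes "b = 0"
  shows "tr_null (\<lambda>m n. z1 m * f2 n i) - tr_null (\<lambda>m n. z2 m * f1 n i) = 0"
proof -
  have ?thesis if "i = 1 \<or> i = 2 \<or> i = 3 \<or> i = 4"
    using that assms by (elim disjE) (simp_all add: tr_null_def frame_values field_simps)
  then show ?thesis using exhaust_4 by blast
qed

lemma lie_zero:
  assumes "b = 0"
  shows "tr_null (\<lambda>m n. z1 m * dA n i j) + tr_null (\<lambda>m n. null_form m j * f1 i n) + tr_null (\<lambda>m n. null_form i m * f1 j n) = 0" (is ?A)
    and "tr_null (\<lambda>m n. z2 m * dA n i j) + tr_null (\<lambda>m n. null_form m j * f2 i n) + tr_null (\<lambda>m n. null_form i m * f2 j n) = 0" (is ?B)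
proof -
  have "?A \<and> ?B" if "i = 1 \<or> i = 2 \<or> i = 3 \<or> i = 4" "j = 1 \<or> j = 2 \<or> j = 3 \<or> j = 4"
    using that assms by (elim disjE) (simp_all add: tr_null_def frame_values field_simps)
  then show ?A ?B using exhaust_4 by blast+
qed

end

subsection \<open>Traces, Lie derivatives and the Hodge dual\<close>

definition tr_g :: "metric \<Rightarrow> point \<Rightarrow> (4 \<Rightarrow> 4 \<Rightarrow> real) \<Rightarrow> real" where
  "tr_g g p T = (\<Sum>a\<in>UNIV. \<Sum>b\<in>UNIV. ginv g p $ a $ b * T a b)"

lemma tr_g_mult_left: "tr_g g p (\<lambda>a b. c * T a b) = c * tr_g g p T"
  by (simp add: tr_g_def sum_distrib_left mult.left_commute)

lemma tr_g_mult_right: "tr_g g p (\<lambda>a b. T a b * c) = tr_g g p T * c"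
  using tr_g_mult_left[of g p c T] by (simp add: mult.commute)

lemma fr1_tr_g: "fr1 e (\<lambda>c. tr_g g p (\<lambda>a b. T a b c)) k = tr_g g p (\<lambda>a b. fr1 e (T a b) k)"
  by (simp add: tr_g_def fr1_linear)

lemma fr2_product: "fr2 e (\<lambda>a b. w a * v b) i j = fr1 e w i * fr1 e v j"
  by (simp add: fr2_def fr1_linear)

lemma fr2_transpose: "fr2 e (\<lambda>a b. T b a) i j = fr2 e T j i"
  unfolding fr2_def by (rule fr1_swap)

text \<open>Turns raised indices into nested metric traces, for which the change to a frame is
  known.\<close>

lemma sum_raise2:
  fixes T :: "real form2"
  shows "(\<Sum>c\<in>UNIV. \<Sum>d\<in>UNIV. Y c d * raise2 g T p c d) =
    tr_g g p (\<lambda>c e. tr_g g p (\<lambda>d f. Y c d * T p e f))"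
proof -
  have "(\<Sum>d\<in>UNIV. Y c d * raise2 g T p c d) =
      (\<Sum>e\<in>UNIV. \<Sum>d\<in>UNIV. \<Sum>f\<in>UNIV. ginv g p $ c $ e * (ginv g p $ d $ f * (Y c d * T p e f)))" for c
    unfolding raise2_def real_scaleR_def sum_distrib_left
    by (rule trans[OF sum.swap]) (simp add: mult_ac)
  then show ?thesis by (simp add: tr_g_def sum_distrib_left)
qed

lemma hodge_tr_g:
  "hodge g os T p a b = tr_g g p (\<lambda>c e. tr_g g p (\<lambda>d f. volume_element g os p a b c d * T p e f)) / 2"
  unfolding hodge_def sum_raise2 ..

definition nabla_vector :: "metric \<Rightarrow> real form1 \<Rightarrow> point \<Rightarrow> 4 \<Rightarrow> 4 \<Rightarrow> real" where
  "nabla_vector g X p a c = pd a (\<lambda>x. X x c) p + (\<Sum>d\<in>UNIV. christoffel g p c a d * X p d)"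

context metric_domain
begin

lemma ginv_sym:
  assumes "p \<in> M"
  shows "ginv g p $ a $ b = ginv g p $ b $ a"
proof -
  have "transpose (g p) = g p" using lorentzian_g[OF assms] unfolding lorentzian_def by blast
  then have "matrix_inv (g p) = transpose (matrix_inv (g p))"
    using matrix_inv_inverse[OF invertible_g[OF assms]]
    by (intro matrix_inv_unique) (metis matrix_transpose_mul transpose_mat)+
  then have "ginv g p $ a $ b = transpose (ginv g p) $ a $ b" unfolding ginv_def by simp
  then show ?thesis by (simp add: transpose_def)
qed

lemma raise_real: "raise g w p a = (\<Sum>b\<in>UNIV. ginv g p $ a $ b * (w p b :: real))"
  by (simp add: raise_def)

lemma lower_raise: "p \<in> M \<Longrightarrow> (\<Sum>c\<in>UNIV. g p $ a $ c * raise g w p c) = w p a"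
  unfolding raise_real by (rule lower_raised)

lemma smooth_raise:
  fixes w :: "real form1"
  assumes "\<And>a. smooth_on M (\<lambda>x. w x a)"
  shows "smooth_on M (\<lambda>x. raise g w x a)"
  unfolding raise_real by (intro smooth_on_sum smooth_on_mult open_M assms smooth_ginv)

text \<open>Raising an index commutes with covariant differentiation: the lowering equation for
  \<open>raise g w\<close> is differentiated with a parallel metric, and the result is raised
  back.\<close>

lemma nabla_vector_raise:
  assumes p: "p \<in> M" and w: "\<And>a. smooth_on M (\<lambda>x. w x a)"
  shows "nabla_vector g (raise g w) p a c = (\<Sum>b\<in>UNIV. ginv g p $ c $ b * nabla1 g w p a b)"
proof -
  let ?X = "raise g w"
  note [simp] = differentiable_on_M[OF p]
  have low: "(\<Sum>c\<in>UNIV. g p $ e $ c * nabla_vector g ?X p a c) = nabla1 g w p a e" for e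
  proof -
    have "pd a (\<lambda>x. \<Sum>c\<in>UNIV. g x $ e $ c * ?X x c) p = pd a (\<lambda>x. w x e) p"
      by (rule pd_cong[OF open_M p]) (rule lower_raise)
    then have 1: "(\<Sum>c\<in>UNIV. g p $ e $ c * pd a (\<lambda>x. ?X x c) p) =
        pd a (\<lambda>x. w x e) p - (\<Sum>c\<in>UNIV. pd a (\<lambda>x. g x $ e $ c) p * ?X p c)"
      by (simp add: pd_sum pd_mult smooth_raise w smooth_on_mult open_M sum.distrib)
    have gd: "pd a (\<lambda>x. g x $ e $ c) p = (\<Sum>d\<in>UNIV. christoffel g p d a e * g p $ d $ c) + (\<Sum>d\<in>UNIV. christoffel g p d a c * g p $ e $ d)" for c
      using nabla2_metric[OF p, of a e c] by (simp add: nabla2_def)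
    have 2: "(\<Sum>c\<in>UNIV. pd a (\<lambda>x. g x $ e $ c) p * ?X p c) =
        (\<Sum>c\<in>UNIV. \<Sum>d\<in>UNIV. christoffel g p d a e * (g p $ d $ c * ?X p c)) +
        (\<Sum>c\<in>UNIV. \<Sum>d\<in>UNIV. g p $ e $ d * (christoffel g p d a c * ?X p c))"
      unfolding gd distrib_right sum.distrib sum_distrib_right by (simp add: mult_ac)
    have 3: "(\<Sum>c\<in>UNIV. \<Sum>d\<in>UNIV. christoffel g p d a e * (g p $ d $ c * ?X p c)) = (\<Sum>d\<in>UNIV. christoffel g p d a e * w p d)"
      by (rule trans[OF sum.swap]) (simp add: sum_distrib_left[symmetric] lower_raise[OF p])
    have 4: "(\<Sum>c\<in>UNIV. \<Sum>d\<in>UNIV. g p $ e $ d * (christoffel g p d a c * ?X p c)) =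
        (\<Sum>c\<in>UNIV. g p $ e $ c * (\<Sum>d\<in>UNIV. christoffel g p c a d * ?X p d))"
      unfolding sum_distrib_left by (rule sum.swap)
    show ?thesis
      unfolding nabla_vector_def nabla1_def distrib_left sum.distrib 1 2 3 4 by simp
  qed
  show ?thesis using raise_lowered[OF p, of c "nabla_vector g ?X p a"] unfolding low by simp
qed

text \<open>The connection is torsion-free, so replacing partial by covariant derivatives adds
  Christoffel terms that cancel in pairs.\<close>

lemma lie_derivative2_nabla:
  assumes p: "p \<in> M"
  shows "lie_derivative2 X T p a b = (\<Sum>c\<in>UNIV. X p c * nabla2 g T p c a b +
    T p c b * nabla_vector g X p a c + T p a c * nabla_vector g X p b c)"
proof -
  have 1: "(\<Sum>c\<in>UNIV. X p c * (\<Sum>d\<in>UNIV. christoffel g p d c a * T p d b)) =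
      (\<Sum>c\<in>UNIV. T p c b * (\<Sum>d\<in>UNIV. christoffel g p c a d * X p d))"
    unfolding sum_distrib_left by (rule trans[OF sum.swap]) (simp add: christoffel_sym[OF p, of _ a] mult_ac)
  have 2: "(\<Sum>c\<in>UNIV. X p c * (\<Sum>d\<in>UNIV. christoffel g p d c b * T p a d)) =
      (\<Sum>c\<in>UNIV. T p a c * (\<Sum>d\<in>UNIV. christoffel g p c b d * X p d))"
    unfolding sum_distrib_left by (rule trans[OF sum.swap]) (simp add: christoffel_sym[OF p, of _ b] mult_ac)
  show ?thesis
    unfolding lie_derivative2_def nabla2_def nabla_vector_def real_scaleR_def
      right_diff_distrib distrib_left sum.distrib sum_subtractf 1 2 by simp
qed

lemma lie_bracket_nabla:
  assumes p: "p \<in> M"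
  shows "lie_bracket X Y p a = (\<Sum>c\<in>UNIV. X p c * nabla_vector g Y p c a - Y p c * nabla_vector g X p c a)"
proof -
  have "(\<Sum>c\<in>UNIV. X p c * (\<Sum>d\<in>UNIV. christoffel g p a c d * Y p d)) =
      (\<Sum>c\<in>UNIV. Y p c * (\<Sum>d\<in>UNIV. christoffel g p a c d * X p d))"
    unfolding sum_distrib_left by (rule trans[OF sum.swap]) (simp add: christoffel_sym[OF p, of a] mult_ac)
  then show ?thesis
    unfolding lie_bracket_def nabla_vector_def right_diff_distrib distrib_left sum.distrib sum_subtractf by simp
qed

text \<open>In the Lie derivative of the metric the term with the derivative of \<open>g\<close>
  vanishes, which leaves the symmetrised covariant derivative.\<close>

lemma killing_nabla1:
  assumes killing: "killing_vector_on M g (raise g w)" and w: "\<And>a. smooth_on M (\<lambda>x. w x a)" and p: "p \<in> M"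
  shows "nabla1 g w p a b = - nabla1 g w p b a"
proof -
  have low: "(\<Sum>c\<in>UNIV. g p $ e $ c * nabla_vector g (raise g w) p a c) = nabla1 g w p a e" for a e
    unfolding nabla_vector_raise[OF p w] by (rule lower_raised[OF p])
  have low': "(\<Sum>c\<in>UNIV. g p $ c $ e * nabla_vector g (raise g w) p a c) = nabla1 g w p a e" for a e
    using low[of e a] by (simp add: g_sym[OF p, of _ e])
  have "lie_derivative2 (raise g w) (\<lambda>x i j. g x $ i $ j) p a b = 0"
    using killing p unfolding killing_vector_on_def by blast
  then show ?thesis
    unfolding lie_derivative2_nabla[OF p] nabla2_metric[OF p] by (simp add: sum.distrib low low')
qed

lemma lie_derivative2_raise:
  assumes p: "p \<in> M" and w: "\<And>a. smooth_on M (\<lambda>x. w x a)"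
  shows "lie_derivative2 (raise g w) T p a b = tr_g g p (\<lambda>c d. w p d * nabla2 g T p c a b)
    + tr_g g p (\<lambda>c d. T p c b * nabla1 g w p a d) + tr_g g p (\<lambda>c d. T p a c * nabla1 g w p b d)"
  unfolding lie_derivative2_nabla[OF p] nabla_vector_raise[OF p w] raise_real tr_g_def
  by (simp add: sum.distrib sum_distrib_left sum_distrib_right mult_ac)

lemma lower_lie_bracket_raise:
  assumes p: "p \<in> M" and w: "\<And>a. smooth_on M (\<lambda>x. w x a)" and v: "\<And>a. smooth_on M (\<lambda>x. v x a)"
  shows "lie_bracket (raise g w) (raise g v) p a = (\<Sum>b\<in>UNIV. ginv g p $ a $ b *
    (tr_g g p (\<lambda>c d. w p d * nabla1 g v p c b) - tr_g g p (\<lambda>c d. v p d * nabla1 g w p c b)))"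
proof -
  have 1: "(\<Sum>c\<in>UNIV. raise g w p c * (\<Sum>b\<in>UNIV. ginv g p $ a $ b * nabla1 g v p c b)) =
      (\<Sum>b\<in>UNIV. ginv g p $ a $ b * tr_g g p (\<lambda>c d. w p d * nabla1 g v p c b))" for w v
    unfolding tr_g_def raise_real sum_distrib_left sum_distrib_right
    by (rule trans[OF sum.swap]) (simp add: mult_ac)
  show ?thesis
    unfolding lie_bracket_nabla[OF p] nabla_vector_raise[OF p w] nabla_vector_raise[OF p v]
      sum_subtractf right_diff_distrib 1 ..
qed

lemma smooth_volume_element: "smooth_on M (\<lambda>x. volume_element g os x a b c d)"
proof -
  have "smooth_on M (\<lambda>x. \<bar>det (g x)\<bar>)"
  proof (rule smooth_on_cong[OF open_M])
    show "smooth_on M (\<lambda>x. - det (g x))"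
      by (intro smooth_on_minus smooth_on_det smooth_metric open_M)
  qed (simp add: abs_of_neg det_g_neg)
  then have "smooth_on M (\<lambda>x. sqrt \<bar>det (g x)\<bar>)"
    by (rule smooth_on_sqrt[OF open_M]) (use det_g_neg in force)
  then show ?thesis
    unfolding volume_element_eps4 by (intro smooth_on_mult open_M smooth_on_const)
qed

lemma smooth_tr_g:
  assumes "\<And>a b. smooth_on M (\<lambda>x. T x a b)"
  shows "smooth_on M (\<lambda>x. tr_g g x (T x))"
  unfolding tr_g_def by (intro smooth_on_sum smooth_on_mult open_M assms smooth_ginv)

lemma smooth_hodge:
  assumes "\<And>a b. smooth_on M (\<lambda>x. T x a b)"
  shows "smooth_on M (\<lambda>x. hodge g os T x a b)"
  unfolding hodge_tr_g
  by (intro smooth_on_divide smooth_tr_g smooth_on_mult smooth_volume_element assms open_M smooth_on_const) simp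

lemma smooth_codiff:
  fixes T :: "real form2"
  assumes "\<And>a b. smooth_on M (\<lambda>x. T x a b)"
  shows "smooth_on M (\<lambda>x. codiff g T x a)"
  unfolding codiff_def real_scaleR_def
  by (intro smooth_on_minus smooth_on_sum smooth_on_mult smooth_nabla2 smooth_ginv assms open_M)

lemma smooth_riemann_up: "smooth_on M (\<lambda>x. riemann_up g x a b c d)"
  unfolding riemann_up_def
  by (intro smooth_on_add smooth_on_diff smooth_on_sum smooth_on_mult smooth_on_pd smooth_christoffel open_M)

lemma smooth_ricci: "smooth_on M (\<lambda>x. ricci g x a b)"
  unfolding ricci_def by (intro smooth_on_sum smooth_riemann_up open_M)

lemma scalar_curvature_tr_g: "scalar_curvature g p = tr_g g p (ricci g p)"
  by (simp add: scalar_curvature_def tr_g_def)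

lemma smooth_scalar_curvature: "smooth_on M (scalar_curvature g)"
  unfolding scalar_curvature_tr_g[abs_def] by (intro smooth_tr_g smooth_ricci)

lemma ricci_tr_g: "p \<in> M \<Longrightarrow> ricci g p a b = tr_g g p (\<lambda>c d. riemann g p d a c b)"
  unfolding ricci_def tr_g_def by (simp add: riemann_up_eq)

end

subsection \<open>The conformal Killing-Yano equation in real form\<close>

lemma pd_self_dual:
  fixes f h :: "point \<Rightarrow> real"
  assumes "f differentiable (at p)" "h differentiable (at p)"
  shows "pd a (\<lambda>x. (complex_of_real (f x) - \<i> * complex_of_real (h x)) / complex_of_real (sqrt 2)) p =
    (complex_of_real (pd a f p) - \<i> * complex_of_real (pd a h p)) / complex_of_real (sqrt 2)"
proof -
  have "(f has_derivative frechet_derivative f (at p)) (at p)" "(h has_derivative frechet_derivative h (at p)) (at p)"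
    using assms frechet_derivative_works by blast+
  then have "((\<lambda>x. (complex_of_real (f x) - \<i> * complex_of_real (h x)) / complex_of_real (sqrt 2)) has_derivative
    (\<lambda>v. (complex_of_real (frechet_derivative f (at p) v) - \<i> * complex_of_real (frechet_derivative h (at p) v)) / complex_of_real (sqrt 2))) (at p)"
    by (auto intro!: derivative_eq_intros)
  then show ?thesis unfolding pd_def by (simp add: pd_eqI[unfolded pd_def])
qed

context metric_domain
begin

lemma nabla2_self_dual:
  assumes p: "p \<in> M" and A: "\<And>a b. smooth_on M (\<lambda>x. A x a b)"
  shows "nabla2 g (self_dual g os A) p a b c =
    (complex_of_real (nabla2 g A p a b c) - \<i> * complex_of_real (nabla2 g (hodge g os A) p a b c)) / complex_of_real (sqrt 2)"
proof -
  have "pd a (\<lambda>x. self_dual g os A x b c) p = (complex_of_real (pd a (\<lambda>x. A x b c) p) -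
      \<i> * complex_of_real (pd a (\<lambda>x. hodge g os A x b c) p)) / complex_of_real (sqrt 2)"
    unfolding self_dual_def by (intro pd_self_dual differentiable_on_M[OF p] A smooth_hodge)
  then show ?thesis
    unfolding nabla2_def self_dual_def scaleR_conv_of_real
    by (simp add: diff_divide_distrib right_diff_distrib sum_subtractf sum_distrib_left sum_divide_distrib mult_ac)
qed

lemma codiff_self_dual:
  assumes p: "p \<in> M" and A: "\<And>a b. smooth_on M (\<lambda>x. A x a b)"
  shows "codiff g (self_dual g os A) p c =
    (complex_of_real (codiff g A p c) - \<i> * complex_of_real (codiff g (hodge g os A) p c)) / complex_of_real (sqrt 2)"
  unfolding codiff_def nabla2_self_dual[OF p A] scaleR_conv_of_real
  by (simp add: diff_divide_distrib right_diff_distrib sum_subtractf sum_distrib_left sum_divide_distrib mult_ac)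

lemma raise_self_dual:
  assumes p: "p \<in> M" and A: "\<And>a b. smooth_on M (\<lambda>x. A x a b)"
  shows "raise g (codiff g (self_dual g os A)) p c =
    (complex_of_real (raise g (codiff g A) p c) - \<i> * complex_of_real (raise g (codiff g (hodge g os A)) p c)) / complex_of_real (sqrt 2)"
  unfolding raise_def codiff_self_dual[OF p A] scaleR_conv_of_real
  by (simp add: diff_divide_distrib right_diff_distrib sum_subtractf sum_distrib_left sum_divide_distrib mult_ac)

lemma raise_Gtensor:
  assumes p: "p \<in> M"
  shows "(\<Sum>m\<in>UNIV. raise g w p m * Gtensor g p m a b c) = w p b * g p $ a $ c - w p c * g p $ a $ b"
proof -
  have "(\<Sum>m\<in>UNIV. raise g w p m * Gtensor g p m a b c) =
      (\<Sum>m\<in>UNIV. g p $ b $ m * raise g w p m) * g p $ a $ c - (\<Sum>m\<in>UNIV. g p $ c $ m * raise g w p m) * g p $ a $ b"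
    unfolding Gtensor_def right_diff_distrib sum_subtractf sum_distrib_right
    by (simp add: g_sym[OF p, of _ b] g_sym[OF p, of _ c] mult_ac)
  then show ?thesis unfolding lower_raise[OF p] by simp
qed

text \<open>Real and imaginary parts of the complex equation, once the factor
  \<open>1 / sqrt 2\<close> common to both sides is cancelled.\<close>

lemma cky_real:
  assumes p: "p \<in> M" and cky: "cky_tensor_on M g os A"
  defines "Z1 \<equiv> codiff g A" and "Z2 \<equiv> codiff g (hodge g os A)"
  shows "3 * nabla2 g A p a b c = Z1 p b * g p $ a $ c - Z1 p c * g p $ a $ b
      - tr_g g p (\<lambda>m n. volume_element g os p m a b c * Z2 p n)"
    and "3 * nabla2 g (hodge g os A) p a b c = Z2 p b * g p $ a $ c - Z2 p c * g p $ a $ b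
      + tr_g g p (\<lambda>m n. volume_element g os p m a b c * Z1 p n)"
proof -
  have A: "smooth_on M (\<lambda>x. A x a b)" for a b
    using cky unfolding cky_tensor_on_def smooth_two_form_on_def by blast
  let ?v = "\<lambda>m. volume_element g os p m a b c" and ?G = "\<lambda>m. Gtensor g p m a b c"
  let ?x = "nabla2 g A p a b c" and ?y = "nabla2 g (hodge g os A) p a b c"
  have V: "(\<Sum>m\<in>UNIV. raise g w p m * ?v m) = tr_g g p (\<lambda>m n. ?v m * w p n)" for w :: "real form1"
    unfolding tr_g_def raise_real sum_distrib_right by (simp add: mult_ac)
  have s: "complex_of_real (sqrt 2) \<noteq> 0" by simp
  have "3 * nabla2 g (self_dual g os A) p a b c =
        2 * (\<Sum>m\<in>UNIV. raise g (codiff g (self_dual g os A)) p m * self_dual_metric g os p m a b c)"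
    using cky p unfolding cky_tensor_on_def by blast
  then have "3 * (complex_of_real ?x - \<i> * complex_of_real ?y) / complex_of_real (sqrt 2) =
      (\<Sum>m\<in>UNIV. (complex_of_real (raise g Z1 p m) - \<i> * complex_of_real (raise g Z2 p m)) *
         (complex_of_real (?G m) - \<i> * complex_of_real (?v m))) / complex_of_real (sqrt 2)"
    unfolding nabla2_self_dual[OF p A] raise_self_dual[OF p A] self_dual_metric_def Z1_def Z2_def
    by (simp add: sum_distrib_left sum_divide_distrib)
  then have E: "3 * (complex_of_real ?x - \<i> * complex_of_real ?y) =
      (\<Sum>m\<in>UNIV. (complex_of_real (raise g Z1 p m) - \<i> * complex_of_real (raise g Z2 p m)) *
         (complex_of_real (?G m) - \<i> * complex_of_real (?v m)))"
    using s by (metis (no_types, lifting) divide_cancel_right)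
  have "3 * ?x = (\<Sum>m\<in>UNIV. raise g Z1 p m * ?G m - raise g Z2 p m * ?v m)"
    using arg_cong[OF E, of Re] by simp
  then show "3 * ?x = Z1 p b * g p $ a $ c - Z1 p c * g p $ a $ b - tr_g g p (\<lambda>m n. ?v m * Z2 p n)"
    unfolding sum_subtractf raise_Gtensor[OF p] V .
  have "- (3 * ?y) = (\<Sum>m\<in>UNIV. - (raise g Z1 p m * ?v m) - raise g Z2 p m * ?G m)"
    using arg_cong[OF E, of Im] by simp
  then have "- (3 * ?y) = - (\<Sum>m\<in>UNIV. raise g Z1 p m * ?v m) - (\<Sum>m\<in>UNIV. raise g Z2 p m * ?G m)"
    by (simp add: sum_subtractf sum_negf)
  then show "3 * ?y = Z2 p b * g p $ a $ c - Z2 p c * g p $ a $ b + tr_g g p (\<lambda>m n. ?v m * Z1 p n)"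
    unfolding raise_Gtensor[OF p] V by simp
qed

end

subsection \<open>Existence of adapted null frames\<close>

text \<open>
  In an orthonormal frame the components of \<open>T\<close> are an electric field \<open>r y\<close> and a magnetic field
  \<open>r z\<close>, where nullity makes \<open>y\<close> and \<open>z\<close> orthonormal.  The fundamental vector points along
  \<open>k = z \<times> y\<close>, and the sign \<open>t\<close> in front of the last vector fixes the orientation.
\<close>

lemma null_frame_algebra:
  fixes T :: "4 \<Rightarrow> 4 \<Rightarrow> real"
  assumes anti: "\<And>i j. T j i = - T i j"
    and n1: "T 1 2 * T 1 2 + T 1 3 * T 1 3 + T 1 4 * T 1 4 = T 3 4 * T 3 4 + T 2 4 * T 2 4 + T 2 3 * T 2 3"
    and n2: "T 1 2 * T 3 4 - T 1 3 * T 2 4 + T 1 4 * T 2 3 = 0"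
    and nz: "\<exists>i j. T i j \<noteq> 0" and t: "t * t = 1"
  shows "\<exists>L. (\<forall>i j. fr2 L (\<lambda>i j. minkowski $ i $ j) i j = null_metric i j) \<and> (\<forall>i j. fr2 L T i j = null_form i j) \<and>
    t * det (frame_matrix L) = 1"
proof -
  have Tn: "T i i = 0" "T 2 1 = - T 1 2" "T 3 1 = - T 1 3" "T 4 1 = - T 1 4" "T 3 2 = - T 2 3" "T 4 2 = - T 2 4" "T 4 3 = - T 3 4" for i
    using anti[of i i] by (auto intro: anti)
  define r where "r = sqrt (T 1 2 * T 1 2 + T 1 3 * T 1 3 + T 1 4 * T 1 4)"
  have sq: "r * r = T 1 2 * T 1 2 + T 1 3 * T 1 3 + T 1 4 * T 1 4" unfolding r_def by simp
  have "r \<noteq> 0"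
  proof
    assume "r = 0"
    then have 1: "T 1 2 * T 1 2 + T 1 3 * T 1 3 + T 1 4 * T 1 4 = 0" using sq by simp
    have s0: "u = 0 \<and> v = 0 \<and> w = 0" if "u * u + v * v + w * w = 0" for u v w :: real
      using that by (smt (verit) mult_eq_0_iff zero_le_square)
    have "T 1 2 = 0 \<and> T 1 3 = 0 \<and> T 1 4 = 0" by (rule s0[OF 1])
    moreover have "T 3 4 = 0 \<and> T 2 4 = 0 \<and> T 2 3 = 0" by (rule s0) (use 1 n1 in simp)
    ultimately have "\<forall>i j. T i j = 0" unfolding forall_4 by (simp add: Tn)
    then show False using nz by blast
  qed
  define y1 y2 y3 z1 z2 z3 where "y1 = T 1 2 / r" and "y2 = T 1 3 / r" and "y3 = T 1 4 / r"
    and "z1 = T 3 4 / r" and "z2 = - T 2 4 / r" and "z3 = T 2 3 / r"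
  have Tv: "T 1 2 = r * y1" "T 1 3 = r * y2" "T 1 4 = r * y3" "T 3 4 = r * z1" "T 2 4 = - (r * z2)" "T 2 3 = r * z3"
    using \<open>r \<noteq> 0\<close> unfolding y1_def y2_def y3_def z1_def z2_def z3_def by auto
  have "r * r * (y1 * y1 + y2 * y2 + y3 * y3) = r * r * 1" using sq unfolding Tv by algebra
  then have yy: "y1 * y1 + y2 * y2 + y3 * y3 = 1" using \<open>r \<noteq> 0\<close> by simp
  have "r * r * (z1 * z1 + z2 * z2 + z3 * z3) = r * r * 1" using sq n1 unfolding Tv by algebra
  then have zz: "z1 * z1 + z2 * z2 + z3 * z3 = 1" using \<open>r \<noteq> 0\<close> by simp
  have "r * r * (y1 * z1 + y2 * z2 + y3 * z3) = 0" using n2 unfolding Tv by algebra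
  then have yz: "y1 * z1 + y2 * z2 + y3 * z3 = 0" using \<open>r \<noteq> 0\<close> by simp
  define k1 k2 k3 where "k1 = z2 * y3 - z3 * y2" and "k2 = z3 * y1 - z1 * y3" and "k3 = z1 * y2 - z2 * y1"
  note k = k1_def k2_def k3_def
  have kk: "k1 * k1 + k2 * k2 + k3 * k3 = 1" unfolding k using yy zz yz by algebra
  have ky: "k1 * y1 + k2 * y2 + k3 * y3 = 0" unfolding k by algebra
  have kz: "k1 * z1 + k2 * z2 + k3 * z3 = 0" unfolding k by algebra
  have kxy: "k2 * y3 - k3 * y2 = - z1" "k3 * y1 - k1 * y3 = - z2" "k1 * y2 - k2 * y1 = - z3"
    unfolding k using yy yz by algebra+
  have kxz: "k2 * z3 - k3 * z2 = y1" "k3 * z1 - k1 * z3 = y2" "k1 * z2 - k2 * z1 = y3"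
    unfolding k using zz yz by algebra+
  \<comment> \<open>The product of the first two vectors is \<open>2 * r * q\<close>, which this
    normalises to 1.\<close>
  define q where "q = 1 / (2 * r)"
  have rq: "r * q = 1 / 2" using \<open>r \<noteq> 0\<close> unfolding q_def by simp
  define L :: "4 \<Rightarrow> 4 \<Rightarrow> real" where "L = (\<lambda>i m.
    if i = 1 then (if m = 1 then r else if m = 2 then r * k1 else if m = 3 then r * k2 else r * k3)
    else if i = 2 then (if m = 1 then - q else if m = 2 then q * k1 else if m = 3 then q * k2 else q * k3)
    else if i = 3 then (if m = 1 then 0 else if m = 2 then - y1 else if m = 3 then - y2 else - y3)
    else (if m = 1 then 0 else if m = 2 then t * z1 else if m = 3 then t * z2 else t * z3))"
  have Lv: "L 1 1 = r" "L 1 2 = r * k1" "L 1 3 = r * k2" "L 1 4 = r * k3"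
    "L 2 1 = - q" "L 2 2 = q * k1" "L 2 3 = q * k2" "L 2 4 = q * k3"
    "L 3 1 = 0" "L 3 2 = - y1" "L 3 3 = - y2" "L 3 4 = - y3"
    "L 4 1 = 0" "L 4 2 = t * z1" "L 4 3 = t * z2" "L 4 4 = t * z3"
    unfolding L_def by simp_all
  have mink: "fr2 L (\<lambda>i j. minkowski $ i $ j) i j = - L i 1 * L j 1 + L i 2 * L j 2 + L i 3 * L j 3 + L i 4 * L j 4" for i j
    unfolding fr2_def fr1_def sum_4 by (simp add: minkowski_def)
  have M: "\<forall>i j. fr2 L (\<lambda>i j. minkowski $ i $ j) i j = null_metric i j"
    unfolding forall_4 mink Lv null_metric_simps using kk ky kz yy zz yz rq t
    by (intro conjI; algebra)
  have TT: "fr2 L T i j = (L i 1 * L j 2 - L i 2 * L j 1) * (r * y1) + (L i 1 * L j 3 - L i 3 * L j 1) * (r * y2)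
      + (L i 1 * L j 4 - L i 4 * L j 1) * (r * y3) + (L i 3 * L j 4 - L i 4 * L j 3) * (r * z1)
      - (L i 2 * L j 4 - L i 4 * L j 2) * (r * z2) + (L i 2 * L j 3 - L i 3 * L j 2) * (r * z3)" for i j
    unfolding fr2_def fr1_def sum_4 Tn Tv by (simp add: algebra_simps)
  have A: "\<forall>i j. fr2 L T i j = null_form i j"
  proof -
    have 12: "fr2 L T 1 2 = 0" unfolding TT Lv using ky by algebra
    have 13: "fr2 L T 1 3 = 0"
    proof -
      have "fr2 L T 1 3 = - (r * r) * (y1 * y1 + y2 * y2 + y3 * y3) -
          r * r * ((k2 * y3 - k3 * y2) * z1 + (k3 * y1 - k1 * y3) * z2 + (k1 * y2 - k2 * y1) * z3)"
        unfolding TT Lv by algebra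
      then show ?thesis unfolding kxy yy using zz by algebra
    qed
    have 14: "fr2 L T 1 4 = 0"
    proof -
      have "fr2 L T 1 4 = r * r * t * ((y1 * z1 + y2 * z2 + y3 * z3) +
          ((k2 * z3 - k3 * z2) * z1 + (k3 * z1 - k1 * z3) * z2 + (k1 * z2 - k2 * z1) * z3))"
        unfolding TT Lv by algebra
      then show ?thesis unfolding kxz using yz by simp
    qed
    have 23: "fr2 L T 2 3 = 1"
    proof -
      have "fr2 L T 2 3 = r * q * ((y1 * y1 + y2 * y2 + y3 * y3) -
          ((k2 * y3 - k3 * y2) * z1 + (k3 * y1 - k1 * y3) * z2 + (k1 * y2 - k2 * y1) * z3))"
        unfolding TT Lv by algebra
      then show ?thesis unfolding kxy yy rq using zz by algebra
    qed
    have 24: "fr2 L T 2 4 = 0"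
    proof -
      have "fr2 L T 2 4 = r * q * t * (- (y1 * z1 + y2 * z2 + y3 * z3) +
          ((k2 * z3 - k3 * z2) * z1 + (k3 * z1 - k1 * z3) * z2 + (k1 * z2 - k2 * z1) * z3))"
        unfolding TT Lv by algebra
      then show ?thesis unfolding kxz using yz by simp
    qed
    have 34: "fr2 L T 3 4 = 0" unfolding TT Lv by algebra
    have d: "fr2 L T i i = 0" for i unfolding TT by algebra
    have a: "fr2 L T j i = - fr2 L T i j" for i j unfolding TT by algebra
    show ?thesis unfolding forall_4
      using 12 13 14 23 24 34 d a[of 1 2] a[of 1 3] a[of 1 4] a[of 2 3] a[of 2 4] a[of 3 4] by simp
  qed
  have "det (frame_matrix L) = t"
    unfolding det_4 frame_matrix_def vec_lambda_beta Lv using kk rq unfolding k by algebra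
  then have "t * det (frame_matrix L) = 1" using t by simp
  then show ?thesis using M A by blast
qed

text \<open>The condition on \<open>A\<close> fixes the scale of l, and the last clause says that
  the volume element equals 1 on the frame, which fixes the orientation.\<close>

definition adapted :: "metric \<Rightarrow> real \<Rightarrow> real form2 \<Rightarrow> point \<Rightarrow> (4 \<Rightarrow> 4 \<Rightarrow> real) \<Rightarrow> bool" where
  "adapted g os A p e \<longleftrightarrow> invertible (frame_matrix e) \<and>
     (\<forall>i j. fr2 e (\<lambda>a b. g p $ a $ b) i j = null_metric i j) \<and> (\<forall>i j. fr2 e (A p) i j = null_form i j) \<and>
     os * sqrt \<bar>det (g p)\<bar> * det (frame_matrix e) = 1"

lemma fr1_compose: "fr1 (\<lambda>i a. \<Sum>m\<in>UNIV. L i m * e m a) w i = fr1 L (fr1 e w) i"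
  unfolding fr1_def sum_distrib_left sum_distrib_right by (rule trans[OF sum.swap]) (simp add: mult_ac)

lemma fr2_compose: "fr2 (\<lambda>i a. \<Sum>m\<in>UNIV. L i m * e m a) T i j = fr2 L (fr2 e T) i j"
proof -
  have 1: "fr2 (\<lambda>i a. \<Sum>m\<in>UNIV. L i m * e m a) T i j = fr1 L (\<lambda>m. fr1 e (\<lambda>a. fr1 L (fr1 e (T a)) j) m) i"
    unfolding fr2_def fr1_compose[abs_def] by (simp add: fr1_compose)
  have 2: "fr1 e (\<lambda>a. fr1 L (fr1 e (T a)) j) m = fr1 L (fr2 e T m) j" for m
    unfolding fr2_def[abs_def]
    by (simp add: fr1_def[of L] fr1_linear)
  show ?thesis unfolding 1 2 fr2_def[of L] ..
qed

lemma frame_matrix_compose: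
  "frame_matrix (\<lambda>i a. \<Sum>m\<in>UNIV. L i m * e m a) = frame_matrix e ** frame_matrix L"
  by (simp add: vec_eq_iff frame_matrix_def matrix_matrix_mult_def mult.commute)

lemma tr_g_uminus: "tr_g g p (\<lambda>a b. - T a b) = - tr_g g p T"
  by (simp add: tr_g_def sum_negf)

context metric_domain
begin

text \<open>The full contraction \<open>S\<^sub>a\<^sub>b T\<^sup>a\<^sup>b\<close>, as a nested
  trace so that the frame rules apply.\<close>

definition dot2 :: "point \<Rightarrow> (4 \<Rightarrow> 4 \<Rightarrow> real) \<Rightarrow> (4 \<Rightarrow> 4 \<Rightarrow> real) \<Rightarrow> real" where
  "dot2 p S T = tr_g g p (\<lambda>a c. tr_g g p (\<lambda>b d. S a b * T c d))"

text \<open>These are the real and imaginary parts of the nullity condition.\<close>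

lemma null_two_form_dot2:
  assumes "null_two_form_at g os A p"
  shows "dot2 p (A p) (A p) = dot2 p (hodge g os A p) (hodge g os A p)"
    and "dot2 p (A p) (hodge g os A p) + dot2 p (hodge g os A p) (A p) = 0"
proof -
  let ?B = "hodge g os A"
  have r: "raise2 g (self_dual g os A) p a b =
      (complex_of_real (raise2 g A p a b) - \<i> * complex_of_real (raise2 g ?B p a b)) / complex_of_real (sqrt 2)" for a b
    unfolding raise2_def self_dual_def scaleR_conv_of_real
    by (simp add: diff_divide_distrib right_diff_distrib sum_subtractf sum_distrib_left sum_divide_distrib mult_ac)
  have s2: "complex_of_real (sqrt 2) * complex_of_real (sqrt 2) = 2"
    by (metis of_real_mult of_real_numeral real_sqrt_mult_self abs_numeral)
  have "(\<Sum>a\<in>UNIV. \<Sum>b\<in>UNIV. self_dual g os A p a b * raise2 g (self_dual g os A) p a b) = 0"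
    using assms unfolding null_two_form_at_def by blast
  then have "(\<Sum>a\<in>UNIV. \<Sum>b\<in>UNIV. (complex_of_real (A p a b) - \<i> * complex_of_real (?B p a b)) *
      (complex_of_real (raise2 g A p a b) - \<i> * complex_of_real (raise2 g ?B p a b)) / 2) = 0"
    unfolding r unfolding self_dual_def by (simp add: s2)
  then have z: "(\<Sum>a\<in>UNIV. \<Sum>b\<in>UNIV. (complex_of_real (A p a b) - \<i> * complex_of_real (?B p a b)) *
      (complex_of_real (raise2 g A p a b) - \<i> * complex_of_real (raise2 g ?B p a b))) = 0"
    by (simp add: sum_divide_distrib[symmetric])
  have "(\<Sum>a\<in>UNIV. \<Sum>b\<in>UNIV. A p a b * raise2 g A p a b) - (\<Sum>a\<in>UNIV. \<Sum>b\<in>UNIV. ?B p a b * raise2 g ?B p a b) = 0"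
    using arg_cong[OF z, of Re] by (simp add: sum_subtractf)
  then show "dot2 p (A p) (A p) = dot2 p (?B p) (?B p)"
    unfolding sum_raise2 dot2_def by simp
  have "(\<Sum>a\<in>UNIV. \<Sum>b\<in>UNIV. A p a b * raise2 g ?B p a b) + (\<Sum>a\<in>UNIV. \<Sum>b\<in>UNIV. ?B p a b * raise2 g A p a b) = 0"
    using arg_cong[OF z, of Im] by (simp add: sum_subtractf sum_negf)
  then show "dot2 p (A p) (?B p) + dot2 p (?B p) (A p) = 0"
    unfolding sum_raise2 dot2_def by simp
qed

definition tr_frame :: "point \<Rightarrow> (4 \<Rightarrow> 4 \<Rightarrow> real) \<Rightarrow> (4 \<Rightarrow> 4 \<Rightarrow> real) \<Rightarrow> real" where
  "tr_frame p e X = (\<Sum>i\<in>UNIV. \<Sum>j\<in>UNIV. frame_inv_metric g p e i j * X i j)"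

lemma tr_g_frame:
  assumes "p \<in> M" "invertible (frame_matrix e)"
  shows "tr_g g p T = tr_frame p e (fr2 e T)"
  unfolding tr_g_def tr_frame_def using contraction_frame[OF assms] .

text \<open>Taking the traces one after the other contracts the slots in the order \<open>b\<close>,
  \<open>d\<close>, \<open>a\<close>, \<open>c\<close>; exchanging contractions restores the order
  in which \<open>fr2\<close> and \<open>fr4\<close> read a tensor.\<close>

lemma tr_g_tr_g:
  assumes p: "p \<in> M" and e: "invertible (frame_matrix e)"
  shows "tr_g g p (\<lambda>a c. tr_g g p (\<lambda>b d. T a b c d)) =
    tr_frame p e (\<lambda>i k. tr_frame p e (\<lambda>j m. fr1 e (\<lambda>a. fr1 e (\<lambda>b. fr1 e (\<lambda>c. fr1 e (\<lambda>d. T a b c d) m) k) j) i))"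
proof -
  have "tr_g g p (\<lambda>a c. tr_g g p (\<lambda>b d. T a b c d)) =
      tr_frame p e (\<lambda>i k. tr_g g p (\<lambda>b d. fr1 e (\<lambda>a. fr1 e (\<lambda>c. T a b c d) k) i))"
    unfolding tr_g_frame[OF p e, of "\<lambda>a c. tr_g g p (\<lambda>b d. T a b c d)"] fr2_def fr1_tr_g ..
  also have "\<dots> = tr_frame p e (\<lambda>i k. tr_frame p e (\<lambda>j m. fr1 e (\<lambda>b. fr1 e (\<lambda>d. fr1 e (\<lambda>a. fr1 e (\<lambda>c. T a b c d) k) i) m) j))"
    unfolding tr_g_frame[OF p e, of "\<lambda>b d. _ b d"] fr2_def ..
  also have "(\<lambda>i k. tr_frame p e (\<lambda>j m. fr1 e (\<lambda>b. fr1 e (\<lambda>d. fr1 e (\<lambda>a. fr1 e (\<lambda>c. T a b c d) k) i) m) j)) =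
      (\<lambda>i k. tr_frame p e (\<lambda>j m. fr1 e (\<lambda>a. fr1 e (\<lambda>b. fr1 e (\<lambda>c. fr1 e (\<lambda>d. T a b c d) m) k) j) i))"
  proof -
    have "fr1 e (\<lambda>d. fr1 e (\<lambda>a. fr1 e (\<lambda>c. T a b c d) k) i) m = fr1 e (\<lambda>a. fr1 e (\<lambda>d. fr1 e (\<lambda>c. T a b c d) k) m) i" for b i k m
      by (rule fr1_swap)
    moreover have "fr1 e (\<lambda>d. fr1 e (\<lambda>c. T a b c d) k) m = fr1 e (\<lambda>c. fr1 e (\<lambda>d. T a b c d) m) k" for a b k m
      by (rule fr1_swap)
    ultimately have "fr1 e (\<lambda>b. fr1 e (\<lambda>d. fr1 e (\<lambda>a. fr1 e (\<lambda>c. T a b c d) k) i) m) j =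
      fr1 e (\<lambda>b. fr1 e (\<lambda>a. fr1 e (\<lambda>c. fr1 e (\<lambda>d. T a b c d) m) k) i) j" for i j k m
      by simp
    moreover have "fr1 e (\<lambda>b. fr1 e (\<lambda>a. fr1 e (\<lambda>c. fr1 e (\<lambda>d. T a b c d) m) k) i) j =
      fr1 e (\<lambda>a. fr1 e (\<lambda>b. fr1 e (\<lambda>c. fr1 e (\<lambda>d. T a b c d) m) k) j) i" for i j k m
      by (rule fr1_swap)
    ultimately show ?thesis by (simp only:)
  qed
  finally show ?thesis .
qed

lemma dot2_tr_frame:
  assumes "p \<in> M" "invertible (frame_matrix e)"
  shows "dot2 p S T = tr_frame p e (\<lambda>i k. tr_frame p e (\<lambda>j m. fr2 e S i j * fr2 e T k m))"
proof -
  have "fr1 e (\<lambda>c. fr1 e (\<lambda>d. S a b * T c d) m) k = S a b * fr2 e T k m" for a b k m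
    by (simp add: fr2_def fr1_linear)
  then show ?thesis
    unfolding dot2_def tr_g_tr_g[OF assms] by (simp add: fr1_linear fr2_def)
qed

lemma fr2_hodge:
  assumes "p \<in> M" "invertible (frame_matrix e)"
  shows "fr2 e (hodge g os T p) i j = tr_frame p e (\<lambda>k m. tr_frame p e (\<lambda>l n.
    os * sqrt \<bar>det (g p)\<bar> * det (frame_matrix e) * eps4 i j k l * fr2 e (T p) m n)) / 2"
proof -
  have "fr1 e (\<lambda>c. fr1 e (\<lambda>d. fr1 e (\<lambda>e'. fr1 e (\<lambda>f. volume_element g os p a b c d * T p e' f) n) m) l) k =
      fr2 e (volume_element g os p a b) k l * fr2 e (T p) m n" for a b k l m n
    by (simp add: fr2_def fr1_linear)
  then have h: "hodge g os T p a b = tr_frame p e (\<lambda>k m. tr_frame p e (\<lambda>l n.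
      fr2 e (volume_element g os p a b) k l * fr2 e (T p) m n)) / 2" for a b
    unfolding hodge_tr_g tr_g_tr_g[OF assms] by simp
  have "fr2 e (hodge g os T p) i j = tr_frame p e (\<lambda>k m. tr_frame p e (\<lambda>l n.
      fr4 e (volume_element g os p) i j k l * fr2 e (T p) m n)) / 2"
    unfolding fr2_def[of e "hodge g os T p"] h fr4_def fr3_def tr_frame_def by (simp add: fr1_linear)
  then show ?thesis unfolding fr4_volume_element .
qed

text \<open>In an orthonormal frame nullity says that the electric and magnetic parts of
  \<open>A\<close> are orthogonal and of equal length; \<open>null_frame_algebra\<close> then
  provides the change of frame \<open>L\<close>.\<close>

lemma exists_adapted:
  assumes p: "p \<in> M" and os: "os * os = 1" and anti: "\<And>a b. A p b a = - A p a b"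
    and null: "null_two_form_at g os A p"
  shows "\<exists>e. adapted g os A p e"
proof -
  obtain P :: "real ^ 4 ^ 4" where P: "invertible P" "transpose P ** g p ** P = minkowski"
    using lorentzian_g[OF p] unfolding lorentzian_def by blast
  define e0 where "e0 = (\<lambda>i a. P $ a $ i)"
  have F: "frame_matrix e0 = P" by (simp add: frame_matrix_def e0_def vec_eq_iff)
  have inv: "invertible (frame_matrix e0)" using P F by simp
  have met: "(\<chi> i j. fr2 e0 (\<lambda>a b. g p $ a $ b) i j) = minkowski"
    unfolding frame_metric_matrix F by (rule P(2))
  then have met': "fr2 e0 (\<lambda>a b. g p $ a $ b) = (\<lambda>i j. minkowski $ i $ j)"
    by (auto simp: vec_eq_iff fun_eq_iff)
  have "minkowski ** minkowski = mat 1"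
    by (simp add: vec_eq_iff matrix_matrix_mult_def minkowski_def mat_def forall_4 sum_4)
  then have "matrix_inv minkowski = minkowski" by (intro matrix_inv_unique)
  then have fc: "tr_frame p e0 X = - X 1 1 + X 2 2 + X 3 3 + X 4 4" for X
    unfolding tr_frame_def frame_inv_metric_def met by (simp add: minkowski_def sum_4)
  \<comment> \<open>The volume of the orthonormal frame, which is 1 or -1; \<open>L\<close> is
    chosen to compensate the sign.\<close>
  define t where "t = os * sqrt \<bar>det (g p)\<bar> * det (frame_matrix e0)"
  have t: "t * t = 1"
  proof -
    have "det (transpose P ** g p ** P) = -1" unfolding P(2) by (simp add: det_4 minkowski_def)
    then have d: "det (g p) * (det P * det P) = -1" by (simp add: det_mul det_transpose mult_ac)
    have "t * t = (os * os) * (sqrt \<bar>det (g p)\<bar> * sqrt \<bar>det (g p)\<bar>) * (det P * det P)"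
      unfolding t_def F by (simp add: mult_ac)
    also have "sqrt \<bar>det (g p)\<bar> * sqrt \<bar>det (g p)\<bar> = - det (g p)"
      using det_g_neg[OF p] by simp
    finally show ?thesis using d os by simp
  qed
  define T where "T = fr2 e0 (A p)"
  define S where "S = fr2 e0 (hodge g os A p)"
  have Ta: "T j i = - T i j" for i j
  proof -
    have "(\<lambda>a b. A p b a) = (\<lambda>a b. - A p a b)" by (intro ext) (rule anti)
    then show ?thesis
      using fr2_transpose[of e0 "A p" i j] unfolding T_def by (simp add: fr2_def fr1_linear)
  qed
  have Tn: "T i i = 0" "T 2 1 = - T 1 2" "T 3 1 = - T 1 3" "T 4 1 = - T 1 4" "T 3 2 = - T 2 3" "T 4 2 = - T 2 4" "T 4 3 = - T 3 4" for i
    using Ta[of i i] by (auto intro: Ta)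
  have Seq: "S i j = tr_frame p e0 (\<lambda>k m. tr_frame p e0 (\<lambda>l n. t * eps4 i j k l * T m n)) / 2" for i j
    unfolding S_def T_def t_def using fr2_hodge[OF p inv] .
  have S: "S i i = 0" "S 1 2 = t * T 3 4" "S 3 4 = - t * T 1 2" "S 1 3 = - t * T 2 4" "S 1 4 = t * T 2 3" "S 2 3 = - t * T 1 4" "S 2 4 = t * T 1 3"
    "S 2 1 = - t * T 3 4" "S 4 3 = t * T 1 2" "S 3 1 = t * T 2 4" "S 4 1 = - t * T 2 3" "S 3 2 = t * T 1 4" "S 4 2 = - t * T 1 3" for i
    unfolding Seq fc by (simp_all add: eps4_simps Tn)
  have d: "dot2 p X Y = tr_frame p e0 (\<lambda>i k. tr_frame p e0 (\<lambda>j m. fr2 e0 X i j * fr2 e0 Y k m))" for X Y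
    by (rule dot2_tr_frame[OF p inv])
  have "tr_frame p e0 (\<lambda>i k. tr_frame p e0 (\<lambda>j m. T i j * T k m)) = tr_frame p e0 (\<lambda>i k. tr_frame p e0 (\<lambda>j m. S i j * S k m))"
    using null_two_form_dot2(1)[OF null] unfolding d T_def[symmetric] S_def[symmetric] .
  then have n1: "T 1 2 * T 1 2 + T 1 3 * T 1 3 + T 1 4 * T 1 4 = T 3 4 * T 3 4 + T 2 4 * T 2 4 + T 2 3 * T 2 3"
    unfolding fc S Tn using t by (simp add: algebra_simps) algebra
  have "tr_frame p e0 (\<lambda>i k. tr_frame p e0 (\<lambda>j m. T i j * S k m)) + tr_frame p e0 (\<lambda>i k. tr_frame p e0 (\<lambda>j m. S i j * T k m)) = 0"
    using null_two_form_dot2(2)[OF null] unfolding d T_def[symmetric] S_def[symmetric] .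
  then have n2: "T 1 2 * T 3 4 - T 1 3 * T 2 4 + T 1 4 * T 2 3 = 0"
    unfolding fc S Tn using t by (simp add: algebra_simps) algebra
  have nz: "\<exists>i j. T i j \<noteq> 0"
  proof (rule ccontr)
    assume "\<not> ?thesis"
    then have "fr2 e0 (A p) i j = fr2 e0 (\<lambda>a b. 0) i j" for i j unfolding T_def by (simp add: fr2_def)
    then have "A p a b = 0" for a b by (rule fr2_inject[OF inv])
    then show False using null unfolding null_two_form_at_def by blast
  qed
  obtain L where L: "\<And>i j. fr2 L (\<lambda>i j. minkowski $ i $ j) i j = null_metric i j" "\<And>i j. fr2 L T i j = null_form i j"
    "t * det (frame_matrix L) = 1"
    using null_frame_algebra[OF Ta n1 n2 nz t] by blast
  define e where "e = (\<lambda>i a. \<Sum>m\<in>UNIV. L i m * e0 m a)"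
  have 1: "fr2 e X i j = fr2 L (fr2 e0 X) i j" for X i j unfolding e_def by (rule fr2_compose)
  have 2: "frame_matrix e = frame_matrix e0 ** frame_matrix L" unfolding e_def by (rule frame_matrix_compose)
  have 3: "os * sqrt \<bar>det (g p)\<bar> * det (frame_matrix e) = 1"
    using L(3) unfolding 2 det_mul t_def by (simp add: mult_ac)
  then have "invertible (frame_matrix e)" by (auto simp: invertible_det_nz)
  moreover have "fr2 e (\<lambda>a b. g p $ a $ b) i j = null_metric i j" for i j unfolding 1 met' by (rule L(1))
  moreover have "fr2 e (A p) i j = null_form i j" for i j unfolding 1 T_def[symmetric] by (rule L(2))
  ultimately show ?thesis using 3 unfolding adapted_def by blast
qed

lemma tr_frame_adapted:
  assumes "adapted g os A p e"
  shows "tr_frame p e X = tr_null X" and "frame_inv_metric g p e i j = null_metric i j"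
proof -
  have met: "(\<chi> i j. fr2 e (\<lambda>a b. g p $ a $ b) i j) = (\<chi> i j. null_metric i j)"
    using assms unfolding adapted_def by simp
  have "(\<chi> i j. null_metric i j) ** (\<chi> i j. null_metric i j) = mat 1"
    by (simp add: vec_eq_iff matrix_matrix_mult_def mat_def forall_4 sum_4)
  then have "matrix_inv (\<chi> i j. null_metric i j) = (\<chi> i j. null_metric i j)" by (intro matrix_inv_unique)
  then show *: "frame_inv_metric g p e i j = null_metric i j" for i j
    unfolding frame_inv_metric_def met by simp
  show "tr_frame p e X = tr_null X" unfolding tr_frame_def * tr_null_def sum_4 by simp
qed

end

subsection \<open>Null conformal Killing-Yano tensors\<close>

lemma fr4_rotate: "fr3 e (\<lambda>a b c. fr1 e (\<lambda>m. T m a b c) h) i j k = fr4 e T h i j k"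
proof -
  have "fr1 e (\<lambda>c. fr1 e (\<lambda>m. T m a b c) h) k = fr1 e (\<lambda>m. fr1 e (\<lambda>c. T m a b c) k) h" for a b
    by (rule fr1_swap)
  moreover have "fr1 e (\<lambda>b. fr1 e (\<lambda>m. fr1 e (\<lambda>c. T m a b c) k) h) j = fr1 e (\<lambda>m. fr1 e (\<lambda>b. fr1 e (\<lambda>c. T m a b c) k) j) h" for a
    by (rule fr1_swap)
  moreover have "fr1 e (\<lambda>a. fr1 e (\<lambda>m. fr1 e (\<lambda>b. fr1 e (\<lambda>c. T m a b c) k) j) h) i = fr1 e (\<lambda>m. fr1 e (\<lambda>a. fr1 e (\<lambda>b. fr1 e (\<lambda>c. T m a b c) k) j) i) h"
    by (rule fr1_swap)
  ultimately show ?thesis unfolding fr4_def fr3_def fr2_def by simp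
qed

lemma fr4_pair: "fr4 e (\<lambda>a b c d. T c d a b) i j k l = fr4 e T k l i j"
proof -
  have sum: "fr4 e T i j k l = (\<Sum>a\<in>UNIV. \<Sum>b\<in>UNIV. \<Sum>c\<in>UNIV. \<Sum>d\<in>UNIV. e i a * (e j b * (e k c * (e l d * T a b c d))))" for T i j k l
    by (simp add: fr4_def fr3_def fr2_def fr1_def sum_distrib_left)
  show ?thesis unfolding sum by (rule trans[OF sum_swap4]) (simp add: mult_ac)
qed

lemma fr4_swap_left: "fr4 e (\<lambda>a b c d. T b a c d) i j k l = fr4 e T j i k l"
  unfolding fr4_def fr3_def by (rule fr1_swap)

lemma fr4_swap_right: "fr4 e (\<lambda>a b c d. T a b d c) i j k l = fr4 e T i j l k"
proof -
  have "fr2 e (\<lambda>c d. T a b d c) k l = fr2 e (T a b) l k" for a b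
    unfolding fr2_def by (rule fr1_swap)
  then show ?thesis unfolding fr4_def fr3_def by simp
qed

lemma fr4_cycle: "fr4 e (\<lambda>a b c d. T a c d b) i j k l = fr4 e T i k l j"
proof -
  have "fr1 e (\<lambda>c. fr1 e (\<lambda>d. T a c d b) l) k = fr2 e (\<lambda>c d. T a c d b) k l" for a b
    by (simp add: fr2_def)
  have 1: "fr1 e (\<lambda>b. fr1 e (\<lambda>c. fr1 e (\<lambda>d. T a c d b) l) k) j = fr1 e (\<lambda>c. fr1 e (\<lambda>b. fr1 e (\<lambda>d. T a c d b) l) j) k" for a
    by (rule fr1_swap)
  have 2: "fr1 e (\<lambda>b. fr1 e (\<lambda>d. T a c d b) l) j = fr1 e (\<lambda>d. fr1 e (T a c d) j) l" for a c
    by (rule fr1_swap)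
  show ?thesis unfolding fr4_def fr3_def fr2_def 1 2 ..
qed

lemma fr4_minus: "fr4 e (\<lambda>a b c d. - T a b c d) i j k l = - fr4 e T i j k l"
  by (simp add: fr4_def fr3_def fr2_def fr1_linear)

lemma fr4_add: "fr4 e (\<lambda>a b c d. S a b c d + T a b c d) i j k l = fr4 e S i j k l + fr4 e T i j k l"
  by (simp add: fr4_def fr3_def fr2_def fr1_linear)

lemma fr4_diff: "fr4 e (\<lambda>a b c d. S a b c d - T a b c d) i j k l = fr4 e S i j k l - fr4 e T i j k l"
  by (simp add: fr4_def fr3_def fr2_def fr1_linear)

lemma fr4_mult_left: "fr4 e (\<lambda>a b c d. h * T a b c d) i j k l = h * fr4 e T i j k l"
  by (simp add: fr4_def fr3_def fr2_def fr1_linear)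

context metric_domain
begin

lemma frame_riemann:
  fixes e :: "4 \<Rightarrow> 4 \<Rightarrow> real"
  assumes p: "p \<in> M"
  defines "r \<equiv> fr4 e (riemann g p)"
  shows "r i j k l = - r j i k l" "r i j k l = - r i j l k" "r i j k l = r k l i j"
    "r i j k l + r i k l j + r i l j k = 0"
proof -
  have "riemann g p = (\<lambda>a b c d. - riemann g p b a c d)" by (intro ext) (rule riemann_antisym_left[OF p])
  then have "r i j k l = fr4 e (\<lambda>a b c d. - riemann g p b a c d) i j k l" unfolding r_def by (rule arg_cong)
  then show "r i j k l = - r j i k l"
    using fr4_minus[of e "\<lambda>a b c d. riemann g p b a c d" i j k l] fr4_swap_left[of e "riemann g p" i j k l]
    unfolding r_def by linarith
  have "riemann g p = (\<lambda>a b c d. - riemann g p a b d c)" by (intro ext) (rule riemann_antisym_right)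
  then have "r i j k l = fr4 e (\<lambda>a b c d. - riemann g p a b d c) i j k l" unfolding r_def by (rule arg_cong)
  then show "r i j k l = - r i j l k"
    using fr4_minus[of e "\<lambda>a b c d. riemann g p a b d c" i j k l] fr4_swap_right[of e "riemann g p" i j k l]
    unfolding r_def by linarith
  have "riemann g p = (\<lambda>a b c d. riemann g p c d a b)" by (intro ext) (rule riemann_pair[OF p])
  then have "r i j k l = fr4 e (\<lambda>a b c d. riemann g p c d a b) i j k l" unfolding r_def by (rule arg_cong)
  then show "r i j k l = r k l i j"
    using fr4_pair[of e "riemann g p" i j k l] unfolding r_def by linarith
  have "(\<lambda>a b c d. riemann g p a b c d + riemann g p a c d b + riemann g p a d b c) = (\<lambda>a b c d. 0)"
    by (intro ext) (rule riemann_cyclic[OF p])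
  then have "fr4 e (\<lambda>a b c d. riemann g p a b c d + riemann g p a c d b + riemann g p a d b c) i j k l = fr4 e (\<lambda>a b c d. 0) i j k l"
    by (rule arg_cong)
  moreover have "fr4 e (\<lambda>a b c d. riemann g p a d b c) i j k l = r i l j k"
    unfolding r_def
    using fr4_cycle[of e "\<lambda>a b c d. riemann g p a c d b" i j k l] fr4_cycle[of e "riemann g p" i k l j] by linarith
  moreover have "fr4 e (\<lambda>a b c d. 0) i j k l = 0" by (simp add: fr4_def fr3_def fr2_def)
  ultimately show "r i j k l + r i k l j + r i l j k = 0"
    unfolding fr4_add using fr4_cycle[of e "riemann g p" i j k l] unfolding r_def by linarith
qed

lemma tr_g_product_tr_frame:
  assumes "p \<in> M" "invertible (frame_matrix e)"
  shows "tr_g g p (\<lambda>a b. w a * v b) = tr_frame p e (\<lambda>i j. fr1 e w i * fr1 e v j)"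
  unfolding tr_g_frame[OF assms] fr2_product ..

lemma fr1_interior_tr_frame:
  assumes "p \<in> M" "invertible (frame_matrix e)"
  shows "fr1 e (\<lambda>c. tr_g g p (\<lambda>a b. w a * T b c)) k = tr_frame p e (\<lambda>i j. fr1 e w i * fr2 e T j k)"
proof -
  have "fr1 e (\<lambda>c. fr1 e (\<lambda>b. T b c) j) k = fr2 e T j k" for j
    unfolding fr2_def by (rule fr1_swap)
  then show ?thesis unfolding tr_g_product_tr_frame[OF assms] by (simp add: tr_frame_def fr1_linear)
qed

lemma fr3_volume_tr_frame:
  assumes "p \<in> M" "invertible (frame_matrix e)"
  shows "fr3 e (\<lambda>a b c. tr_g g p (\<lambda>m n. T m a b c * w n)) k i j = tr_frame p e (\<lambda>m n. fr4 e T m k i j * fr1 e w n)"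
  unfolding tr_g_product_tr_frame[OF assms] fr4_rotate[symmetric]
  by (simp add: fr3_def fr2_def tr_frame_def fr1_linear mult_ac)

lemma fr4_curvature1:
  assumes p: "p \<in> M" and e: "invertible (frame_matrix e)"
  shows "fr4 e (\<lambda>a b c d. \<Sum>h\<in>UNIV. riemann_up g p h c a b * T h d) l k i j =
    tr_frame p e (\<lambda>h f. fr4 e (riemann g p) f i l k * fr2 e T h j)"
proof -
  have 1: "(\<Sum>h\<in>UNIV. riemann_up g p h c a b * T h d) = tr_frame p e (\<lambda>h f. fr1 e (\<lambda>h. T h d) h * fr1 e (\<lambda>f. riemann g p a b f c) f)" for a b c d
  proof -
    have "(\<Sum>h\<in>UNIV. riemann_up g p h c a b * T h d) = tr_g g p (\<lambda>h f. T h d * riemann g p a b f c)"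
      unfolding tr_g_def riemann_up_eq[OF p] sum_distrib_right
      by (simp add: riemann_pair[OF p, of _ c] mult_ac)
    then show ?thesis unfolding tr_g_product_tr_frame[OF p e] .
  qed
  have 2: "fr1 e (\<lambda>d. fr1 e (\<lambda>h. T h d) h) j = fr2 e T h j" for h
    unfolding fr2_def by (rule fr1_swap)
  have 3: "fr1 e (\<lambda>c. fr1 e (\<lambda>f. riemann g p a b f c) f) i = fr2 e (riemann g p a b) f i" for f a b
    unfolding fr2_def by (rule fr1_swap)
  have 4: "fr4 e (riemann g p) f i l k = fr4 e (riemann g p) l k f i" for f
    by (rule frame_riemann(3)[OF p])
  have 5: "fr2 e (\<lambda>c d. tr_frame p e (\<lambda>h f. fr1 e (\<lambda>h. T h d) h * fr1 e (\<lambda>f. riemann g p a b f c) f)) i j =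
      tr_frame p e (\<lambda>h f. fr2 e (riemann g p a b) f i * fr2 e T h j)" for a b
    by (subst fr2_def) (simp only: tr_frame_def fr1_linear 2 3 mult.commute[of "fr2 e T _ _"])
  show ?thesis
    unfolding 1 4 unfolding fr4_def fr3_def 5 unfolding tr_frame_def fr1_linear ..
qed

lemma fr4_curvature2:
  assumes p: "p \<in> M" and e: "invertible (frame_matrix e)"
  shows "fr4 e (\<lambda>a b c d. \<Sum>h\<in>UNIV. riemann_up g p h d a b * T c h) l k i j =
    tr_frame p e (\<lambda>h f. fr4 e (riemann g p) f j l k * fr2 e T i h)"
  using fr4_curvature1[OF p e, of "\<lambda>h c. T c h" l k j i]
    fr4_swap_right[of e "\<lambda>a b c d. \<Sum>h\<in>UNIV. riemann_up g p h c a b * T d h" l k i j]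
  unfolding fr2_transpose[of e T] by simp

lemma fr3_curvature:
  assumes p: "p \<in> M" and e: "invertible (frame_matrix e)"
  shows "fr3 e (\<lambda>a b c. \<Sum>h\<in>UNIV. riemann_up g p h a b c * w h) l i j =
    tr_frame p e (\<lambda>n m. fr4 e (riemann g p) n l i j * fr1 e w m)"
proof -
  have "(\<Sum>h\<in>UNIV. riemann_up g p h a b c * w h) = tr_g g p (\<lambda>f h. riemann g p f a b c * w h)" for a b c
    unfolding tr_g_def riemann_up_eq[OF p] sum_distrib_right
    by (rule trans[OF sum.swap]) (simp add: ginv_sym[OF p] mult_ac)
  then show ?thesis unfolding fr3_volume_tr_frame[OF p e, symmetric] by simp
qed

lemma fr2_ricci:
  assumes p: "p \<in> M" and e: "invertible (frame_matrix e)"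
  shows "fr2 e (ricci g p) i j = tr_frame p e (\<lambda>k m. fr4 e (riemann g p) m i k j)"
proof -
  have R: "ricci g p a b = tr_frame p e (\<lambda>k m. fr1 e (\<lambda>c. fr1 e (\<lambda>d. riemann g p a d b c) m) k)" for a b
  proof -
    have "riemann g p d a c b = riemann g p a d b c" for c d
      using riemann_antisym_left[OF p, of d a c b] riemann_antisym_right[of p a d c b] by simp
    then show ?thesis unfolding ricci_tr_g[OF p] tr_g_frame[OF p e] fr2_def by simp
  qed
  have "fr1 e (\<lambda>c. fr1 e (\<lambda>d. riemann g p a d b c) m) k = fr1 e (\<lambda>d. fr1 e (riemann g p a d b) k) m" for a b k m
    by (rule fr1_swap)
  moreover have "fr1 e (\<lambda>b. fr1 e (\<lambda>d. fr1 e (riemann g p a d b) k) m) j = fr1 e (\<lambda>d. fr1 e (\<lambda>b. fr1 e (riemann g p a d b) k) j) m" for a k m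
    by (rule fr1_swap)
  ultimately have "fr2 e (ricci g p) i j = tr_frame p e (\<lambda>k m. fr4 e (riemann g p) i m j k)"
    unfolding fr2_def[of e "ricci g p"] R[abs_def] tr_frame_def fr1_linear fr4_def fr3_def fr2_def by simp
  also have "(\<lambda>k m. fr4 e (riemann g p) i m j k) = (\<lambda>k m. fr4 e (riemann g p) m i k j)"
    using frame_riemann(1)[OF p, of e] frame_riemann(2)[OF p, of e] by (intro ext) (metis minus_minus)
  finally show ?thesis .
qed

end

section \<open>The standing hypotheses and frame fields adapted at a point\<close>

locale null_cky = metric_domain +
  fixes os :: real and A :: "real form2"
  assumes os: "os * os = 1" and cky: "cky_tensor_on M g os A"
    and null: "\<And>p. p \<in> M \<Longrightarrow> null_two_form_at g os A p"
    and killing1: "killing_vector_on M g (raise g (codiff g A))"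
    and killing2: "killing_vector_on M g (raise g (codiff g (hodge g os A)))"
    and independent: "\<And>p. p \<in> M \<Longrightarrow> \<exists>a b. wedge (codiff g A p) (codiff g (hodge g os A) p) a b \<noteq> 0"
begin

abbreviation "B \<equiv> hodge g os A"
abbreviation "Z1 \<equiv> codiff g A"
abbreviation "Z2 \<equiv> codiff g B"
abbreviation "F1 \<equiv> nabla1 g Z1"
abbreviation "F2 \<equiv> nabla1 g Z2"

lemma A_anti: "p \<in> M \<Longrightarrow> A p b a = - A p a b"
  using cky unfolding cky_tensor_on_def smooth_two_form_on_def by blast

lemma smooth_A [simp]: "smooth_on M (\<lambda>x. A x a b)"
  using cky unfolding cky_tensor_on_def smooth_two_form_on_def by blast

lemma smooth_B [simp]: "smooth_on M (\<lambda>x. B x a b)" by (rule smooth_hodge) simp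
lemma smooth_Z1 [simp]: "smooth_on M (\<lambda>x. Z1 x a)" by (rule smooth_codiff) simp
lemma smooth_Z2 [simp]: "smooth_on M (\<lambda>x. Z2 x a)" by (rule smooth_codiff) simp
lemma smooth_F1 [simp]: "smooth_on M (\<lambda>x. F1 x a b)" by (rule smooth_nabla1) simp
lemma smooth_F2 [simp]: "smooth_on M (\<lambda>x. F2 x a b)" by (rule smooth_nabla1) simp

lemma F1_anti: "p \<in> M \<Longrightarrow> F1 p a b = - F1 p b a" by (rule killing_nabla1[OF killing1]) simp_all
lemma F2_anti: "p \<in> M \<Longrightarrow> F2 p a b = - F2 p b a" by (rule killing_nabla1[OF killing2]) simp_all

end

text \<open>\<open>E\<close> is adapted at \<open>p\<close> only; elsewhere on \<open>U\<close> it
  is just a frame, with a varying Gram matrix.\<close>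

locale null_cky_frame = null_cky M g os A + parallel_frame M g p E U os
  for M g os A p E U +
  assumes adapted: "adapted g os A p (E p)"

lemma (in null_cky) exists_frame:
  assumes "p \<in> M"
  shows "\<exists>E U. null_cky_frame M g os A p E U"
proof -
  obtain e where e: "adapted g os A p e"
    using exists_adapted[of p os A, OF assms os A_anti[OF assms] null[OF assms]] by blast
  then have "invertible (frame_matrix e)" unfolding adapted_def by blast
  then obtain E U where "parallel_frame M g p E U os" "E p = e"
    using exists_parallel_frame[OF assms _ os] by blast
  then have "null_cky_frame M g os A p E U"
    using e null_cky_axioms by (simp add: null_cky_frame_def null_cky_frame_axioms_def)
  then show ?thesis by blast
qed

section \<open>Differentiating contractions and the Hodge dual at \<open>p\<close>\<close>

context parallel_frame
begin

lemma fcon_H: "tr_frame x (E x) X = (\<Sum>i\<in>UNIV. \<Sum>j\<in>UNIV. H x i j * X i j)"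
  by (simp add: tr_frame_def H_def)

lemma smooth_tr_frame:
  assumes "\<And>i j. smooth_on U (\<lambda>x. X x i j)"
  shows "smooth_on U (\<lambda>x. tr_frame x (E x) (X x))"
  unfolding fcon_H using assms stationary_H
  by (intro smooth_on_sum smooth_on_mult open_U) (auto simp: stationary_def)

text \<open>The inverse Gram matrix is stationary, so the derivative passes through the
  trace.\<close>

lemma dE_tr_frame:
  assumes X: "\<And>i j. smooth_on U (\<lambda>x. X x i j)"
  shows "dE l (\<lambda>x. tr_frame x (E x) (X x)) = tr_frame p (E p) (\<lambda>i j. dE l (\<lambda>x. X x i j))"
proof -
  have "smooth_on U (\<lambda>x. H x i j)" "dE l (\<lambda>x. H x i j) = 0" for i j
    using stationary_H unfolding stationary_def by auto
  then show ?thesis unfolding fcon_H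
    by (simp add: dE_sum dE_mult X smooth_on_mult smooth_on_sum open_U)
qed

lemma U_M: "x \<in> U \<Longrightarrow> x \<in> M" using U_sub by blast

lemma dE_tr_g_product:
  assumes w: "\<And>a. smooth_on M (\<lambda>x. w x a)" and v: "\<And>a. smooth_on M (\<lambda>x. v x a)"
  shows "dE l (\<lambda>x. tr_g g x (\<lambda>a b. w x a * v x b)) = tr_frame p (E p) (\<lambda>i j.
    fr1 (E p) (w p) i * fr2 (E p) (nabla1 g v p) l j + fr2 (E p) (nabla1 g w p) l i * fr1 (E p) (v p) j)"
proof -
  note w' = smooth_U[OF w] and v' = smooth_U[OF v]
  have "dE l (\<lambda>x. tr_g g x (\<lambda>a b. w x a * v x b)) =
      dE l (\<lambda>x. tr_frame x (E x) (\<lambda>i j. fr1 (E x) (w x) i * fr1 (E x) (v x) j))"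
    by (intro dE_cong tr_g_product_tr_frame U_M invertible_E)
  also have "\<dots> = tr_frame p (E p) (\<lambda>i j. dE l (\<lambda>x. fr1 (E x) (w x) i * fr1 (E x) (v x) j))"
    by (intro dE_tr_frame smooth_on_mult smooth_fr1 w' v' open_U)
  finally show ?thesis by (simp add: dE_mult smooth_fr1 w' v' dE_fr1)
qed

lemma dE_interior:
  assumes w: "\<And>a. smooth_on M (\<lambda>x. w x a)" and T: "\<And>a b. smooth_on M (\<lambda>x. T x a b)"
  shows "dE l (\<lambda>x. fr1 (E x) (\<lambda>c. tr_g g x (\<lambda>a b. w x a * T x b c)) k) = tr_frame p (E p) (\<lambda>i j.
    fr1 (E p) (w p) i * fr3 (E p) (nabla2 g T p) l j k + fr2 (E p) (nabla1 g w p) l i * fr2 (E p) (T p) j k)"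
proof -
  note w' = smooth_U[OF w] and T' = smooth_U[OF T]
  have "dE l (\<lambda>x. fr1 (E x) (\<lambda>c. tr_g g x (\<lambda>a b. w x a * T x b c)) k) =
      dE l (\<lambda>x. tr_frame x (E x) (\<lambda>i j. fr1 (E x) (w x) i * fr2 (E x) (T x) j k))"
    by (intro dE_cong fr1_interior_tr_frame U_M invertible_E)
  also have "\<dots> = tr_frame p (E p) (\<lambda>i j. dE l (\<lambda>x. fr1 (E x) (w x) i * fr2 (E x) (T x) j k))"
    by (intro dE_tr_frame smooth_on_mult smooth_fr1 smooth_fr2 w' T' open_U)
  finally show ?thesis by (simp add: dE_mult smooth_fr1 smooth_fr2 w' T' dE_fr1 dE_fr2)
qed

lemma dE_dot2:
  assumes S: "\<And>a b. smooth_on M (\<lambda>x. S x a b)" and T: "\<And>a b. smooth_on M (\<lambda>x. T x a b)"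
  shows "dE l (\<lambda>x. dot2 x (S x) (T x)) = tr_frame p (E p) (\<lambda>i k. tr_frame p (E p) (\<lambda>j m.
    fr2 (E p) (S p) i j * fr3 (E p) (nabla2 g T p) l k m + fr3 (E p) (nabla2 g S p) l i j * fr2 (E p) (T p) k m))"
proof -
  note S' = smooth_U[OF S] and T' = smooth_U[OF T]
  have "dE l (\<lambda>x. dot2 x (S x) (T x)) =
      dE l (\<lambda>x. tr_frame x (E x) (\<lambda>i k. tr_frame x (E x) (\<lambda>j m. fr2 (E x) (S x) i j * fr2 (E x) (T x) k m)))"
    by (intro dE_cong dot2_tr_frame U_M invertible_E)
  also have "\<dots> = tr_frame p (E p) (\<lambda>i k. tr_frame p (E p) (\<lambda>j m. dE l (\<lambda>x. fr2 (E x) (S x) i j * fr2 (E x) (T x) k m)))"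
    by (subst dE_tr_frame, intro smooth_tr_frame smooth_on_mult smooth_fr2 S' T' open_U, subst dE_tr_frame,
        intro smooth_on_mult smooth_fr2 S' T' open_U, rule refl)
  finally show ?thesis by (simp add: dE_mult smooth_fr2 S' T' dE_fr2)
qed

text \<open>The Hodge dual is parallel: \<open>tau\<close> and the inverse Gram matrix contribute
  nothing at \<open>p\<close>.\<close>

lemma dE_hodge:
  assumes T: "\<And>a b. smooth_on M (\<lambda>x. T x a b)"
  shows "dE l (\<lambda>x. fr2 (E x) (hodge g os T x) i j) = tr_frame p (E p) (\<lambda>k m. tr_frame p (E p) (\<lambda>h n.
    tau p * eps4 i j k h * fr3 (E p) (nabla2 g T p) l m n)) / 2"
proof -
  note T' = smooth_U[OF T]
  have t: "smooth_on U tau" "dE l tau = 0" using stationary_tau unfolding stationary_def by auto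
  have s: "smooth_on U (\<lambda>x. tau x * eps4 i j k h * fr2 (E x) (T x) m n)" for k h m n
    by (intro smooth_on_mult smooth_fr2 T' t open_U smooth_on_const)
  have d: "dE l (\<lambda>x. tau x * eps4 i j k h * fr2 (E x) (T x) m n) = tau p * eps4 i j k h * fr3 (E p) (nabla2 g T p) l m n" for k h m n
    by (simp add: dE_mult t smooth_fr2 T' smooth_on_mult open_U dE_fr2)
  have "dE l (\<lambda>x. fr2 (E x) (hodge g os T x) i j) =
      dE l (\<lambda>x. (1 / 2) * tr_frame x (E x) (\<lambda>k m. tr_frame x (E x) (\<lambda>h n. tau x * eps4 i j k h * fr2 (E x) (T x) m n)))"
  proof (rule dE_cong)
    fix x assume x: "x \<in> U"
    show "fr2 (E x) (hodge g os T x) i j = (1 / 2) * tr_frame x (E x) (\<lambda>k m. tr_frame x (E x) (\<lambda>h n. tau x * eps4 i j k h * fr2 (E x) (T x) m n))"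
      unfolding fr2_hodge[OF U_M[OF x] invertible_E[OF x]] tau_def by simp
  qed
  also have "\<dots> = (1 / 2) * tr_frame p (E p) (\<lambda>k m. tr_frame p (E p) (\<lambda>h n. dE l (\<lambda>x. tau x * eps4 i j k h * fr2 (E x) (T x) m n)))"
    by (subst dE_mult) (simp_all add: smooth_tr_frame s dE_tr_frame)
  finally show ?thesis unfolding d by simp
qed

end

context null_cky_frame
begin

abbreviation "zeta1 \<equiv> fr1 (E p) (Z1 p)"
abbreviation "zeta2 \<equiv> fr1 (E p) (Z2 p)"
abbreviation "DA \<equiv> fr3 (E p) (nabla2 g A p)"
abbreviation "DB \<equiv> fr3 (E p) (nabla2 g B p)"
abbreviation "phi1 \<equiv> fr2 (E p) (F1 p)"
abbreviation "phi2 \<equiv> fr2 (E p) (F2 p)"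
abbreviation "riem \<equiv> fr4 (E p) (riemann g p)"
abbreviation "Dphi1 \<equiv> fr3 (E p) (nabla2 g F1 p)"
abbreviation "Dphi2 \<equiv> fr3 (E p) (nabla2 g F2 p)"

lemma inv_p: "invertible (frame_matrix (E p))" using invertible_E p_U by blast

lemma tr_frame_p: "tr_frame p (E p) X = tr_null X" by (rule tr_frame_adapted(1)[OF adapted])

lemma tau_p: "tau p = 1" using adapted unfolding adapted_def tau_def by blast

lemma G_p: "fr2 (E p) (\<lambda>a b. g p $ a $ b) i j = null_metric i j" using adapted unfolding adapted_def by blast

lemma A_p: "fr2 (E p) (A p) i j = null_form i j" using adapted unfolding adapted_def by blast

lemma fr2_hodge_p: "fr2 (E p) (hodge g os T p) i j = tr_null (\<lambda>k m. tr_null (\<lambda>l n. eps4 i j k l * fr2 (E p) (T p) m n)) / 2"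
  unfolding fr2_hodge[OF p_M inv_p] tr_frame_p using tau_p unfolding tau_def by simp

lemma B_p: "fr2 (E p) (B p) i j = null_dual i j"
proof -
  have "\<forall>i j. fr2 (E p) (B p) i j = null_dual i j"
    unfolding fr2_hodge_p A_p forall_4 tr_null_def by (simp add: eps4_simps)
  then show ?thesis by blast
qed

text \<open>Stated on all of \<open>U\<close>, with general \<open>G x\<close> and
  \<open>tau x\<close>, because \<open>dE_cky\<close> differentiates it.\<close>

lemma fr3_cky:
  assumes "x \<in> U"
  shows "3 * fr3 (E x) (nabla2 g A x) k i j = fr1 (E x) (Z1 x) i * G x k j - fr1 (E x) (Z1 x) j * G x k i
      - tr_frame x (E x) (\<lambda>m n. tau x * eps4 m k i j * fr1 (E x) (Z2 x) n)"
    and "3 * fr3 (E x) (nabla2 g B x) k i j = fr1 (E x) (Z2 x) i * G x k j - fr1 (E x) (Z2 x) j * G x k i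
      + tr_frame x (E x) (\<lambda>m n. tau x * eps4 m k i j * fr1 (E x) (Z1 x) n)"
proof -
  have x: "x \<in> M" and e: "invertible (frame_matrix (E x))" using assms U_M invertible_E by auto
  have v: "fr3 (E x) (\<lambda>a b c. tr_g g x (\<lambda>m n. volume_element g os x m a b c * w n)) k i j =
      tr_frame x (E x) (\<lambda>m n. tau x * eps4 m k i j * fr1 (E x) w n)" for w
    unfolding fr3_volume_tr_frame[OF x e] fr4_volume_element tau_def ..
  have 1: "fr3 (E x) (\<lambda>a b c. w b * g x $ a $ c) k i j = fr1 (E x) w i * G x k j" for w
    unfolding fr3_def fr2_def G_def by (simp add: fr1_linear)
  have 2: "fr3 (E x) (\<lambda>a b c. w c * g x $ a $ b) k i j = fr1 (E x) w j * G x k i" for w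
    unfolding fr3_def fr2_def G_def by (simp add: fr1_linear)
  have lin: "fr3 (E x) (\<lambda>a b c. h * S a b c) k i j = h * fr3 (E x) S k i j"
    "fr3 (E x) (\<lambda>a b c. S a b c + T a b c) k i j = fr3 (E x) S k i j + fr3 (E x) T k i j"
    "fr3 (E x) (\<lambda>a b c. S a b c - T a b c) k i j = fr3 (E x) S k i j - fr3 (E x) T k i j" for h S T
    by (simp_all add: fr3_def fr2_def fr1_linear)
  have "(\<lambda>a b c. 3 * nabla2 g A x a b c) = (\<lambda>a b c. Z1 x b * g x $ a $ c - Z1 x c * g x $ a $ b
      - tr_g g x (\<lambda>m n. volume_element g os x m a b c * Z2 x n))"
    by (intro ext) (rule cky_real(1)[OF x cky])
  then have "fr3 (E x) (\<lambda>a b c. 3 * nabla2 g A x a b c) k i j = fr3 (E x) (\<lambda>a b c. Z1 x b * g x $ a $ c - Z1 x c * g x $ a $ b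
      - tr_g g x (\<lambda>m n. volume_element g os x m a b c * Z2 x n)) k i j"
    by (rule arg_cong)
  then show "3 * fr3 (E x) (nabla2 g A x) k i j = fr1 (E x) (Z1 x) i * G x k j - fr1 (E x) (Z1 x) j * G x k i
      - tr_frame x (E x) (\<lambda>m n. tau x * eps4 m k i j * fr1 (E x) (Z2 x) n)"
    unfolding lin v 1 2 .
  have "(\<lambda>a b c. 3 * nabla2 g B x a b c) = (\<lambda>a b c. Z2 x b * g x $ a $ c - Z2 x c * g x $ a $ b
      + tr_g g x (\<lambda>m n. volume_element g os x m a b c * Z1 x n))"
    by (intro ext) (rule cky_real(2)[OF x cky])
  then have "fr3 (E x) (\<lambda>a b c. 3 * nabla2 g B x a b c) k i j = fr3 (E x) (\<lambda>a b c. Z2 x b * g x $ a $ c - Z2 x c * g x $ a $ b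
      + tr_g g x (\<lambda>m n. volume_element g os x m a b c * Z1 x n)) k i j"
    by (rule arg_cong)
  then show "3 * fr3 (E x) (nabla2 g B x) k i j = fr1 (E x) (Z2 x) i * G x k j - fr1 (E x) (Z2 x) j * G x k i
      + tr_frame x (E x) (\<lambda>m n. tau x * eps4 m k i j * fr1 (E x) (Z1 x) n)"
    unfolding lin v 1 2 .
qed

lemma Gp: "G p i j = null_metric i j" unfolding G_def by (rule G_p)

lemma dot2_p: "dot2 p S T = tr_null (\<lambda>i k. tr_null (\<lambda>j m. fr2 (E p) S i j * fr2 (E p) T k m))"
  unfolding dot2_tr_frame[OF p_M inv_p] tr_frame_p ..

end

text \<open>The normal form in an adapted frame gives both scalars separately. Holding at every
  point of \<open>M\<close>, they can be differentiated.\<close>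

lemma (in null_cky) dot2_zero:
  assumes "p \<in> M"
  shows "dot2 p (A p) (A p) = 0" and "dot2 p (A p) (B p) = 0"
proof -
  obtain E U where "null_cky_frame M g os A p E U" using exists_frame[OF assms] by blast
  then interpret F: null_cky_frame M g os A p E U .
  show "dot2 p (A p) (A p) = 0" "dot2 p (A p) (B p) = 0"
    unfolding F.dot2_p F.A_p F.B_p by (simp_all add: tr_null_def)
qed

section \<open>Consequences of the CKY equation and of its derivative in the adapted frame\<close>

context null_cky_frame
begin

lemma algebra1: "null_algebra1 zeta1 zeta2 DA DB"
proof
  show "3 * DA k i j = zeta1 i * null_metric k j - zeta1 j * null_metric k i - tr_null (\<lambda>m n. eps4 m k i j * zeta2 n)" for k i j
    using fr3_cky(1)[OF p_U, of k i j] unfolding tr_frame_p tau_p Gp by simp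
  show "3 * DB k i j = zeta2 i * null_metric k j - zeta2 j * null_metric k i + tr_null (\<lambda>m n. eps4 m k i j * zeta1 n)" for k i j
    using fr3_cky(2)[OF p_U, of k i j] unfolding tr_frame_p tau_p Gp by simp
  show "tr_null (\<lambda>i k. tr_null (\<lambda>j m. null_form i j * DA l k m + DA l i j * null_form k m)) = 0" for l
  proof -
    have "dE l (\<lambda>x. dot2 x (A x) (A x)) = dE l (\<lambda>x. 0)"
      by (rule dE_cong) (rule dot2_zero(1)[OF U_M])
    then show ?thesis by (simp add: dE_dot2 tr_frame_p A_p)
  qed
  show "tr_null (\<lambda>i k. tr_null (\<lambda>j m. null_form i j * DB l k m + DA l i j * null_dual k m)) = 0" for l
  proof -
    have "dE l (\<lambda>x. dot2 x (A x) (B x)) = dE l (\<lambda>x. 0)"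
      by (rule dE_cong) (rule dot2_zero(2)[OF U_M])
    then show ?thesis by (simp add: dE_dot2 tr_frame_p A_p B_p)
  qed
qed

lemma phi_antisym: "phi1 i j = - phi1 j i" "phi2 i j = - phi2 j i"
proof -
  have "(\<lambda>a b. F1 p a b) = (\<lambda>a b. - F1 p b a)" by (intro ext) (rule F1_anti[OF p_M])
  then have "phi1 i j = fr2 (E p) (\<lambda>a b. - F1 p b a) i j" by (rule arg_cong)
  also have "\<dots> = - fr2 (E p) (\<lambda>a b. F1 p b a) i j" by (simp add: fr2_def fr1_linear)
  finally show "phi1 i j = - phi1 j i" using fr2_transpose[of "E p" "F1 p" i j] by linarith
  have "(\<lambda>a b. F2 p a b) = (\<lambda>a b. - F2 p b a)" by (intro ext) (rule F2_anti[OF p_M])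
  then have "phi2 i j = fr2 (E p) (\<lambda>a b. - F2 p b a) i j" by (rule arg_cong)
  also have "\<dots> = - fr2 (E p) (\<lambda>a b. F2 p b a) i j" by (simp add: fr2_def fr1_linear)
  finally show "phi2 i j = - phi2 j i" using fr2_transpose[of "E p" "F2 p" i j] by linarith
qed

text \<open>The derivative of the CKY equation expresses the second derivatives of \<open>A\<close>
  linearly through the first derivatives of \<open>Z1\<close> and \<open>Z2\<close>.\<close>

lemma dE_cky: "3 * fr4 (E p) (nabla3 g (nabla2 g A) p) l k i j =
    phi1 l i * null_metric k j - phi1 l j * null_metric k i - tr_null (\<lambda>m n. eps4 m k i j * phi2 l n)"
proof -
  have sQ: "smooth_on U (\<lambda>x. nabla2 g A x a b c)" for a b c by (intro smooth_U smooth_nabla2 smooth_A)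
  have sZ: "smooth_on U (\<lambda>x. Z1 x a)" "smooth_on U (\<lambda>x. Z2 x a)" for a by (intro smooth_U smooth_Z1 smooth_Z2)+
  have sG: "smooth_on U (\<lambda>x. G x i j)" "dE l (\<lambda>x. G x i j) = 0" for i j
    using stationary_G unfolding stationary_def by auto
  have t: "smooth_on U tau" "dE l tau = 0" using stationary_tau unfolding stationary_def by auto
  have sv: "smooth_on U (\<lambda>x. tau x * eps4 m k i j * fr1 (E x) (Z2 x) n)" for m n
    by (intro smooth_on_mult smooth_fr1 sZ t open_U smooth_on_const)
  have dv: "dE l (\<lambda>x. tau x * eps4 m k i j * fr1 (E x) (Z2 x) n) = eps4 m k i j * phi2 l n" for m n
    by (simp add: dE_mult t smooth_fr1 sZ smooth_on_mult open_U dE_fr1 tau_p)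
  have "dE l (\<lambda>x. 3 * fr3 (E x) (nabla2 g A x) k i j) = dE l (\<lambda>x. fr1 (E x) (Z1 x) i * G x k j - fr1 (E x) (Z1 x) j * G x k i
      - tr_frame x (E x) (\<lambda>m n. tau x * eps4 m k i j * fr1 (E x) (Z2 x) n))"
    by (rule dE_cong) (rule fr3_cky(1))
  moreover have "dE l (\<lambda>x. 3 * fr3 (E x) (nabla2 g A x) k i j) = 3 * fr4 (E p) (nabla3 g (nabla2 g A) p) l k i j"
    by (simp add: dE_mult smooth_fr3 sQ dE_fr3)
  moreover have "dE l (\<lambda>x. fr1 (E x) (Z1 x) i * G x k j - fr1 (E x) (Z1 x) j * G x k i
      - tr_frame x (E x) (\<lambda>m n. tau x * eps4 m k i j * fr1 (E x) (Z2 x) n)) =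
      phi1 l i * null_metric k j - phi1 l j * null_metric k i - tr_null (\<lambda>m n. eps4 m k i j * phi2 l n)"
    by (simp add: dE_diff dE_mult smooth_tr_frame sv smooth_fr1 sZ sG smooth_on_mult smooth_on_diff open_U dE_fr1 Gp
        dE_tr_frame dv tr_frame_p)
  ultimately show ?thesis by simp
qed

lemma algebra2: "null_algebra2 zeta1 zeta2 DA DB phi1 phi2 riem"
proof (rule null_algebra2.intro[OF algebra1], unfold_locales)
  show "phi1 i j = - phi1 j i" "phi2 i j = - phi2 j i" for i j by (rule phi_antisym)+
  show "riem i j k l = - riem j i k l" "riem i j k l = - riem i j l k" "riem i j k l = riem k l i j"
    "riem i j k l + riem i k l j + riem i l j k = 0" for i j k l
    by (rule frame_riemann[OF p_M])+
  fix l k i j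
  let ?N = "nabla3 g (nabla2 g A) p"
  \<comment> \<open>This gives the curvature side of \<open>Ricci_A\<close>; the other side is
    \<open>dE_cky\<close> antisymmetrised in the two directions of differentiation.\<close>
  have "(\<lambda>a b c d. ?N a b c d - ?N b a c d) = (\<lambda>a b c d. - (\<Sum>e\<in>UNIV. riemann_up g p e c a b * A p e d) -
      (\<Sum>e\<in>UNIV. riemann_up g p e d a b * A p c e))"
    by (intro ext) (rule Ricci_identity2[OF p_M smooth_A])
  then have "fr4 (E p) (\<lambda>a b c d. ?N a b c d - ?N b a c d) l k i j =
      fr4 (E p) (\<lambda>a b c d. - (\<Sum>e\<in>UNIV. riemann_up g p e c a b * A p e d) - (\<Sum>e\<in>UNIV. riemann_up g p e d a b * A p c e)) l k i j"
    by (rule arg_cong)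
  moreover have "fr4 (E p) (\<lambda>a b c d. ?N b a c d) l k i j = fr4 (E p) ?N k l i j"
    by (rule fr4_swap_left)
  ultimately have "fr4 (E p) ?N l k i j - fr4 (E p) ?N k l i j =
      - tr_null (\<lambda>h f. riem f i l k * null_form h j) - tr_null (\<lambda>h f. riem f j l k * null_form i h)"
    unfolding fr4_diff fr4_minus fr4_curvature1[OF p_M inv_p] fr4_curvature2[OF p_M inv_p] tr_frame_p A_p by linarith
  then show "- 3 * (tr_null (\<lambda>e f. riem f i l k * null_form e j) + tr_null (\<lambda>e f. riem f j l k * null_form i e)) =
      (phi1 l i * null_metric k j - phi1 l j * null_metric k i - tr_null (\<lambda>m n. eps4 m k i j * phi2 l n)) -
      (phi1 k i * null_metric l j - phi1 k j * null_metric l i - tr_null (\<lambda>m n. eps4 m l i j * phi2 k n))"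
    unfolding dE_cky[symmetric] by argo
qed

lemma tr_g_p: "tr_g g p T = tr_null (fr2 (E p) T)"
  unfolding tr_g_frame[OF p_M inv_p] tr_frame_p ..

lemma ricci_p: "fr2 (E p) (ricci g p) i j = tr_null (\<lambda>k m. riem m i k j)"
  unfolding fr2_ricci[OF p_M inv_p] tr_frame_p ..

lemma scalar_curvature_p: "scalar_curvature g p = 12 * riem 3 4 3 4"
proof -
  interpret alg: null_algebra2 zeta1 zeta2 DA DB phi1 phi2 riem by (rule algebra2)
  show ?thesis
    unfolding scalar_curvature_tr_g tr_g_p
    by (simp add: tr_null_def ricci_p alg.r_normal alg.r_values)
qed

end

text \<open>Since l is null, the trace of \<open>Ric = sigma l l + Lambda g\<close> is
  \<open>4 * Lambda\<close>.\<close>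

definition Lambda_of :: "metric \<Rightarrow> point \<Rightarrow> real" where
  "Lambda_of g p = scalar_curvature g p / 4"

context null_cky
begin

text \<open>The frame computation is \<open>z_values\<close>; in spinors, both factors contain
  \<open>o\<close>, which contracts to zero with itself. The frame-free form is what
  \<open>algebra3\<close> differentiates.\<close>

lemma null_contraction:
  assumes "p \<in> M"
  shows "tr_g g p (\<lambda>a b. Z1 p a * A p b c) - tr_g g p (\<lambda>a b. Z2 p a * B p b c) = 0"
    and "tr_g g p (\<lambda>a b. Z1 p a * B p b c) + tr_g g p (\<lambda>a b. Z2 p a * A p b c) = 0"
proof -
  obtain E U where "null_cky_frame M g os A p E U" using exists_frame[OF assms] by blast
  then interpret F: null_cky_frame M g os A p E U .
  interpret alg: null_algebra1 F.zeta1 F.zeta2 F.DA F.DB by (rule F.algebra1)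
  have "fr1 (E p) (\<lambda>c. tr_g g p (\<lambda>a b. Z1 p a * A p b c) - tr_g g p (\<lambda>a b. Z2 p a * B p b c)) k = fr1 (E p) (\<lambda>c. 0) k" for k
  proof -
    have "\<forall>k. tr_null (\<lambda>i j. F.zeta1 i * null_form j k) - tr_null (\<lambda>i j. F.zeta2 i * null_dual j k) = 0"
      unfolding forall_4 tr_null_def by (simp add: alg.z_values)
    then show ?thesis unfolding fr1_diff fr1_interior_tr_frame[OF assms F.inv_p] F.tr_frame_p F.A_p F.B_p by simp
  qed
  then show "tr_g g p (\<lambda>a b. Z1 p a * A p b c) - tr_g g p (\<lambda>a b. Z2 p a * B p b c) = 0"
    by (rule fr1_inject[OF F.inv_p])
  have "fr1 (E p) (\<lambda>c. tr_g g p (\<lambda>a b. Z1 p a * B p b c) + tr_g g p (\<lambda>a b. Z2 p a * A p b c)) k = fr1 (E p) (\<lambda>c. 0) k" for k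
  proof -
    have "\<forall>k. tr_null (\<lambda>i j. F.zeta1 i * null_dual j k) + tr_null (\<lambda>i j. F.zeta2 i * null_form j k) = 0"
      unfolding forall_4 tr_null_def by (simp add: alg.z_values)
    then show ?thesis unfolding fr1_add fr1_interior_tr_frame[OF assms F.inv_p] F.tr_frame_p F.A_p F.B_p by simp
  qed
  then show "tr_g g p (\<lambda>a b. Z1 p a * B p b c) + tr_g g p (\<lambda>a b. Z2 p a * A p b c) = 0"
    by (rule fr1_inject[OF F.inv_p])
qed

lemma duality:
  assumes "p \<in> M"
  shows "F1 p a b - hodge g os F2 p a b = Lambda_of g p * A p a b"
proof -
  obtain E U where "null_cky_frame M g os A p E U" using exists_frame[OF assms] by blast
  then interpret F: null_cky_frame M g os A p E U .
  interpret alg: null_algebra2 F.zeta1 F.zeta2 F.DA F.DB F.phi1 F.phi2 F.riem by (rule F.algebra2)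
  have "fr2 (E p) (\<lambda>a b. F1 p a b - hodge g os F2 p a b) i j = fr2 (E p) (\<lambda>a b. Lambda_of g p * A p a b) i j" for i j
  proof -
    have "\<forall>i j. F.phi1 i j - tr_null (\<lambda>k m. tr_null (\<lambda>l n. eps4 i j k l * F.phi2 m n)) / 2 = 3 * F.riem 3 4 3 4 * null_form i j"
      unfolding forall_4 tr_null_def by (simp add: eps4_simps alg.f_normal alg.f_dual)
    moreover have "fr2 (E p) (\<lambda>a b. F1 p a b - hodge g os F2 p a b) i j = F.phi1 i j - fr2 (E p) (hodge g os F2 p) i j"
      "fr2 (E p) (\<lambda>a b. Lambda_of g p * A p a b) i j = Lambda_of g p * fr2 (E p) (A p) i j"
      by (simp_all add: fr2_def fr1_linear)
    ultimately show ?thesis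
      unfolding F.fr2_hodge_p F.A_p Lambda_of_def F.scalar_curvature_p by simp
  qed
  then show ?thesis by (rule fr2_inject[OF F.inv_p])
qed

end

section \<open>Derivatives of the null contraction, of the norms and of the duality relation\<close>

context null_cky_frame
begin

lemma algebra3: "null_algebra3 zeta1 zeta2 DA DB phi1 phi2 riem"
proof (rule null_algebra3.intro[OF algebra2], unfold_locales)
  have s: "smooth_on U (\<lambda>x. fr1 (E x) (\<lambda>c. tr_g g x (\<lambda>a b. w x a * T x b c)) k)"
    if "\<And>a. smooth_on M (\<lambda>x. w x a)" "\<And>a b. smooth_on M (\<lambda>x. T x a b)" for w T k
    by (intro smooth_fr1 smooth_U smooth_tr_g smooth_on_mult that open_M)
  show "tr_null (\<lambda>i j. phi1 l i * null_form j c + zeta1 i * DA l j c) - tr_null (\<lambda>i j. phi2 l i * null_dual j c + zeta2 i * DB l j c) = 0" for l c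
  proof -
    have "dE l (\<lambda>x. fr1 (E x) (\<lambda>c. tr_g g x (\<lambda>a b. Z1 x a * A x b c) - tr_g g x (\<lambda>a b. Z2 x a * B x b c)) c) = dE l (\<lambda>x. 0)"
      by (rule dE_cong) (simp add: null_contraction U_M)
    then have "dE l (\<lambda>x. fr1 (E x) (\<lambda>c. tr_g g x (\<lambda>a b. Z1 x a * A x b c)) c) - dE l (\<lambda>x. fr1 (E x) (\<lambda>c. tr_g g x (\<lambda>a b. Z2 x a * B x b c)) c) = 0"
      unfolding fr1_diff by (subst (asm) dE_diff) (simp_all add: s)
    then show ?thesis
      by (simp add: dE_interior tr_frame_p A_p B_p add.commute)
  qed
  show "tr_null (\<lambda>i j. phi1 l i * null_dual j c + zeta1 i * DB l j c) + tr_null (\<lambda>i j. phi2 l i * null_form j c + zeta2 i * DA l j c) = 0" for l c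
  proof -
    have "dE l (\<lambda>x. fr1 (E x) (\<lambda>c. tr_g g x (\<lambda>a b. Z1 x a * B x b c) + tr_g g x (\<lambda>a b. Z2 x a * A x b c)) c) = dE l (\<lambda>x. 0)"
      by (rule dE_cong) (simp add: null_contraction U_M)
    then have "dE l (\<lambda>x. fr1 (E x) (\<lambda>c. tr_g g x (\<lambda>a b. Z1 x a * B x b c)) c) + dE l (\<lambda>x. fr1 (E x) (\<lambda>c. tr_g g x (\<lambda>a b. Z2 x a * A x b c)) c) = 0"
      unfolding fr1_add by (subst (asm) dE_add) (simp_all add: s)
    then show ?thesis
      by (simp add: dE_interior tr_frame_p A_p B_p add.commute)
  qed
qed

end

context null_cky
begin

lemma derivative_norms:
  assumes "p \<in> M"
  shows "dot2 p (F1 p) (F1 p) = dot2 p (F2 p) (F2 p)" and "dot2 p (F1 p) (F2 p) = 0"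
proof -
  obtain E U where "null_cky_frame M g os A p E U" using exists_frame[OF assms] by blast
  then interpret F: null_cky_frame M g os A p E U .
  interpret alg: null_algebra3 F.zeta1 F.zeta2 F.DA F.DB F.phi1 F.phi2 F.riem by (rule F.algebra3)
  show "dot2 p (F1 p) (F1 p) = dot2 p (F2 p) (F2 p)" "dot2 p (F1 p) (F2 p) = 0"
    unfolding F.dot2_p by (rule alg.f_norms)+
qed

lemma smooth_Lambda: "smooth_on M (Lambda_of g)"
  unfolding Lambda_of_def[abs_def]
  using smooth_on_divide[OF open_M smooth_scalar_curvature smooth_on_const, of 4] by simp

end

context null_cky_frame
begin

lemma Dphi_eq: "Dphi1 l i j = tr_null (\<lambda>m n. riem m l i j * zeta1 n)" "Dphi2 l i j = tr_null (\<lambda>m n. riem m l i j * zeta2 n)"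
proof -
  have "nabla2 g F1 p = (\<lambda>a b c. \<Sum>e\<in>UNIV. riemann_up g p e a b c * Z1 p e)"
    by (intro ext) (rule killing_second_derivative[OF p_M smooth_Z1 F1_anti])
  then have "Dphi1 l i j = fr3 (E p) (\<lambda>a b c. \<Sum>e\<in>UNIV. riemann_up g p e a b c * Z1 p e) l i j" by (rule arg_cong)
  then show "Dphi1 l i j = tr_null (\<lambda>m n. riem m l i j * zeta1 n)"
    unfolding fr3_curvature[OF p_M inv_p] tr_frame_p .
  have "nabla2 g F2 p = (\<lambda>a b c. \<Sum>e\<in>UNIV. riemann_up g p e a b c * Z2 p e)"
    by (intro ext) (rule killing_second_derivative[OF p_M smooth_Z2 F2_anti])
  then have "Dphi2 l i j = fr3 (E p) (\<lambda>a b c. \<Sum>e\<in>UNIV. riemann_up g p e a b c * Z2 p e) l i j" by (rule arg_cong)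
  then show "Dphi2 l i j = tr_null (\<lambda>m n. riem m l i j * zeta2 n)"
    unfolding fr3_curvature[OF p_M inv_p] tr_frame_p .
qed

lemma dE_duality:
  "Dphi1 l i j - tr_null (\<lambda>k m. tr_null (\<lambda>h n. eps4 i j k h * Dphi2 l m n)) / 2 =
    dE l (Lambda_of g) * null_form i j + Lambda_of g p * DA l i j"
proof -
  have s: "smooth_on U (\<lambda>x. F1 x a b)" "smooth_on U (\<lambda>x. hodge g os F2 x a b)" "smooth_on U (\<lambda>x. A x a b)" "smooth_on U (Lambda_of g)" for a b
    by (intro smooth_U smooth_F1 smooth_hodge smooth_F2 smooth_A smooth_Lambda)+
  have "fr2 (E x) (F1 x) i j - fr2 (E x) (hodge g os F2 x) i j = Lambda_of g x * fr2 (E x) (A x) i j" if "x \<in> U" for x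
  proof -
    have "(\<lambda>a b. F1 x a b - hodge g os F2 x a b) = (\<lambda>a b. Lambda_of g x * A x a b)"
      by (intro ext) (rule duality[OF U_M[OF that]])
    then have "fr2 (E x) (\<lambda>a b. F1 x a b - hodge g os F2 x a b) i j = fr2 (E x) (\<lambda>a b. Lambda_of g x * A x a b) i j"
      by (rule arg_cong)
    then show ?thesis by (simp add: fr2_def fr1_linear)
  qed
  then have "dE l (\<lambda>x. fr2 (E x) (F1 x) i j - fr2 (E x) (hodge g os F2 x) i j) = dE l (\<lambda>x. Lambda_of g x * fr2 (E x) (A x) i j)"
    by (rule dE_cong)
  moreover have "dE l (\<lambda>x. fr2 (E x) (F1 x) i j - fr2 (E x) (hodge g os F2 x) i j) =
      Dphi1 l i j - tr_null (\<lambda>k m. tr_null (\<lambda>h n. eps4 i j k h * Dphi2 l m n)) / 2"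
  proof -
    have "dE l (\<lambda>x. fr2 (E x) (hodge g os F2 x) i j) = tr_null (\<lambda>k m. tr_null (\<lambda>h n. eps4 i j k h * Dphi2 l m n)) / 2"
      using dE_hodge[of F2 l i j] by (simp add: tr_frame_p tau_p)
    then show ?thesis
      by (subst dE_diff) (simp_all add: smooth_fr2 s dE_fr2[where T = F1])
  qed
  moreover have "dE l (\<lambda>x. Lambda_of g x * fr2 (E x) (A x) i j) = dE l (Lambda_of g) * null_form i j + Lambda_of g p * DA l i j"
    by (simp add: dE_mult smooth_fr2 s dE_fr2 A_p)
  ultimately show ?thesis by simp
qed

text \<open>If \<open>zeta1 3\<close> and \<open>zeta1 4\<close> vanish, then by
  \<open>z_values\<close> both \<open>Z1\<close> and \<open>Z2\<close> are multiples of l at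
  \<open>p\<close>.\<close>

lemma independent_p: "zeta1 3 * zeta1 3 + zeta1 4 * zeta1 4 \<noteq> 0"
proof
  interpret alg: null_algebra1 zeta1 zeta2 DA DB by (rule algebra1)
  assume "zeta1 3 * zeta1 3 + zeta1 4 * zeta1 4 = 0"
  then have "zeta1 3 = 0" "zeta1 4 = 0" by (simp_all add: sum_squares_eq_zero_iff)
  then have "\<forall>i j. zeta1 i * zeta2 j - zeta1 j * zeta2 i = 0"
    unfolding forall_4 by (simp add: alg.z_values)
  moreover have "fr2 (E p) (wedge (Z1 p) (Z2 p)) i j = zeta1 i * zeta2 j - zeta1 j * zeta2 i" for i j
  proof -
    have "wedge (Z1 p) (Z2 p) = (\<lambda>a b. Z1 p a * Z2 p b - Z1 p b * Z2 p a)" by (intro ext) (simp add: wedge_def)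
    then show ?thesis by (simp add: fr2_def fr1_linear mult.commute)
  qed
  ultimately have "fr2 (E p) (wedge (Z1 p) (Z2 p)) i j = fr2 (E p) (\<lambda>a b. 0) i j" for i j
    by (simp add: fr2_def)
  then have "wedge (Z1 p) (Z2 p) a b = 0" for a b by (rule fr2_inject[OF inv_p])
  then show False using independent[OF p_M] by blast
qed

lemma algebra4: "null_algebra4 zeta1 zeta2 DA DB phi1 phi2 riem Dphi1 Dphi2 (\<lambda>l. dE l (Lambda_of g))"
proof (rule null_algebra4.intro[OF algebra3], unfold_locales)
  interpret alg: null_algebra3 zeta1 zeta2 DA DB phi1 phi2 riem by (rule algebra3)
  show "Dphi1 l i j = tr_null (\<lambda>m n. riem m l i j * zeta1 n)" "Dphi2 l i j = tr_null (\<lambda>m n. riem m l i j * zeta2 n)" for l i j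
    by (rule Dphi_eq)+
  show "tr_null (\<lambda>i k. tr_null (\<lambda>j m. phi1 i j * Dphi1 l k m + Dphi1 l i j * phi1 k m)) =
      tr_null (\<lambda>i k. tr_null (\<lambda>j m. phi2 i j * Dphi2 l k m + Dphi2 l i j * phi2 k m))" for l
  proof -
    have "dE l (\<lambda>x. dot2 x (F1 x) (F1 x)) = dE l (\<lambda>x. dot2 x (F2 x) (F2 x))"
      by (rule dE_cong) (rule derivative_norms(1)[OF U_M])
    then show ?thesis by (simp add: dE_dot2 tr_frame_p)
  qed
  show "tr_null (\<lambda>i k. tr_null (\<lambda>j m. phi1 i j * Dphi2 l k m + Dphi1 l i j * phi2 k m)) = 0" for l
  proof -
    have "dE l (\<lambda>x. dot2 x (F1 x) (F2 x)) = dE l (\<lambda>x. 0)"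
      by (rule dE_cong) (rule derivative_norms(2)[OF U_M])
    then show ?thesis by (simp add: dE_dot2 tr_frame_p)
  qed
  have L: "Lambda_of g p = 3 * riem 3 4 3 4" unfolding Lambda_of_def scalar_curvature_p by simp
  have anti: "Dphi2 l i j = - Dphi2 l j i" for l i j
    unfolding Dphi_eq tr_null_def using alg.r_anti_right[of _ l i j] by simp
  have d: "Dphi2 l 4 2 = - Dphi2 l 2 4" "Dphi2 l 3 2 = - Dphi2 l 2 3" for l
    by (rule anti)+
  show "Dphi1 l 2 3 - Dphi2 l 2 4 = dE l (Lambda_of g) + 3 * riem 3 4 3 4 * DA l 2 3" for l
    using dE_duality[of l 2 3] unfolding tr_null_def L by (simp add: eps4_simps d)
  show "Dphi1 l 2 4 + Dphi2 l 2 3 = 3 * riem 3 4 3 4 * DA l 2 4" for l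
    using dE_duality[of l 2 4] unfolding tr_null_def L by (simp add: eps4_simps d)
  show "zeta1 3 * zeta1 3 + zeta1 4 * zeta1 4 \<noteq> 0" by (rule independent_p)
qed

end

section \<open>Normal form of the curvature and the fundamental vector\<close>

definition null_covec :: "4 \<Rightarrow> real" where
  "null_covec i = (if i = 2 then 1 else 0)"

lemma null_covec_simps [simp]: "null_covec 1 = 0" "null_covec 2 = 1" "null_covec 3 = 0" "null_covec 4 = 0"
  by (simp_all add: null_covec_def)

text \<open>A constant curvature part plus the Kulkarni-Nomizu product of the metric with l l, where
  \<open>null_covec\<close> is l with lowered index; both are built from the metric and the Ricci
  tensor, so no Weyl part is left.\<close>

lemma (in null_algebra4) r_formula:
  "r i j k l = r 3 4 3 4 * (null_metric i k * null_metric j l - null_metric i l * null_metric j k) + r 2 3 2 3 *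
    (null_metric i k * null_covec j * null_covec l - null_metric i l * null_covec j * null_covec k - null_metric j k * null_covec i * null_covec l + null_metric j l * null_covec i * null_covec k)"
proof -
  have "\<forall>i j k l. r i j k l = r 3 4 3 4 * (null_metric i k * null_metric j l - null_metric i l * null_metric j k) + r 2 3 2 3 *
    (null_metric i k * null_covec j * null_covec l - null_metric i l * null_covec j * null_covec k - null_metric j k * null_covec i * null_covec l + null_metric j l * null_covec i * null_covec k)"
    unfolding forall_4 by (simp add: r_normal r_values weyl_values)
  then show ?thesis by blast
qed

lemma (in null_algebra4) ricci_formula:
  "tr_null (\<lambda>k m. r m i k j) = 3 * r 3 4 3 4 * null_metric i j + 2 * r 2 3 2 3 * null_covec i * null_covec j"
proof -
  have "\<forall>i j. tr_null (\<lambda>k m. r m i k j) = 3 * r 3 4 3 4 * null_metric i j + 2 * r 2 3 2 3 * null_covec i * null_covec j"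
    unfolding forall_4 tr_null_def by (simp add: r_normal r_values weyl_values)
  then show ?thesis by blast
qed

lemma fr4_products:
  "fr4 e (\<lambda>a b c d. S a c * T b d) i j k l = fr2 e S i k * fr2 e T j l"
  "fr4 e (\<lambda>a b c d. S a d * T b c) i j k l = fr2 e S i l * fr2 e T j k"
  "fr4 e (\<lambda>a b c d. S b c * T a d) i j k l = fr2 e S j k * fr2 e T i l"
  "fr4 e (\<lambda>a b c d. S b d * T a c) i j k l = fr2 e S j l * fr2 e T i k"
  unfolding fr4_def fr3_def fr2_def by (simp_all add: fr1_linear mult.commute)

lemma ip_real:
  "ip g p (\<lambda>a. complex_of_real (x a) + \<i> * complex_of_real (y a)) (\<lambda>a. complex_of_real (u a) + \<i> * complex_of_real (v a)) =
    complex_of_real (tr_g g p (\<lambda>a b. x a * u b) - tr_g g p (\<lambda>a b. y a * v b)) +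
    \<i> * complex_of_real (tr_g g p (\<lambda>a b. x a * v b) + tr_g g p (\<lambda>a b. y a * u b))"
proof -
  have "ip g p (\<lambda>a. complex_of_real (x a) + \<i> * complex_of_real (y a)) (\<lambda>a. complex_of_real (u a) + \<i> * complex_of_real (v a)) =
    (\<Sum>a\<in>UNIV. \<Sum>b\<in>UNIV. complex_of_real (ginv g p $ a $ b * (x a * u b) - ginv g p $ a $ b * (y a * v b)) +
      \<i> * complex_of_real (ginv g p $ a $ b * (x a * v b) + ginv g p $ a $ b * (y a * u b)))"
    unfolding ip_def by (intro sum.cong refl) (simp add: complex_eq_iff algebra_simps)
  then show ?thesis
    unfolding tr_g_def by (simp add: complex_eq_iff sum.distrib sum_subtractf)
qed

context metric_domain
begin

text \<open>For a null CKY tensor this turns out to be \<open>l a * l b\<close> for every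
  fundamental vector \<open>l\<close>, yet it is smooth in the point and involves no choice of
  sign.\<close>

definition fundamental_square :: "real form2 \<Rightarrow> point \<Rightarrow> 4 \<Rightarrow> 4 \<Rightarrow> real" where
  "fundamental_square A p a b = tr_g g p (\<lambda>c d. A p a c * A p b d)"

lemma tr_g_transpose: "p \<in> M \<Longrightarrow> tr_g g p (\<lambda>a b. T b a) = tr_g g p T"
  unfolding tr_g_def by (subst sum.swap) (simp add: ginv_sym)

lemma ip_commute: "p \<in> M \<Longrightarrow> ip g p u v = ip g p v u"
  unfolding ip_def by (subst sum.swap) (simp add: ginv_sym mult_ac)

text \<open>Contracting one index of the self-dual form with one of its conjugate leaves only
  \<open>l a * l b\<close>, by the conditions on \<open>m\<close>; real parts give the two
  squares.\<close>

lemma fundamental_vector_product: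
  assumes p: "p \<in> M" and l: "fundamental_vector_at g os A p l"
  shows "2 * (l a * l b) = fundamental_square A p a b + fundamental_square (hodge g os A) p a b"
proof -
  let ?B = "hodge g os A" and ?L = "\<lambda>a. complex_of_real (l a)"
  obtain m where m: "ip g p ?L ?L = 0" "ip g p m ?L = 0" "ip g p m (\<lambda>a. cnj (m a)) = 1"
    "self_dual g os A p = wedge ?L m"
    using l unfolding fundamental_vector_at_def Let_def by blast
  have "ip g p ?L (\<lambda>a. cnj (m a)) = cnj (ip g p ?L m)" unfolding ip_def by simp
  then have m2: "ip g p ?L (\<lambda>a. cnj (m a)) = 0" using m(2) ip_commute[OF p, of ?L m] by simp
  have "ip g p (self_dual g os A p a) (\<lambda>d. cnj (self_dual g os A p b d)) =
      ?L a * ?L b * ip g p m (\<lambda>a. cnj (m a)) - ?L a * cnj (m b) * ip g p m ?L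
      - m a * ?L b * ip g p ?L (\<lambda>a. cnj (m a)) + m a * cnj (m b) * ip g p ?L ?L"
    unfolding m(4) wedge_def ip_def
    by (simp add: sum_distrib_left sum.distrib sum_subtractf algebra_simps)
  then have 1: "ip g p (self_dual g os A p a) (\<lambda>d. cnj (self_dual g os A p b d)) = complex_of_real (l a * l b)"
    using m m2 by simp
  have sd: "self_dual g os A p a = (\<lambda>c. complex_of_real (A p a c / sqrt 2) + \<i> * complex_of_real (- ?B p a c / sqrt 2))" for a
    by (intro ext) (simp add: self_dual_def diff_divide_distrib)
  have sd': "(\<lambda>d. cnj (self_dual g os A p b d)) = (\<lambda>c. complex_of_real (A p b c / sqrt 2) + \<i> * complex_of_real (?B p b c / sqrt 2))"
    unfolding sd by (intro ext) simp
  have h: "tr_g g p (\<lambda>c d. x c / sqrt 2 * (y d / sqrt 2)) = tr_g g p (\<lambda>c d. x c * y d) / 2" for x y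
    using tr_g_mult_right[of g p "\<lambda>c d. x c * y d" "1 / 2"] by simp
  have "Re (ip g p (self_dual g os A p a) (\<lambda>d. cnj (self_dual g os A p b d))) =
      tr_g g p (\<lambda>c d. A p a c / sqrt 2 * (A p b d / sqrt 2)) - tr_g g p (\<lambda>c d. - ?B p a c / sqrt 2 * (?B p b d / sqrt 2))"
    unfolding sd' unfolding sd ip_real by simp
  also have "tr_g g p (\<lambda>c d. - ?B p a c / sqrt 2 * (?B p b d / sqrt 2)) = - tr_g g p (\<lambda>c d. ?B p a c / sqrt 2 * (?B p b d / sqrt 2))"
    unfolding tr_g_uminus[symmetric] by simp
  finally show ?thesis unfolding 1 h fundamental_square_def by simp
qed

end

context null_cky_frame
begin

lemma fundamental_square_p: "fr2 (E p) (fundamental_square A p) i j = null_covec i * null_covec j" "fr2 (E p) (fundamental_square B p) i j = null_covec i * null_covec j"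
proof -
  have X: "fr2 (E p) (fundamental_square X p) i j = tr_null (\<lambda>k m. fr2 (E p) (X p) i k * fr2 (E p) (X p) j m)" for X i j
  proof -
    have l: "fundamental_square X p a b = tr_frame p (E p) (\<lambda>k m. fr1 (E p) (X p a) k * fr1 (E p) (X p b) m)" for a b
      unfolding fundamental_square_def by (rule tr_g_product_tr_frame[OF p_M inv_p])
    have "fr2 (E p) (fundamental_square X p) i j = tr_frame p (E p) (\<lambda>k m. fr2 (E p) (X p) i k * fr2 (E p) (X p) j m)"
      unfolding fr2_def[of "E p" "fundamental_square X p"] l unfolding fr2_def tr_frame_def by (simp add: fr1_linear)
    then show ?thesis unfolding tr_frame_p .
  qed
  have "\<forall>i j. fr2 (E p) (fundamental_square A p) i j = null_covec i * null_covec j" "\<forall>i j. fr2 (E p) (fundamental_square B p) i j = null_covec i * null_covec j"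
    unfolding X A_p B_p forall_4 tr_null_def by simp_all
  then show "fr2 (E p) (fundamental_square A p) i j = null_covec i * null_covec j" "fr2 (E p) (fundamental_square B p) i j = null_covec i * null_covec j" by blast+
qed

lemma fundamental_square_dual_p: "fundamental_square B p a b = fundamental_square A p a b"
  by (rule fr2_inject[OF inv_p]) (simp add: fundamental_square_p)

lemma fundamental_square_nonzero_p: "\<exists>a b. fundamental_square A p a b \<noteq> 0"
proof (rule ccontr)
  assume "\<not> ?thesis"
  then have "fundamental_square A p = (\<lambda>a b. 0)" by (intro ext) blast
  then show False using fundamental_square_p(1)[of 2 2] by (simp add: fr2_def)
qed

text \<open>Lowered frame vectors provide the witnesses: l is the first one, and \<open>m\<close> is
  \<open>(x + i y) / sqrt 2\<close>, with a plus sign because \<open>*A\<close> is minus l wedge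
  y.\<close>

lemma exists_fundamental_p: "\<exists>l. fundamental_vector_at g os A p l"
proof -
  define low where "low = (\<lambda>i a. \<Sum>b\<in>UNIV. g p $ a $ b * E p i b)"
  have low: "fr1 (E p) (low i) j = null_metric j i" for i j
  proof -
    have "fr1 (E p) (low i) j = fr2 (E p) (\<lambda>a b. g p $ a $ b) j i"
      unfolding low_def fr2_def by (simp add: fr1_def mult.commute)
    then show ?thesis unfolding G_p .
  qed
  have ipl: "tr_g g p (\<lambda>a b. low i a * low j b) = null_metric i j" for i j
  proof -
    have "\<forall>i j. tr_null (\<lambda>k m. null_metric k i * null_metric m j) = null_metric i j" unfolding forall_4 tr_null_def by simp
    then show ?thesis unfolding tr_g_product_tr_frame[OF p_M inv_p] tr_frame_p low by simp
  qed
  define s where "s = 1 / sqrt 2"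
  have ss: "s * s = 1 / 2" unfolding s_def by simp
  have ipm: "tr_g g p (\<lambda>a b. (q * low i a) * (t * low j b)) = q * t * null_metric i j" for q t i j
  proof -
    have "tr_g g p (\<lambda>a b. (q * low i a) * (t * low j b)) = tr_g g p (\<lambda>a b. (q * t) * (low i a * low j b))"
      by (simp add: mult_ac)
    then show ?thesis unfolding tr_g_mult_left ipl .
  qed
  define m where "m = (\<lambda>a. complex_of_real (s * low 3 a) + \<i> * complex_of_real (s * low 4 a))"
  have cm: "(\<lambda>a. cnj (m a)) = (\<lambda>a. complex_of_real (s * low 3 a) + \<i> * complex_of_real ((- s) * low 4 a))"
    unfolding m_def by (intro ext) simp
  have L: "(\<lambda>a. complex_of_real (low 1 a)) = (\<lambda>a. complex_of_real (1 * low 1 a) + \<i> * complex_of_real (0 * low 1 a))"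
    by simp
  have A: "A p a b = low 1 a * low 3 b - low 1 b * low 3 a" for a b
  proof (rule fr2_inject[OF inv_p, of "A p" "\<lambda>a b. low 1 a * low 3 b - low 1 b * low 3 a"])
    fix i j
    have "\<forall>i j. null_form i j = null_metric i 1 * null_metric j 3 - null_metric j 1 * null_metric i 3" unfolding forall_4 by simp
    then show "fr2 (E p) (A p) i j = fr2 (E p) (\<lambda>a b. low 1 a * low 3 b - low 1 b * low 3 a) i j"
      unfolding A_p by (simp add: fr2_def fr1_linear low)
  qed
  have B: "B p a b = - (low 1 a * low 4 b - low 1 b * low 4 a)" for a b
  proof (rule fr2_inject[OF inv_p, of "B p" "\<lambda>a b. - (low 1 a * low 4 b - low 1 b * low 4 a)"])
    fix i j
    have "\<forall>i j. null_dual i j = - (null_metric i 1 * null_metric j 4 - null_metric j 1 * null_metric i 4)" unfolding forall_4 by simp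
    then show "fr2 (E p) (B p) i j = fr2 (E p) (\<lambda>a b. - (low 1 a * low 4 b - low 1 b * low 4 a)) i j"
      unfolding B_p by (simp add: fr2_def fr1_linear low)
  qed
  have "self_dual g os A p = wedge (\<lambda>a. complex_of_real (low 1 a)) m"
    unfolding self_dual_def A B wedge_def m_def s_def
    by (intro ext) (simp add: complex_eq_iff diff_divide_distrib)
  moreover have "ip g p (\<lambda>a. complex_of_real (low 1 a)) (\<lambda>a. complex_of_real (low 1 a)) = 0"
    unfolding L ip_real ipm by simp
  moreover have "ip g p m m = 0" unfolding m_def ip_real ipm by simp
  moreover have "ip g p m (\<lambda>a. complex_of_real (low 1 a)) = 0" unfolding L unfolding m_def ip_real ipm by simp
  moreover have "ip g p m (\<lambda>a. cnj (m a)) = 1" unfolding cm unfolding m_def ip_real ipm by (simp add: ss)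
  ultimately have "fundamental_vector_at g os A p (low 1)"
    unfolding fundamental_vector_at_def Let_def by blast
  then show ?thesis by blast
qed

lemma Lambda_p: "Lambda_of g p = 3 * riem 3 4 3 4"
  unfolding Lambda_of_def scalar_curvature_p by simp

lemma ricci_eq_p: "ricci g p a b = 2 * riem 2 3 2 3 * fundamental_square A p a b + Lambda_of g p * g p $ a $ b"
proof (rule fr2_inject[OF inv_p, of "ricci g p" "\<lambda>a b. 2 * riem 2 3 2 3 * fundamental_square A p a b + Lambda_of g p * g p $ a $ b"])
  fix i j
  interpret alg: null_algebra4 zeta1 zeta2 DA DB phi1 phi2 riem Dphi1 Dphi2 "\<lambda>l. dE l (Lambda_of g)" by (rule algebra4)
  have "fr2 (E p) (\<lambda>a b. 2 * riem 2 3 2 3 * fundamental_square A p a b + Lambda_of g p * g p $ a $ b) i j =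
      2 * riem 2 3 2 3 * fr2 (E p) (fundamental_square A p) i j + Lambda_of g p * fr2 (E p) (\<lambda>a b. g p $ a $ b) i j"
    by (simp add: fr2_def fr1_linear)
  then show "fr2 (E p) (ricci g p) i j = fr2 (E p) (\<lambda>a b. 2 * riem 2 3 2 3 * fundamental_square A p a b + Lambda_of g p * g p $ a $ b) i j"
    unfolding ricci_p alg.ricci_formula fundamental_square_p G_p Lambda_p by simp
qed

lemma weyl_zero_p: "weyl g p a b c d = 0"
proof -
  interpret alg: null_algebra4 zeta1 zeta2 DA DB phi1 phi2 riem Dphi1 Dphi2 "\<lambda>l. dE l (Lambda_of g)" by (rule algebra4)
  have "weyl g p = (\<lambda>a b c d. riemann g p a b c d
     - (1 / 2) * (g p $ a $ c * ricci g p b d - g p $ a $ d * ricci g p b c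
        - g p $ b $ c * ricci g p a d + g p $ b $ d * ricci g p a c)
     + scalar_curvature g p / 6 * (g p $ a $ c * g p $ b $ d - g p $ a $ d * g p $ b $ c))"
    by (intro ext) (simp add: weyl_def Gtensor_def)
  then have W: "fr4 (E p) (weyl g p) i j k l = riem i j k l
     - (1 / 2) * (null_metric i k * fr2 (E p) (ricci g p) j l - null_metric i l * fr2 (E p) (ricci g p) j k
        - null_metric j k * fr2 (E p) (ricci g p) i l + null_metric j l * fr2 (E p) (ricci g p) i k)
     + scalar_curvature g p / 6 * (null_metric i k * null_metric j l - null_metric i l * null_metric j k)" for i j k l
    by (simp only: fr4_add fr4_diff fr4_mult_left fr4_products G_p fr4_products[where S = "\<lambda>a b. g p $ a $ b" and T = "ricci g p"]
        fr4_products[where S = "\<lambda>a b. g p $ a $ b" and T = "\<lambda>a b. g p $ a $ b"])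
  have "fr4 (E p) (weyl g p) i j k l = 0" for i j k l
    unfolding W ricci_p alg.ricci_formula scalar_curvature_p
    by (subst alg.r_formula[of i j k l]) (simp add: algebra_simps)
  then have "fr4 (E p) (weyl g p) i j k l = fr4 (E p) (\<lambda>a b c d. 0) i j k l" for i j k l
    by (simp add: fr4_def fr3_def fr2_def)
  then show ?thesis by (rule fr4_inject[OF inv_p])
qed

lemma constant_curvature_p:
  assumes "riem 2 3 2 3 = 0"
  shows "riemann g p a b c d = Lambda_of g p / 3 * Gtensor g p a b c d"
proof (rule fr4_inject[OF inv_p, of "riemann g p" "\<lambda>a b c d. Lambda_of g p / 3 * Gtensor g p a b c d"])
  fix i j k l
  interpret alg: null_algebra4 zeta1 zeta2 DA DB phi1 phi2 riem Dphi1 Dphi2 "\<lambda>l. dE l (Lambda_of g)" by (rule algebra4)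
  have G: "Gtensor g p = (\<lambda>a b c d. g p $ a $ c * g p $ b $ d - g p $ a $ d * g p $ b $ c)"
    by (intro ext) (simp add: Gtensor_def)
  have "fr4 (E p) (Gtensor g p) i j k l = null_metric i k * null_metric j l - null_metric i l * null_metric j k"
    unfolding G fr4_diff fr4_products[where S = "\<lambda>a b. g p $ a $ b" and T = "\<lambda>a b. g p $ a $ b"] G_p ..
  then have "fr4 (E p) (\<lambda>a b c d. Lambda_of g p / 3 * Gtensor g p a b c d) i j k l =
      Lambda_of g p / 3 * (null_metric i k * null_metric j l - null_metric i l * null_metric j k)"
    unfolding fr4_mult_left by simp
  then show "riem i j k l = fr4 (E p) (\<lambda>a b c d. Lambda_of g p / 3 * Gtensor g p a b c d) i j k l"
    unfolding alg.r_formula[of i j k l] Lambda_p assms by simp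
qed

text \<open>The differential of \<open>Lambda\<close> and the constraint in \<open>dL_values\<close>
  make both \<open>zeta1 3\<close> and \<open>zeta1 4\<close> annihilate
  \<open>riem 2 3 2 3\<close>, and the two do not vanish together.\<close>

lemma dLambda_p:
  assumes "\<And>a. pd a (Lambda_of g) p = 0"
  shows "riem 2 3 2 3 = 0"
proof -
  interpret alg: null_algebra4 zeta1 zeta2 DA DB phi1 phi2 riem Dphi1 Dphi2 "\<lambda>l. dE l (Lambda_of g)" by (rule algebra4)
  have "dE 2 (Lambda_of g) = 0" unfolding dE_def using assms by simp
  then have "zeta1 3 * riem 2 3 2 3 = 0" "zeta1 4 * riem 2 3 2 3 = 0" using alg.dL_values by auto
  then show ?thesis using independent_p by auto
qed

text \<open>A component in one particular frame; by \<open>defect_p\<close> its square is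
  frame-independent, being half of \<open>defect p\<close>.\<close>

definition obstruction :: real where "obstruction = zeta1 4"

lemma obstruction_curvature: "obstruction * riem 2 3 2 3 = 0"
proof -
  interpret alg: null_algebra4 zeta1 zeta2 DA DB phi1 phi2 riem Dphi1 Dphi2 "\<lambda>l. dE l (Lambda_of g)" by (rule algebra4)
  show ?thesis unfolding obstruction_def by (rule alg.dL_values(5))
qed

end

section \<open>The defect, the bracket and the invariance of \<open>A\<close>\<close>

context null_cky
begin

text \<open>
  In an adapted frame this equals \<open>2 b\<^sup>2\<close> with \<open>b\<close> the component of \<open>Z\<^sub>1\<close> along the
  fourth vector, which is the obstruction to (i) and (ii).  Its differential vanishes identically.
\<close>

definition defect :: "point \<Rightarrow> real" where
  "defect p = tr_g g p (\<lambda>a b. Z1 p a * Z1 p b) + 3 / 2 * dot2 p (F1 p) (A p)"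

lemma smooth_defect: "smooth_on M defect"
proof -
  have "smooth_on M (\<lambda>x. dot2 x (F1 x) (A x))"
    unfolding dot2_def by (intro smooth_tr_g smooth_on_mult smooth_F1 smooth_A open_M)
  moreover have "smooth_on M (\<lambda>x. tr_g g x (\<lambda>a b. Z1 x a * Z1 x b))"
    by (intro smooth_tr_g smooth_on_mult smooth_Z1 open_M)
  ultimately show ?thesis
    unfolding defect_def[abs_def] by (intro smooth_on_add smooth_on_mult smooth_on_const open_M)
qed

end

context null_cky_frame
begin

lemma defect_p: "defect p = 2 * (obstruction * obstruction)"
proof -
  interpret alg: null_algebra3 zeta1 zeta2 DA DB phi1 phi2 riem by (rule algebra3)
  show ?thesis
    unfolding defect_def obstruction_def tr_g_product_tr_frame[OF p_M inv_p] tr_frame_p dot2_p A_p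
    by (rule alg.imaginary_part)
qed

lemma pd_defect_p: "pd a defect p = 0"
proof -
  interpret alg: null_algebra4 zeta1 zeta2 DA DB phi1 phi2 riem Dphi1 Dphi2 "\<lambda>l. dE l (Lambda_of g)" by (rule algebra4)
  have s1: "smooth_on U (\<lambda>x. dot2 x (F1 x) (A x))"
    unfolding dot2_def by (intro smooth_U smooth_tr_g smooth_on_mult smooth_F1 smooth_A open_M)
  have s2: "smooth_on U (\<lambda>x. tr_g g x (\<lambda>a b. Z1 x a * Z1 x b))"
    by (intro smooth_U smooth_tr_g smooth_on_mult smooth_Z1 open_M)
  have "dE l defect = 0" for l
  proof -
    have "dE l defect = dE l (\<lambda>x. tr_g g x (\<lambda>a b. Z1 x a * Z1 x b)) + 3 / 2 * dE l (\<lambda>x. dot2 x (F1 x) (A x))"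
      unfolding defect_def[abs_def] using s1 s2
      by (subst dE_add) (simp_all add: dE_mult smooth_on_mult open_U del: times_divide_eq_left)
    also have "\<dots> = 0"
      using alg.d_imaginary_part[of l]
      by (simp add: dE_tr_g_product dE_dot2 tr_frame_p A_p)
    finally show ?thesis .
  qed
  then have "fr1 (E p) (\<lambda>a. pd a defect p) l = fr1 (E p) (\<lambda>a. 0) l" for l unfolding dE_def by simp
  then show ?thesis by (rule fr1_inject[OF inv_p])
qed

lemma bracket_p:
  assumes "obstruction = 0"
  shows "lie_bracket (raise g Z1) (raise g Z2) p a = 0"
proof -
  interpret alg: null_algebra3 zeta1 zeta2 DA DB phi1 phi2 riem by (rule algebra3)
  have swap: "tr_g g p (\<lambda>c d. w d * N c b) = tr_g g p (\<lambda>c d. w c * N d b)" for w and N :: "4 \<Rightarrow> 4 \<Rightarrow> real" and b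
    using tr_g_transpose[OF p_M, of "\<lambda>c d. w c * N d b"] .
  have "fr1 (E p) (\<lambda>b. tr_g g p (\<lambda>c d. Z1 p c * F2 p d b) - tr_g g p (\<lambda>c d. Z2 p c * F1 p d b)) k = fr1 (E p) (\<lambda>b. 0) k" for k
    unfolding fr1_diff fr1_interior_tr_frame[OF p_M inv_p] tr_frame_p
    using alg.bracket_zero[of k] assms unfolding obstruction_def by simp
  then have "tr_g g p (\<lambda>c d. Z1 p c * F2 p d b) - tr_g g p (\<lambda>c d. Z2 p c * F1 p d b) = 0" for b
    by (rule fr1_inject[OF inv_p])
  then show ?thesis
    unfolding lower_lie_bracket_raise[OF p_M smooth_Z1 smooth_Z2] swap by simp
qed

lemma fr2_lie_derivative:
  assumes w: "\<And>a. smooth_on M (\<lambda>x. w x a)"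
  shows "fr2 (E p) (lie_derivative2 (raise g w) A p) i j = tr_null (\<lambda>m n. fr1 (E p) (w p) m * DA n i j)
    + tr_null (\<lambda>m n. null_form m j * fr2 (E p) (nabla1 g w p) i n) + tr_null (\<lambda>m n. null_form i m * fr2 (E p) (nabla1 g w p) j n)"
proof -
  let ?F = "nabla1 g w p"
  have 1: "tr_g g p (\<lambda>c d. w p d * nabla2 g A p c a b) = tr_frame p (E p) (\<lambda>m n. fr1 (E p) (w p) m * fr1 (E p) (\<lambda>c. nabla2 g A p c a b) n)" for a b
    using tr_g_transpose[OF p_M, of "\<lambda>c d. w p c * nabla2 g A p d a b"] unfolding tr_g_product_tr_frame[OF p_M inv_p] .
  have 2: "tr_g g p (\<lambda>c d. A p c b * ?F a d) = tr_frame p (E p) (\<lambda>m n. fr1 (E p) (\<lambda>c. A p c b) m * fr1 (E p) (?F a) n)" for a b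
    by (rule tr_g_product_tr_frame[OF p_M inv_p])
  have 3: "tr_g g p (\<lambda>c d. A p a c * ?F b d) = tr_frame p (E p) (\<lambda>m n. fr1 (E p) (A p a) m * fr1 (E p) (?F b) n)" for a b
    by (rule tr_g_product_tr_frame[OF p_M inv_p])
  have s1: "fr1 (E p) (\<lambda>b. fr1 (E p) (\<lambda>c. nabla2 g A p c a b) n) j = fr1 (E p) (\<lambda>c. fr1 (E p) (nabla2 g A p c a) j) n" for a n
    by (rule fr1_swap)
  have s2: "fr1 (E p) (\<lambda>a. fr1 (E p) (\<lambda>c. fr1 (E p) (nabla2 g A p c a) j) n) i = fr1 (E p) (\<lambda>c. fr1 (E p) (\<lambda>a. fr1 (E p) (nabla2 g A p c a) j) i) n" for n
    by (rule fr1_swap)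
  have s3: "fr1 (E p) (\<lambda>b. fr1 (E p) (\<lambda>c. A p c b) m) j = fr1 (E p) (\<lambda>c. fr1 (E p) (A p c) j) m" for m
    by (rule fr1_swap)
  have "fr2 (E p) (lie_derivative2 (raise g w) A p) i j = fr1 (E p) (\<lambda>a. fr1 (E p) (\<lambda>b.
      tr_frame p (E p) (\<lambda>m n. fr1 (E p) (w p) m * fr1 (E p) (\<lambda>c. nabla2 g A p c a b) n) +
      tr_frame p (E p) (\<lambda>m n. fr1 (E p) (\<lambda>c. A p c b) m * fr1 (E p) (?F a) n) +
      tr_frame p (E p) (\<lambda>m n. fr1 (E p) (A p a) m * fr1 (E p) (?F b) n)) j) i"
    unfolding fr2_def lie_derivative2_raise[OF p_M w, abs_def] 1 2 3 ..
  also have "\<dots> = tr_frame p (E p) (\<lambda>m n. fr1 (E p) (w p) m * DA n i j) +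
      tr_frame p (E p) (\<lambda>m n. fr2 (E p) (A p) m j * fr2 (E p) ?F i n) +
      tr_frame p (E p) (\<lambda>m n. fr2 (E p) (A p) i m * fr2 (E p) ?F j n)"
    unfolding tr_frame_def fr1_linear s1 s2 s3 fr3_def fr2_def ..
  finally show ?thesis unfolding tr_frame_p A_p .
qed

lemma lie_derivative_p:
  assumes "obstruction = 0"
  shows "lie_derivative2 (raise g Z1) A p a b = 0" "lie_derivative2 (raise g Z2) A p a b = 0"
proof -
  interpret alg: null_algebra3 zeta1 zeta2 DA DB phi1 phi2 riem by (rule algebra3)
  have z: "fr2 (E p) (\<lambda>a b. 0) i j = 0" for i j by (simp add: fr2_def)
  show "lie_derivative2 (raise g Z1) A p a b = 0"
  proof (rule fr2_inject[OF inv_p, of "lie_derivative2 (raise g Z1) A p" "\<lambda>a b. 0"])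
    show "fr2 (E p) (lie_derivative2 (raise g Z1) A p) i j = fr2 (E p) (\<lambda>a b. 0) i j" for i j
      unfolding fr2_lie_derivative[of Z1, OF smooth_Z1] z
      using alg.lie_zero(1)[of i j] assms unfolding obstruction_def by simp
  qed
  show "lie_derivative2 (raise g Z2) A p a b = 0"
  proof (rule fr2_inject[OF inv_p, of "lie_derivative2 (raise g Z2) A p" "\<lambda>a b. 0"])
    show "fr2 (E p) (lie_derivative2 (raise g Z2) A p) i j = fr2 (E p) (\<lambda>a b. 0) i j" for i j
      unfolding fr2_lie_derivative[of Z2, OF smooth_Z2] z
      using alg.lie_zero(2)[of i j] assms unfolding obstruction_def by simp
  qed
qed

end

section \<open>Smooth coefficients of the Ricci tensor and the passage from points to all of
  \<open>M\<close>\<close>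

context null_cky
begin

text \<open>Projects \<open>Ric - Lambda g\<close> onto l l in the Euclidean product of coordinate
  components. The metric product cannot serve, because l is null and so l l has metric norm
  zero.\<close>

definition sigma :: "point \<Rightarrow> real" where
  "sigma p = (\<Sum>a\<in>UNIV. \<Sum>b\<in>UNIV. (ricci g p a b - Lambda_of g p * g p $ a $ b) * fundamental_square A p a b) /
    (\<Sum>a\<in>UNIV. \<Sum>b\<in>UNIV. (fundamental_square A p a b)\<^sup>2)"

lemma smooth_fundamental_square: "smooth_on M (\<lambda>x. fundamental_square A x a b)"
  unfolding fundamental_square_def by (intro smooth_tr_g smooth_on_mult smooth_A open_M)

lemma fundamental_square_norm_nonzero:
  assumes "p \<in> M"
  shows "(\<Sum>a\<in>UNIV. \<Sum>b\<in>UNIV. (fundamental_square A p a b)\<^sup>2) \<noteq> 0"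
proof
  assume "(\<Sum>a\<in>UNIV. \<Sum>b\<in>UNIV. (fundamental_square A p a b)\<^sup>2) = 0"
  then have "\<forall>a b. fundamental_square A p a b = 0" by (simp add: sum_nonneg_eq_0_iff sum_nonneg)
  moreover obtain E U where "null_cky_frame M g os A p E U" using exists_frame[OF assms] by blast
  ultimately show False using null_cky_frame.fundamental_square_nonzero_p by blast
qed

lemma smooth_sigma: "smooth_on M sigma"
  unfolding sigma_def[abs_def] power2_eq_square
  using fundamental_square_norm_nonzero unfolding power2_eq_square
  by (intro smooth_on_divide smooth_on_sum smooth_on_mult smooth_on_diff smooth_ricci smooth_Lambda smooth_metric
      smooth_fundamental_square open_M) auto

lemma ricci_eq:
  assumes p: "p \<in> M"
  shows "ricci g p a b = sigma p * fundamental_square A p a b + Lambda_of g p * g p $ a $ b"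
proof -
  obtain E U where "null_cky_frame M g os A p E U" using exists_frame[OF p] by blast
  then interpret F: null_cky_frame M g os A p E U .
  have 1: "ricci g p a b - Lambda_of g p * g p $ a $ b = 2 * F.riem 2 3 2 3 * fundamental_square A p a b" for a b
    using F.ricci_eq_p by simp
  have "sigma p = 2 * F.riem 2 3 2 3"
    using fundamental_square_norm_nonzero[OF p] unfolding sigma_def 1
    by (simp add: sum_distrib_left[symmetric] power2_eq_square mult.assoc)
  then show ?thesis using 1[of a b] by simp
qed

lemma riemann_if_dLambda_zero:
  assumes p: "p \<in> M" and d: "\<And>a. pd a (Lambda_of g) p = 0"
  shows "riemann g p a b c d = Lambda_of g p / 3 * Gtensor g p a b c d"
proof -
  obtain E U where "null_cky_frame M g os A p E U" using exists_frame[OF p] by blast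
  then interpret F: null_cky_frame M g os A p E U .
  show ?thesis by (rule F.constant_curvature_p[OF F.dLambda_p[OF d]])
qed

lemma dLambda_nonzero_at:
  assumes "p \<in> M" "\<not> constant_curvature_on {p} g"
  shows "\<exists>a. pd a (Lambda_of g) p \<noteq> 0"
proof (rule ccontr)
  assume "\<not> ?thesis"
  then have "riemann g p a b c d = Lambda_of g p / 3 * Gtensor g p a b c d" for a b c d
    using riemann_if_dLambda_zero[OF assms(1)] by blast
  then show False using assms(2) unfolding constant_curvature_on_def by blast
qed

text \<open>Otherwise \<open>Lambda_of g\<close> is a constant \<open>c\<close> on the connected set
  \<open>M\<close>, and the curvature is \<open>c / 3\<close> everywhere.\<close>

lemma dLambda_nonzero:
  assumes conn: "connected M" and not_const: "\<not> constant_curvature_on M g"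
  shows "\<exists>p\<in>M. \<exists>a. pd a (Lambda_of g) p \<noteq> 0"
proof (rule ccontr)
  assume "\<not> ?thesis"
  then have d: "pd a (Lambda_of g) p = 0" if "p \<in> M" for p a using that by blast
  obtain c where "\<forall>p\<in>M. Lambda_of g p = c"
    using constant_if_pd_zero[OF open_M conn smooth_Lambda d] by blast
  then have "\<forall>p\<in>M. \<forall>a b c' d. riemann g p a b c' d = c / 3 * Gtensor g p a b c' d"
    using riemann_if_dLambda_zero d by auto
  then show False using not_const unfolding constant_curvature_on_def by blast
qed

lemma defect_zero:
  assumes conn: "connected M" and not_const: "\<not> constant_curvature_on M g" and p: "p \<in> M"
  shows "defect p = 0"
proof -
  have "pd a defect x = 0" if x: "x \<in> M" for x a
  proof -
    obtain E U where "null_cky_frame M g os A x E U" using exists_frame[OF x] by blast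
    then show ?thesis by (rule null_cky_frame.pd_defect_p)
  qed
  then obtain c where c: "\<forall>p\<in>M. defect p = c"
    using constant_if_pd_zero[OF open_M conn smooth_defect] by blast
  obtain q a where q: "q \<in> M" "pd a (Lambda_of g) q \<noteq> 0"
    using dLambda_nonzero[OF conn not_const] by blast
  obtain E U where "null_cky_frame M g os A q E U" using exists_frame[OF q(1)] by blast
  then interpret F: null_cky_frame M g os A q E U .
  interpret alg: null_algebra4 F.zeta1 F.zeta2 F.DA F.DB F.phi1 F.phi2 F.riem F.Dphi1 F.Dphi2 "\<lambda>l. F.dE l (Lambda_of g)"
    by (rule F.algebra4)
  have "F.riem 2 3 2 3 \<noteq> 0"
  proof
    assume "F.riem 2 3 2 3 = 0"
    then have "\<forall>l. F.dE l (Lambda_of g) = 0" unfolding forall_4 using alg.dL_values by simp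
    then have "fr1 (E q) (\<lambda>a. pd a (Lambda_of g) q) l = fr1 (E q) (\<lambda>a. 0) l" for l unfolding F.dE_def by simp
    then have "pd a (Lambda_of g) q = 0" by (rule fr1_inject[OF F.inv_p])
    then show False using q(2) by simp
  qed
  \<comment> \<open>The constraint forces the obstruction to vanish at \<open>q\<close>, where the
    curvature component is nonzero; constancy of \<open>defect\<close> spreads this over
    \<open>M\<close>, including points where that component is zero.\<close>
  then have "F.obstruction = 0" using F.obstruction_curvature by simp
  then have "defect q = 0" using F.defect_p by simp
  then show ?thesis using c q(1) p by simp
qed

lemma invariance:
  assumes "connected M" "\<not> constant_curvature_on M g" and p: "p \<in> M"
  shows "lie_bracket (raise g Z1) (raise g Z2) p a = 0" "lie_derivative2 (raise g Z1) A p a b = 0"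
    "lie_derivative2 (raise g Z2) A p a b = 0"
proof -
  obtain E U where "null_cky_frame M g os A p E U" using exists_frame[OF p] by blast
  then interpret F: null_cky_frame M g os A p E U .
  have "F.obstruction = 0" using defect_zero[OF assms] F.defect_p by simp
  then show "lie_bracket (raise g Z1) (raise g Z2) p a = 0" "lie_derivative2 (raise g Z1) A p a b = 0"
    "lie_derivative2 (raise g Z2) A p a b = 0"
    by (rule F.bracket_p F.lie_derivative_p)+
qed

lemma weyl_zero:
  assumes "p \<in> M"
  shows "weyl g p a b c d = 0"
  using exists_frame[OF assms] null_cky_frame.weyl_zero_p by blast

lemma exists_fundamental:
  assumes "p \<in> M"
  shows "\<exists>l. fundamental_vector_at g os A p l"
  using exists_frame[OF assms] null_cky_frame.exists_fundamental_p by blast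

text \<open>The squares of \<open>A\<close> and of its dual coincide, so their sum
  \<open>2 * (l a * l b)\<close> identifies each of them with \<open>l a * l b\<close>, whichever
  fundamental vector is taken.\<close>

lemma ricci_fundamental:
  assumes p: "p \<in> M" and l: "fundamental_vector_at g os A p l"
  shows "ricci g p a b = sigma p * l a * l b + Lambda_of g p * g p $ a $ b"
proof -
  obtain E U where "null_cky_frame M g os A p E U" using exists_frame[OF p] by blast
  then have "fundamental_square B p a b = fundamental_square A p a b" by (rule null_cky_frame.fundamental_square_dual_p)
  then have "fundamental_square A p a b = l a * l b" using fundamental_vector_product[OF p l, of a b] by simp
  then show ?thesis using ricci_eq[OF p, of a b] by simp
qed

end

theorem proposition3:
  fixes M :: "point set" and g :: metric and os :: real
    and A :: "real form2" and Z1 Z2 :: "real form1"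
  assumes spacetime: "oriented_spacetime M g os"
    and not_constant_curvature: "\<not> constant_curvature_on M g"
    and cky: "cky_tensor_on M g os A"
    and null: "\<forall>p\<in>M. null_two_form_at g os A p"
    and Z1: "Z1 = codiff g A"
    and Z2: "Z2 = codiff g (hodge g os A)"
    and killing1: "killing_vector_on M g (raise g Z1)"
    and killing2: "killing_vector_on M g (raise g Z2)"
    and independent: "\<forall>p\<in>M. \<exists>a b. wedge (Z1 p) (Z2 p) a b \<noteq> 0"
  shows
    "(\<forall>p\<in>M. \<forall>a. lie_bracket (raise g Z1) (raise g Z2) p a = 0) \<and>
     (\<forall>p\<in>M. \<forall>a b. lie_derivative2 (raise g Z1) A p a b = 0
                 \<and> lie_derivative2 (raise g Z2) A p a b = 0) \<and>
     (\<forall>p\<in>M. \<forall>a b c d. weyl g p a b c d = 0) \<and>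
     (\<exists>\<sigma> \<Lambda>. smooth_on M \<sigma> \<and> smooth_on M \<Lambda> \<and>
        (\<forall>p\<in>M. (\<exists>l. fundamental_vector_at g os A p l) \<and>
           (\<forall>l. fundamental_vector_at g os A p l \<longrightarrow>
              (\<forall>a b. ricci g p a b = \<sigma> p * l a * l b + \<Lambda> p * g p $ a $ b))) \<and>
        (\<exists>p\<in>M. \<exists>a. pd a \<Lambda> p \<noteq> 0) \<and>
        (\<forall>p\<in>M. \<not> constant_curvature_on {p} g \<longrightarrow> (\<exists>a. pd a \<Lambda> p \<noteq> 0)))"
proof -
  interpret null_cky M g os A
    using assms unfolding oriented_spacetime_def by unfold_locales auto
  have conn: "connected M" using spacetime unfolding oriented_spacetime_def by blast
  note inv = invariance[OF conn not_constant_curvature, folded Z1, folded Z2]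
  show ?thesis
    by (intro conjI exI[of _ sigma] exI[of _ "Lambda_of g"] smooth_sigma smooth_Lambda ballI allI impI
        inv weyl_zero exists_fundamental ricci_fundamental dLambda_nonzero_at
        dLambda_nonzero[OF conn not_constant_curvature])
qed

end
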